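(* Let $M$ be either $B_n^+$ or $B_n^{+*}$ ($n\ge2$). For a real $p\ge0$, there exists a uniform measure of parameter $p$ on $\overline M$ if and only if $p\in[0,q_n]\cup\{1\}$, and for each such $p$ it is unique; denote it $\nu_p$. Moreover: (1) $\nu_0$ is the Dirac measure at $\mathbf e$. (2) $\nu_1$ is the Dirac measure at the element $\Delta^\infty\in\overline M$, the constant sequence $(\Delta,\Delta,\dots)$. (3) For $p\in(0,q_n)$, $\nu_p$ is supported by $M$, and it is characterized equivalently by $\nu_p(\{x\})=H_n(p)\,p^{|x|}$ for all $x\in M$, or by $\nu_p(\Uparrow x)=p^{|x|}$ for all $x\in M$. (4) For $p=q_n$, $\nu_{q_n}$ is supported by $\partial M$, and it is the unique probability measure on $\overline M$ satisfying $\nu_{q_n}(\uparrow x)=q_n^{|x|}$ for all $x\in M$.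
   Context: $M$ is either (a) the positive braid monoid $B_n^+$, generated by $\Sigma=\{\sigma_1,\dots,\sigma_{n-1}\}$ with relations $\sigma_i\sigma_j=\sigma_j\sigma_i$ for $|i-j|\ge2$, $\sigma_i\sigma_j\sigma_i=\sigma_j\sigma_i\sigma_j$ for $|i-j|=1$; or (b) the dual braid monoid $B_n^{+*}$, generated by $\Sigma=\{\sigma_{i,j}:1\le i<j\le n\}$ ($\sigma_{j,i}=\sigma_{i,j}$) with relations $\sigma_{i,j}\sigma_{j,k}=\sigma_{j,k}\sigma_{k,i}=\sigma_{k,i}\sigma_{i,j}$ for $i<j<k$ and $\sigma_{i,j}\sigma_{k,\ell}=\sigma_{k,\ell}\sigma_{i,j}$ whenever $i<j<k<\ell$ or $i<k<\ell<j$. Unit $\mathbf e$; $|x|$ word length; $x\le_l y$ iff $y=xz$. $M$ is a Garside monoid; $\Delta_X$ is the least upper bound of $X\subseteq\Sigma$ for $\le_l$, $\Delta=\Delta_\Sigma$, $\mathcal S_n$ the set of left divisors of $\Delta$. For $x\in\mathcal S_n$, $\mathsf R(x)=\{\sigma\in\Sigma:x\sigma\notin\mathcal S_n\}$, $\mathsf L(x)=\{\sigma\in\Sigma:\sigma\le_l x\}$, $x\to y$ iff $\mathsf L(y)\subseteq\mathsf R(x)$. Every $x\neq\mathbf e$ has a unique Garside normal form $(x_1,\dots,x_k)$ (non-unit simple braids, $x=x_1\cdots x_k$, $x_i\to x_{i+1}$); the normal form of $\mathbf e$ is $(\mathbf e)$. $G_n(t)=\sum_{x\in M}t^{|x|}$,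 $H_n(t)=\sum_{X\subseteq\Sigma}(-1)^{|X|}t^{|\Delta_X|}$ (so that $G_n=1/H_n$), and $q_n$ is the radius of convergence of $G_n$. $\overline M$ is the set of sequences $(\xi_k)_{k\ge1}$ in $\mathcal S_n$ with $\xi_k\to\xi_{k+1}$ for all $k$, with product topology ($\mathcal S_n$ discrete) and Borel $\sigma$-algebra; $M$ is identified with sequences eventually equal to $\mathbf e$ via $x\mapsto$ its normal form followed by infinitely many $\mathbf e$; $\partial M=\overline M\setminus M$. $\Uparrow x$ is the closure in $\overline M$ of $\{xz:z\in M\}$ and $\uparrow x=\Uparrow x\cap\partial M$. A uniform measure of parameter $p\ge0$ is a probability measure $\nu$ on $\overline M$ with $\nu(\Uparrow x)=p^{|x|}$ for all $x\in M$. *)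

theory Defs
  imports "HOL-Analysis.Analysis" "HOL-Probability.Probability"
begin

text \<open>Which monoid: the positive braid monoid (Artin) or the dual braid monoid (Dual).
  A generator is encoded as a pair (i,j) with i<j: sigma_i of B_n^+ is (i,i+1),
  sigma_{i,j} of the dual monoid is (min i j, max i j).\<close>

datatype mkind = Artin | Dual

type_synonym gen = "nat \<times> nat"
type_synonym elt = "gen list set"

definition sg :: "nat \<Rightarrow> nat \<Rightarrow> gen" where
  "sg i j = (min i j, max i j)"

definition gens :: "mkind \<Rightarrow> nat \<Rightarrow> gen set" where
  "gens k n = (case k of
      Artin \<Rightarrow> {(i, i + 1) | i. 1 \<le> i \<and> i + 1 \<le> n}
    | Dual \<Rightarrow> {(i, j) | i j. 1 \<le> i \<and> i < j \<and> j \<le> n})"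

definition rels :: "mkind \<Rightarrow> nat \<Rightarrow> (gen list \<times> gen list) set" where
  "rels k n = (case k of
      Artin \<Rightarrow>
        {([(i, i+1), (j, j+1)], [(j, j+1), (i, i+1)]) | i j.
            1 \<le> i \<and> i < n \<and> 1 \<le> j \<and> j < n \<and> (i + 2 \<le> j \<or> j + 2 \<le> i)}
        \<union> {([(i, i+1), (j, j+1), (i, i+1)], [(j, j+1), (i, i+1), (j, j+1)]) | i j.
            1 \<le> i \<and> i < n \<and> 1 \<le> j \<and> j < n \<and> (i = j + 1 \<or> j = i + 1)}
    | Dual \<Rightarrow>
        {([sg i j, sg j k], [sg j k, sg k i]) | i j k. 1 \<le> i \<and> i < j \<and> j < k \<and> k \<le> n}
        \<union> {([sg j k, sg k i], [sg k i, sg i j]) | i j k. 1 \<le> i \<and> i < j \<and> j < k \<and> k \<le> n}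
        \<union> {([sg i j, sg k l], [sg k l, sg i j]) | i j k l.
            1 \<le> i \<and> i < j \<and> j \<le> n \<and> 1 \<le> k \<and> k < l \<and> l \<le> n \<and>
            ((i < j \<and> j < k \<and> k < l) \<or> (i < k \<and> k < l \<and> l < j))})"

inductive beq :: "(gen list \<times> gen list) set \<Rightarrow> gen list \<Rightarrow> gen list \<Rightarrow> bool" for R where
  beq_refl: "beq R w w"
| beq_step: "\<lbrakk>(u, v) \<in> R \<or> (v, u) \<in> R; beq R w (a @ u @ b)\<rbrakk> \<Longrightarrow> beq R w (a @ v @ b)"

definition cls :: "mkind \<Rightarrow> nat \<Rightarrow> gen list \<Rightarrow> elt" where
  "cls k n w = {v. beq (rels k n) w v}"

definition Mon :: "mkind \<Rightarrow> nat \<Rightarrow> elt set" where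
  "Mon k n = cls k n ` lists (gens k n)"

definition unit_e :: "mkind \<Rightarrow> nat \<Rightarrow> elt" where
  "unit_e k n = cls k n []"

definition gel :: "mkind \<Rightarrow> nat \<Rightarrow> gen \<Rightarrow> elt" where
  "gel k n s = cls k n [s]"

definition mmul :: "mkind \<Rightarrow> nat \<Rightarrow> elt \<Rightarrow> elt \<Rightarrow> elt" where
  "mmul k n x y = cls k n ((SOME u. u \<in> x) @ (SOME v. v \<in> y))"

definition mprod :: "mkind \<Rightarrow> nat \<Rightarrow> elt list \<Rightarrow> elt" where
  "mprod k n xs = foldr (mmul k n) xs (unit_e k n)"

definition blen :: "elt \<Rightarrow> nat" where
  "blen x = (LEAST m. \<exists>w\<in>x. length w = m)"

definition ldiv :: "mkind \<Rightarrow> nat \<Rightarrow> elt \<Rightarrow> elt \<Rightarrow> bool" where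
  "ldiv k n x y \<longleftrightarrow> (\<exists>z \<in> Mon k n. y = mmul k n x z)"

definition DeltaX :: "mkind \<Rightarrow> nat \<Rightarrow> gen set \<Rightarrow> elt" where
  "DeltaX k n X = (THE d. d \<in> Mon k n \<and> (\<forall>s\<in>X. ldiv k n (gel k n s) d) \<and>
      (\<forall>m\<in>Mon k n. (\<forall>s\<in>X. ldiv k n (gel k n s) m) \<longrightarrow> ldiv k n d m))"

definition Delta :: "mkind \<Rightarrow> nat \<Rightarrow> elt" where
  "Delta k n = DeltaX k n (gens k n)"

definition Simples :: "mkind \<Rightarrow> nat \<Rightarrow> elt set" where
  "Simples k n = {x \<in> Mon k n. ldiv k n x (Delta k n)}"

definition Rset :: "mkind \<Rightarrow> nat \<Rightarrow> elt \<Rightarrow> gen set" where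
  "Rset k n x = {s \<in> gens k n. mmul k n x (gel k n s) \<notin> Simples k n}"

definition Lset :: "mkind \<Rightarrow> nat \<Rightarrow> elt \<Rightarrow> gen set" where
  "Lset k n x = {s \<in> gens k n. ldiv k n (gel k n s) x}"

definition arrow :: "mkind \<Rightarrow> nat \<Rightarrow> elt \<Rightarrow> elt \<Rightarrow> bool" where
  "arrow k n x y \<longleftrightarrow> Lset k n y \<subseteq> Rset k n x"

definition Mbar :: "mkind \<Rightarrow> nat \<Rightarrow> (nat \<Rightarrow> elt) set" where
  "Mbar k n = {\<xi>. (\<forall>i. \<xi> i \<in> Simples k n) \<and> (\<forall>i. arrow k n (\<xi> i) (\<xi> (Suc i)))}"

text \<open>Embedding of M into Mbar: the normal form padded with units.\<close>
definition nfs :: "mkind \<Rightarrow> nat \<Rightarrow> elt \<Rightarrow> (nat \<Rightarrow> elt)" where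
  "nfs k n x = (THE \<xi>. \<xi> \<in> Mbar k n \<and>
      (\<exists>N. (\<forall>i\<ge>N. \<xi> i = unit_e k n) \<and> mprod k n (map \<xi> [0..<N]) = x))"

definition Mimg :: "mkind \<Rightarrow> nat \<Rightarrow> (nat \<Rightarrow> elt) set" where
  "Mimg k n = nfs k n ` Mon k n"

definition bdry :: "mkind \<Rightarrow> nat \<Rightarrow> (nat \<Rightarrow> elt) set" where
  "bdry k n = Mbar k n - Mimg k n"

definition Tbar :: "mkind \<Rightarrow> nat \<Rightarrow> (nat \<Rightarrow> elt) topology" where
  "Tbar k n = subtopology (product_topology (\<lambda>_. discrete_topology (Simples k n)) UNIV) (Mbar k n)"

definition borel_of_top :: "'a topology \<Rightarrow> 'a measure" where
  "borel_of_top T = sigma (topspace T) {U. openin T U}"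

definition Bbar :: "mkind \<Rightarrow> nat \<Rightarrow> (nat \<Rightarrow> elt) measure" where
  "Bbar k n = borel_of_top (Tbar k n)"

definition Up :: "mkind \<Rightarrow> nat \<Rightarrow> elt \<Rightarrow> (nat \<Rightarrow> elt) set" where
  "Up k n x = Tbar k n closure_of {nfs k n (mmul k n x z) | z. z \<in> Mon k n}"

definition up :: "mkind \<Rightarrow> nat \<Rightarrow> elt \<Rightarrow> (nat \<Rightarrow> elt) set" where
  "up k n x = Up k n x \<inter> bdry k n"

definition prob_on :: "mkind \<Rightarrow> nat \<Rightarrow> (nat \<Rightarrow> elt) measure \<Rightarrow> bool" where
  "prob_on k n \<nu> \<longleftrightarrow> prob_space \<nu> \<and> sets \<nu> = sets (Bbar k n)"

definition uniform :: "mkind \<Rightarrow> nat \<Rightarrow> real \<Rightarrow> (nat \<Rightarrow> elt) measure \<Rightarrow> bool" where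
  "uniform k n p \<nu> \<longleftrightarrow> prob_on k n \<nu> \<and> (\<forall>x\<in>Mon k n. measure \<nu> (Up k n x) = p ^ blen x)"

definition qn :: "mkind \<Rightarrow> nat \<Rightarrow> real" where
  "qn k n = real_of_ereal (conv_radius (\<lambda>m. real (card {x \<in> Mon k n. blen x = m})))"

definition Hn :: "mkind \<Rightarrow> nat \<Rightarrow> real \<Rightarrow> real" where
  "Hn k n t = (\<Sum>X\<in>Pow (gens k n). (-1) ^ card X * t ^ blen (DeltaX k n X))"

end

theory Submission
  imports Defs
begin

text \<open>
  The simple elements of both monoids are modelled by a finite automaton: permutations with adjacent swaps at
  descents for \<open>B\<^sub>n\<^sup>+\<close>, noncrossing partitions cut along chords for the dual monoid. In this model any two
  generators have a join, hence so have any two simple elements, and an induction on the word length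
  transfers joins and left cancellation to the presented monoid.

  Inclusion-exclusion shows that a uniform measure of parameter \<open>p\<close> gives the cylinder of a normal
  sequence \<open>(x\<^sub>1, \<dots>, x\<^sub>k)\<close> with product \<open>x\<close> the mass \<open>p\<^bsup>|x|\<^esup> g\<^sub>p(x\<^sub>k)\<close> for an explicit polynomial \<open>g\<^sub>p\<close> in \<open>p\<close>;
  this gives uniqueness, and \<open>g\<^sub>p(e) = H\<^sub>n(p)\<close>. For \<open>p < q\<^sub>n\<close> the measure with masses \<open>H\<^sub>n(p) p\<^bsup>|x|\<^esup>\<close> on \<open>M\<close> is
  uniform because \<open>G\<^sub>n H\<^sub>n = 1\<close>. At \<open>p = q\<^sub>n\<close> the polynomials \<open>g\<^sub>p\<close> are still nonnegative by continuity, and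
  they define a Markov chain on simple elements whose law is uniform. Submultiplicativity of the
  number of elements of given length makes \<open>G\<^sub>n\<close> diverge for \<open>p \<ge> q\<^sub>n\<close>, which forces \<open>H\<^sub>n(p) = 0\<close>.
  Finally, for \<open>q\<^sub>n < p < 1\<close> the graph of simple elements is connected enough to make \<open>g\<^sub>p\<close> positive off
  \<open>e\<close>, so that the sum of \<open>p\<^bsup>|x|\<^esup>\<close> over the \<open>x\<close> with \<open>k\<close> factors is bounded in \<open>k\<close>; comparing it with the
  same sum at \<open>q\<^sub>n\<close>, which is at least \<open>1\<close>, shows that it grows like \<open>(p / q\<^sub>n)\<^sup>k\<close>, a contradiction.
\<close>

section \<open>Alternating sums, growth rates and Markov chains\<close>

lemma sum_Pow_alternating:
  assumes "finite A"
  shows "(\<Sum>X\<in>Pow A. (- 1) ^ card X) = (if A = {} then 1 else 0 :: 'a :: comm_ring_1)"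
  using prod_diff_conv_sum[OF assms, of "\<lambda>_. 1 :: 'a" "\<lambda>_. 1"] assms by (simp add: power_0_left)

lemma (in finite_measure) measure_Diff_UN_inclusion_exclusion:
  assumes "finite A" and U: "U \<in> sets M" and V: "\<And>a. a \<in> A \<Longrightarrow> V a \<in> sets M"
  shows "measure M (U - (\<Union>a\<in>A. V a)) = (\<Sum>X\<in>Pow A. (- 1) ^ card X * measure M (U \<inter> (\<Inter>a\<in>X. V a)))"
proof -
  interpret Incl_Excl "\<lambda>S. S \<in> sets M" "\<lambda>S. measure M (U \<inter> S)"
  proof
    fix S T assume "S \<in> sets M" "T \<in> sets M" "disjnt S T"
    then show "measure M (U \<inter> (S \<union> T)) = measure M (U \<inter> S) + measure M (U \<inter> T)"
      unfolding Int_Un_distrib using U by (intro finite_measure_Union) (auto simp: disjnt_def)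
  qed auto
  have "(\<Union>a\<in>A. V a) \<in> sets M" using \<open>finite A\<close> V by (rule sets.finite_UN)
  then have "measure M (U - (\<Union>a\<in>A. V a)) = measure M U - measure M (U \<inter> (\<Union>a\<in>A. V a))"
    using finite_measure_Diff[of U "U \<inter> (\<Union>a\<in>A. V a)"] U by (simp add: Diff_Int)
  also have "measure M (U \<inter> (\<Union>a\<in>A. V a)) =
      (\<Sum>X\<in>Pow A - {{}}. (- 1) ^ (card X + 1) * measure M (U \<inter> (\<Inter>a\<in>X. V a)))"
    using restricted_indexed[OF \<open>finite A\<close> V] by (simp add: Pow_def set_diff_eq)
  finally show ?thesis
    using \<open>finite A\<close> by (simp add: sum.remove[of "Pow A" "{}"] sum_negf)
qed

lemma submultiplicative_power_le:
  fixes a :: "nat \<Rightarrow> real"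
  assumes "\<And>m. 0 \<le> a m" and submult: "\<And>m l. a (m + l) \<le> a m * a l"
  shows "a (j * m + i) \<le> a m ^ j * a i"
proof (induction j)
  case (Suc j)
  have "a (Suc j * m + i) \<le> a m * a (j * m + i)" using submult[of m "j * m + i"] by (simp add: add.assoc)
  also have "\<dots> \<le> a m * (a m ^ j * a i)" using Suc assms(1) by (rule mult_left_mono)
  finally show ?case by (simp add: mult.assoc)
qed simp

lemma submultiplicative_conv_radius_ge:
  fixes a :: "nat \<Rightarrow> real"
  assumes nonneg: "\<And>m. 0 \<le> a m" and submult: "\<And>m l. a (m + l) \<le> a m * a l"
    and "0 < r" "0 < m" "a m * r ^ m \<le> 1"
  shows "ereal r \<le> conv_radius a"
proof -
  define C where "C = (\<Sum>i<m. a i * r ^ i)"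
  have bounded: "a i * r ^ i \<le> C" for i
  proof -
    have i: "i = (i div m) * m + i mod m" by simp
    have "a i * r ^ i \<le> (a m ^ (i div m) * a (i mod m)) * r ^ i"
      using submultiplicative_power_le[of a, OF nonneg submult, of "i div m" m "i mod m"] \<open>0 < r\<close>
      by (intro mult_right_mono) auto
    also have "\<dots> = (a m * r ^ m) ^ (i div m) * (a (i mod m) * r ^ (i mod m))"
    proof -
      have "r ^ i = (r ^ m) ^ (i div m) * r ^ (i mod m)"
        by (subst i) (simp only: power_add power_mult mult.commute[of "i div m" m])
      then show ?thesis by (simp add: power_mult_distrib)
    qed
    also have "\<dots> \<le> 1 * (a (i mod m) * r ^ (i mod m))"
      using assms by (intro mult_right_mono power_le_one) auto
    also have "\<dots> \<le> C" unfolding C_def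
      using assms member_le_sum[of "i mod m" "{..<m}" "\<lambda>i. a i * r ^ i"] by auto
    finally show ?thesis .
  qed
  show ?thesis
  proof (rule conv_radius_geI_ex')
    fix r' :: real assume r': "0 < r'" "ereal r' < ereal r"
    have le: "norm (a i * of_real r' ^ i) \<le> C * (r' / r) ^ i" for i
    proof -
      have "a i * r' ^ i = (a i * r ^ i) * (r' / r) ^ i" using \<open>0 < r\<close> by (simp add: power_divide)
      also have "\<dots> \<le> C * (r' / r) ^ i" using bounded r' \<open>0 < r\<close> by (intro mult_right_mono) auto
      finally show ?thesis using nonneg[of i] r' by simp
    qed
    have "summable (\<lambda>i. C * (r' / r) ^ i)"
      using r' \<open>0 < r\<close> by (intro summable_mult summable_geometric) auto
    then show "summable (\<lambda>i. a i * of_real r' ^ i)"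
      using le by (rule summable_comparison_test'[where N = 0])
  qed
qed

lemma submultiplicative_ge_1_at_conv_radius:
  fixes a :: "nat \<Rightarrow> real"
  assumes pos: "\<And>m. 0 < a m" and submult: "\<And>m l. a (m + l) \<le> a m * a l"
    and R: "conv_radius a = ereal R" and "0 < m"
  shows "1 \<le> a m * R ^ m"
proof -
  define r where "r = root m (1 / a m)"
  have r: "0 < r" "a m * r ^ m = 1"
    using pos[of m] \<open>0 < m\<close> unfolding r_def by simp_all
  have "ereal r \<le> conv_radius a"
  proof (rule submultiplicative_conv_radius_ge)
    show "0 \<le> a l" for l using pos[of l] by simp
  qed (use r submult \<open>0 < m\<close> in auto)
  then have "a m * r ^ m \<le> a m * R ^ m"
    using r(1) pos[of m] unfolding R by (intro mult_left_mono power_mono) auto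
  then show ?thesis using r(2) by simp
qed

lemma ex_pmf_constant_on_fibres:
  fixes f :: "'a \<Rightarrow> nat" and c :: "nat \<Rightarrow> real"
  assumes fin: "\<And>m. finite {x \<in> A. f x = m}" and ne: "\<And>m. {x \<in> A. f x = m} \<noteq> {}"
    and c: "\<And>m. 0 \<le> c m" and total: "(\<lambda>m. real (card {x \<in> A. f x = m}) * c m) sums 1"
  shows "\<exists>Q. set_pmf Q \<subseteq> A \<and> (\<forall>x\<in>A. pmf Q x = c (f x))"
proof -
  define w where "w m = real (card {x \<in> A. f x = m}) * c m" for m
  have w: "0 \<le> w m" for m unfolding w_def using c by simp
  have "(\<Sum>m. ennreal (w m)) = ennreal 1"
    using w total unfolding w_def[symmetric] by (subst suminf_ennreal2) (auto simp: sums_iff)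
  then have "(\<integral>\<^sup>+m. ennreal (w m) \<partial>count_space UNIV) = 1" by (simp add: nn_integral_count_space_nat)
  then have pmf_N: "pmf (embed_pmf w) m = w m" for m using w by (intro pmf_embed_pmf) auto
  define Q where "Q = bind_pmf (embed_pmf w) (\<lambda>m. pmf_of_set {x \<in> A. f x = m})"
  have "pmf Q x = c (f x)" if "x \<in> A" for x
  proof -
    have card_pos: "0 < card {y \<in> A. f y = f x}" using fin ne card_gt_0_iff by blast
    have "ennreal (pmf Q x) = (\<integral>\<^sup>+m. ennreal (1 / real (card {y \<in> A. f y = f x})) * indicator {f x} m \<partial>embed_pmf w)"
      unfolding Q_def ennreal_pmf_bind using fin ne that
      by (intro nn_integral_cong) (auto simp: indicator_def)
    also have "\<dots> = ennreal (1 / real (card {y \<in> A. f y = f x})) * ennreal (w (f x))"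
      by (simp add: nn_integral_cmult_indicator emeasure_pmf_single pmf_N)
    also have "\<dots> = ennreal (c (f x))"
      using card_pos c by (simp add: w_def flip: ennreal_mult)
    finally show ?thesis using c by simp
  qed
  moreover have "set_pmf Q \<subseteq> A" unfolding Q_def using fin ne by auto
  ultimately show ?thesis by blast
qed

definition retract_into :: "'a set \<Rightarrow> 'a \<Rightarrow> 'a" where
  "retract_into A x = (if x \<in> A then x else (SOME y. y \<in> A))"

text \<open>A path is driven by independent choices \<open>\<omega> (i, x)\<close> of the state that follows \<open>x\<close> at time \<open>i\<close>.\<close>

primrec driven_path :: "('a \<Rightarrow> 'a set) \<Rightarrow> 'a \<Rightarrow> (nat \<times> 'a \<Rightarrow> 'a) \<Rightarrow> nat \<Rightarrow> 'a" where
  "driven_path T x\<^sub>0 \<omega> 0 = retract_into (T x\<^sub>0) (\<omega> (0, x\<^sub>0))"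
| "driven_path T x\<^sub>0 \<omega> (Suc i) = retract_into (T (driven_path T x\<^sub>0 \<omega> i)) (\<omega> (Suc i, driven_path T x\<^sub>0 \<omega> i))"

lemma driven_path_eq:
  "driven_path T x\<^sub>0 \<omega> i =
    retract_into (T (case_nat x\<^sub>0 (driven_path T x\<^sub>0 \<omega>) i)) (\<omega> (i, case_nat x\<^sub>0 (driven_path T x\<^sub>0 \<omega>) i))"
  by (cases i) auto

lemma driven_path_prefix_iff:
  "(\<forall>i<j. driven_path T x\<^sub>0 \<omega> i = \<zeta> i) \<longleftrightarrow>
    (\<forall>i<j. retract_into (T (case_nat x\<^sub>0 \<zeta> i)) (\<omega> (i, case_nat x\<^sub>0 \<zeta> i)) = \<zeta> i)"
proof (induction j)
  case (Suc j)
  have "driven_path T x\<^sub>0 \<omega> j = retract_into (T (case_nat x\<^sub>0 \<zeta> j)) (\<omega> (j, case_nat x\<^sub>0 \<zeta> j))"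
    if "\<forall>i<j. driven_path T x\<^sub>0 \<omega> i = \<zeta> i"
    using driven_path_eq[of T x\<^sub>0 \<omega> j] that by (cases j) auto
  then show ?case using Suc by (auto simp: less_Suc_eq)
qed simp

lemma measure_retract_into_pmf:
  assumes "set_pmf K \<subseteq> A"
  shows "measure (measure_pmf K) {y. retract_into A y = x} = pmf K x"
  unfolding measure_pmf_single[symmetric] using assms
  by (intro measure_pmf.finite_measure_eq_AE) (auto simp: AE_measure_pmf_iff retract_into_def)

lemma driven_path_in:
  assumes "\<And>x. T x \<noteq> {}" shows "driven_path T x\<^sub>0 \<omega> i \<in> T (case_nat x\<^sub>0 (driven_path T x\<^sub>0 \<omega>) i)"
  using driven_path_eq[of T x\<^sub>0 \<omega> i] assms unfolding retract_into_def by (simp add: some_in_eq)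

lemma driven_path_prefix_measure:
  fixes K :: "'a \<Rightarrow> 'a pmf" and T :: "'a \<Rightarrow> 'a set" and x\<^sub>0 :: 'a
  defines "PM \<equiv> PiM (UNIV :: (nat \<times> 'a) set) (\<lambda>i. measure_pmf (K (snd i)))"
  assumes supp: "\<And>x. set_pmf (K x) \<subseteq> T x"
  shows "{\<omega> \<in> space PM. \<forall>i<j. driven_path T x\<^sub>0 \<omega> i = \<zeta> i} \<in> sets PM"
    and "measure PM {\<omega> \<in> space PM. \<forall>i<j. driven_path T x\<^sub>0 \<omega> i = \<zeta> i} =
      (\<Prod>i<j. pmf (K (case_nat x\<^sub>0 \<zeta> i)) (\<zeta> i))"
proof -
  define D where "D i = measure_pmf (K (snd i))" for i :: "nat \<times> 'a"
  interpret D: product_prob_space D UNIV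
    unfolding D_def by (intro product_prob_spaceI measure_pmf.prob_space_axioms)
  have PM: "PM = PiM UNIV D" unfolding PM_def D_def by simp
  define J where "J = (\<lambda>i. (i, case_nat x\<^sub>0 \<zeta> i)) ` {..<j}"
  define allowed where "allowed i = {y. retract_into (T (snd i)) y = \<zeta> (fst i)}" for i :: "nat \<times> 'a"
  have prefix: "{\<omega> \<in> space PM. \<forall>i<j. driven_path T x\<^sub>0 \<omega> i = \<zeta> i} = {\<omega> \<in> space PM. \<forall>i\<in>J. \<omega> i \<in> allowed i}"
    using driven_path_prefix_iff[of j T x\<^sub>0 _ \<zeta>] unfolding allowed_def J_def by auto
  show "{\<omega> \<in> space PM. \<forall>i<j. driven_path T x\<^sub>0 \<omega> i = \<zeta> i} \<in> sets PM"
    unfolding prefix unfolding PM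
    by (intro sets.sets_Collect_finite_All sets_Collect_single') (auto simp: J_def D_def)
  have inj: "inj_on (\<lambda>i. (i, case_nat x\<^sub>0 \<zeta> i)) {..<j}" by (auto simp: inj_on_def)
  have "measure PM {\<omega> \<in> space PM. \<forall>i\<in>J. \<omega> i \<in> allowed i} = (\<Prod>i\<in>J. measure (D i) (allowed i))"
    using D.emeasure_PiM_Collect[of J allowed]
    unfolding PM D.emeasure_eq_measure D.M.emeasure_eq_measure
    by (simp add: J_def D_def prod_ennreal prod_nonneg)
  also have "\<dots> = (\<Prod>i<j. pmf (K (case_nat x\<^sub>0 \<zeta> i)) (\<zeta> i))"
    using supp unfolding J_def
    by (subst prod.reindex[OF inj]) (simp add: D_def allowed_def measure_retract_into_pmf)
  finally show "measure PM {\<omega> \<in> space PM. \<forall>i<j. driven_path T x\<^sub>0 \<omega> i = \<zeta> i} =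
      (\<Prod>i<j. pmf (K (case_nat x\<^sub>0 \<zeta> i)) (\<zeta> i))" unfolding prefix .
qed

lemma ex_markov_chain:
  fixes K :: "'a \<Rightarrow> 'a pmf" and T :: "'a \<Rightarrow> 'a set" and x\<^sub>0 :: 'a
  assumes supp: "\<And>x. set_pmf (K x) \<subseteq> T x"
  defines "\<Omega> \<equiv> {\<xi>. \<forall>i. \<xi> i \<in> T (case_nat x\<^sub>0 \<xi> i)}"
  shows "\<exists>\<nu>. prob_space \<nu> \<and> sets \<nu> = sigma_sets \<Omega> {{\<eta> \<in> \<Omega>. \<forall>i<j. \<eta> i = \<zeta> i} | \<zeta> j. True} \<and>
    (\<forall>\<zeta> j. measure \<nu> {\<eta> \<in> \<Omega>. \<forall>i<j. \<eta> i = \<zeta> i} = (\<Prod>i<j. pmf (K (case_nat x\<^sub>0 \<zeta> i)) (\<zeta> i)))"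
proof -
  define PM where "PM = PiM (UNIV :: (nat \<times> 'a) set) (\<lambda>i. measure_pmf (K (snd i)))"
  interpret PM: prob_space PM
    unfolding PM_def by (intro prob_space_PiM measure_pmf.prob_space_axioms)
  define G where "G = {{\<eta> \<in> \<Omega>. \<forall>i<j. \<eta> i = \<zeta> i} | \<zeta> j. True}"
  define path where "path = driven_path T x\<^sub>0"
  have G: "G \<subseteq> Pow \<Omega>" unfolding G_def by auto
  have "T x \<noteq> {}" for x using supp[of x] set_pmf_not_empty[of "K x"] by blast
  then have path_\<Omega>: "path \<omega> \<in> \<Omega>" for \<omega> using driven_path_in[of T] unfolding path_def \<Omega>_def by blast
  have vimage: "path -` {\<eta> \<in> \<Omega>. \<forall>i<j. \<eta> i = \<zeta> i} \<inter> space PM = {\<omega> \<in> space PM. \<forall>i<j. path \<omega> i = \<zeta> i}" for \<zeta> j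
    using path_\<Omega> by auto
  have prefix: "{\<omega> \<in> space PM. \<forall>i<j. path \<omega> i = \<zeta> i} \<in> sets PM" for \<zeta> j
    unfolding PM_def path_def by (rule driven_path_prefix_measure(1)[OF supp])
  have "path -` A \<inter> space PM \<in> sets PM" if A: "A \<in> G" for A
  proof -
    obtain \<zeta> j where \<zeta>: "A = {\<eta> \<in> \<Omega>. \<forall>i<j. \<eta> i = \<zeta> i}" using A unfolding G_def by blast
    show ?thesis unfolding \<zeta> vimage by (rule prefix)
  qed
  then have meas: "path \<in> measurable PM (sigma \<Omega> G)"
    using path_\<Omega> G by (intro measurable_measure_of) auto
  have "measure (distr PM (sigma \<Omega> G) path) {\<eta> \<in> \<Omega>. \<forall>i<j. \<eta> i = \<zeta> i} =
      (\<Prod>i<j. pmf (K (case_nat x\<^sub>0 \<zeta> i)) (\<zeta> i))" for \<zeta> j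
  proof -
    have "{\<eta> \<in> \<Omega>. \<forall>i<j. \<eta> i = \<zeta> i} \<in> G" unfolding G_def by blast
    then have "measure (distr PM (sigma \<Omega> G) path) {\<eta> \<in> \<Omega>. \<forall>i<j. \<eta> i = \<zeta> i} =
        measure PM {\<omega> \<in> space PM. \<forall>i<j. path \<omega> i = \<zeta> i}"
      unfolding vimage[symmetric] using G by (intro measure_distr meas) auto
    also have "\<dots> = (\<Prod>i<j. pmf (K (case_nat x\<^sub>0 \<zeta> i)) (\<zeta> i))"
      unfolding PM_def path_def by (rule driven_path_prefix_measure(2)[OF supp])
    finally show ?thesis .
  qed
  moreover have "prob_space (distr PM (sigma \<Omega> G) path)" using meas by (rule PM.prob_space_distr)
  moreover have "sets (distr PM (sigma \<Omega> G) path) = sigma_sets \<Omega> G" using G by simp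
  ultimately show ?thesis unfolding G_def[symmetric] by blast
qed

section \<open>Presented monoids\<close>

lemma beq_trans: "beq R v w \<Longrightarrow> beq R u v \<Longrightarrow> beq R u w"
  by (induction rule: beq.induct) (auto intro: beq_step)

lemma beq_rel: "(u, v) \<in> R \<or> (v, u) \<in> R \<Longrightarrow> beq R (a @ u @ b) (a @ v @ b)"
  by (rule beq_step[OF _ beq_refl])

lemma beq_sym: "beq R u v \<Longrightarrow> beq R v u"
proof (induction rule: beq.induct)
  case (beq_step u v w a b)
  then show ?case using beq_trans beq_rel by blast
qed (rule beq_refl)

lemma beq_context: "beq R u v \<Longrightarrow> beq R (a @ u @ b) (a @ v @ b)"
proof (induction rule: beq.induct)
  case (beq_step u v w a' b')
  then show ?case using beq.beq_step[of u v R "a @ w @ b" "a @ a'" "b' @ b"] by simp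
qed (rule beq_refl)

lemma beq_Cons: "beq R u v \<Longrightarrow> beq R (s # u) (s # v)"
  using beq_context[of R u v "[s]" "[]"] by simp

lemma beq_append:
  assumes "beq R u u'" "beq R v v'"
  shows "beq R (u @ v) (u' @ v')"
  using beq_context[OF assms(1), of "[]" v] beq_context[OF assms(2), of u' "[]"] beq_trans by fastforce

lemma rels_length_and_letters:
  assumes "(u, v) \<in> rels k n"
  shows "length u = length v \<and> 2 \<le> length u \<and> u \<in> lists (gens k n) \<and> v \<in> lists (gens k n)"
proof (cases k)
  case Artin
  show ?thesis using assms unfolding Artin rels_def gens_def mkind.case by (elim UnE) auto
next
  case Dual
  show ?thesis using assms unfolding Dual rels_def gens_def mkind.case
    by (elim UnE) (auto simp: sg_def min_def max_def)
qed

lemma rels_ConsE: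
  assumes "(u, v) \<in> rels k n \<or> (v, u) \<in> rels k n"
  obtains s u' t v' where "u = s # u'" "v = t # v'"
  using assms rels_length_and_letters[of u v k n] rels_length_and_letters[of v u k n]
  by (cases u; cases v) auto

lemma beq_length: "beq (rels k n) u v \<Longrightarrow> length u = length v"
  by (induction rule: beq.induct) (auto dest: rels_length_and_letters)

lemma beq_lists_iff: "beq (rels k n) u v \<Longrightarrow> u \<in> lists (gens k n) \<longleftrightarrow> v \<in> lists (gens k n)"
  by (induction rule: beq.induct) (auto dest: rels_length_and_letters)

lemma beq_singleton: "beq (rels k n) u v \<Longrightarrow> length u = 1 \<Longrightarrow> u = v"
proof (induction rule: beq.induct)
  case (beq_step u v w a b)
  then have "2 \<le> length u" using rels_length_and_letters by metis
  moreover have "length (a @ u @ b) = 1" using beq_step by simp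
  ultimately show ?case by simp
qed simp

lemma finite_gens [simp]: "finite (gens k n)"
proof (rule finite_subset)
  show "gens k n \<subseteq> {..n} \<times> {..n}" by (cases k) (auto simp: gens_def)
qed simp

locale braid_monoid =
  fixes k :: mkind and n :: nat
begin

abbreviation "M \<equiv> Mon k n"
abbreviation "\<Sigma> \<equiv> gens k n"
abbreviation "\<sigma> \<equiv> gel k n"
abbreviation unit (\<open>\<one>\<close>) where "\<one> \<equiv> unit_e k n"
abbreviation mult (infixl \<open>\<odot>\<close> 70) where "x \<odot> y \<equiv> mmul k n x y"
abbreviation dvs (infix \<open>\<preceq>\<close> 50) where "x \<preceq> y \<equiv> ldiv k n x y"
abbreviation word_class (\<open>\<langle>_\<rangle>\<close>) where "\<langle>w\<rangle> \<equiv> cls k n w"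
abbreviation word_eq (infix \<open>\<doteq>\<close> 50) where "u \<doteq> v \<equiv> beq (rels k n) u v"

lemma cls_eq_iff: "\<langle>u\<rangle> = \<langle>v\<rangle> \<longleftrightarrow> u \<doteq> v"
proof
  assume "\<langle>u\<rangle> = \<langle>v\<rangle>"
  then have "v \<in> \<langle>u\<rangle>" by (simp add: cls_def beq_refl)
  then show "u \<doteq> v" by (simp add: cls_def)
next
  assume uv: "u \<doteq> v"
  have "u \<doteq> w \<longleftrightarrow> v \<doteq> w" for w
    using beq_trans[OF _ uv] beq_trans[OF _ beq_sym[OF uv]] by blast
  then show "\<langle>u\<rangle> = \<langle>v\<rangle>" by (simp add: cls_def)
qed

lemma mult_cls: "\<langle>u\<rangle> \<odot> \<langle>v\<rangle> = \<langle>u @ v\<rangle>"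
proof -
  have "w \<doteq> (SOME v. v \<in> \<langle>w\<rangle>)" for w by (rule someI2[of _ w]) (auto simp: cls_def beq_refl)
  then show ?thesis unfolding mmul_def cls_eq_iff by (meson beq_append beq_sym)
qed

lemma cls_Cons: "\<langle>s # w\<rangle> = \<sigma> s \<odot> \<langle>w\<rangle>"
  by (simp add: gel_def mult_cls)

lemma blen_cls [simp]: "blen \<langle>w\<rangle> = length w"
proof -
  have "(\<exists>v\<in>\<langle>w\<rangle>. length v = m) \<longleftrightarrow> m = length w" for m
    by (auto simp: cls_def dest: beq_length intro: exI[of _ w] beq_refl)
  then show ?thesis unfolding blen_def by (auto intro: Least_equality)
qed

lemma M_cases: assumes "x \<in> M" obtains w where "w \<in> lists \<Sigma>" "x = \<langle>w\<rangle>"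
  using assms unfolding Mon_def by blast

lemma cls_in_M [simp]: "\<langle>w\<rangle> \<in> M \<longleftrightarrow> w \<in> lists \<Sigma>"
proof
  assume "\<langle>w\<rangle> \<in> M"
  then obtain v where "v \<in> lists \<Sigma>" "\<langle>w\<rangle> = \<langle>v\<rangle>" by (rule M_cases)
  then show "w \<in> lists \<Sigma>" using beq_lists_iff by (simp only: cls_eq_iff)
qed (simp add: Mon_def)

lemma one_closed [simp]: "\<one> \<in> M" and gen_closed [simp]: "s \<in> \<Sigma> \<Longrightarrow> \<sigma> s \<in> M"
  by (auto simp: unit_e_def gel_def)

lemma mult_closed [simp]: "x \<in> M \<Longrightarrow> y \<in> M \<Longrightarrow> x \<odot> y \<in> M"
  by (elim M_cases) (simp add: mult_cls)

lemma mult_assoc: "x \<in> M \<Longrightarrow> y \<in> M \<Longrightarrow> z \<in> M \<Longrightarrow> x \<odot> y \<odot> z = x \<odot> (y \<odot> z)"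
  by (elim M_cases) (simp add: mult_cls)

lemma mult_one_left [simp]: "x \<in> M \<Longrightarrow> \<one> \<odot> x = x" and mult_one_right [simp]: "x \<in> M \<Longrightarrow> x \<odot> \<one> = x"
  by (auto elim!: M_cases simp: unit_e_def mult_cls)

lemma blen_mult [simp]: "x \<in> M \<Longrightarrow> y \<in> M \<Longrightarrow> blen (x \<odot> y) = blen x + blen y"
  by (elim M_cases) (simp add: mult_cls)

lemma blen_one [simp]: "blen \<one> = 0" and blen_gen [simp]: "blen (\<sigma> s) = 1"
  by (auto simp: unit_e_def gel_def)

lemma blen_eq_0_iff [simp]: "x \<in> M \<Longrightarrow> blen x = 0 \<longleftrightarrow> x = \<one>"
  by (elim M_cases) (auto simp: unit_e_def cls_eq_iff dest: beq_length intro: beq_refl)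

lemma gen_neq_one [simp]: "\<sigma> s \<noteq> \<one>"
  using blen_one blen_gen[of s] by (metis zero_neq_one)

lemma gen_inj [simp]: "\<sigma> s = \<sigma> t \<longleftrightarrow> s = t"
  unfolding gel_def cls_eq_iff using beq_singleton[of k n "[s]" "[t]"] by (auto intro: beq_refl)

lemma M_gen_mult_cases:
  assumes "x \<in> M" "x \<noteq> \<one>"
  obtains s y where "s \<in> \<Sigma>" "y \<in> M" "x = \<sigma> s \<odot> y"
proof -
  obtain w where w: "w \<in> lists \<Sigma>" "x = \<langle>w\<rangle>" using assms(1) by (rule M_cases)
  then obtain s v where "w = s # v" using assms(2) by (cases w) (auto simp: unit_e_def)
  then show ?thesis using w that[of s "\<langle>v\<rangle>"] by (simp add: cls_Cons)
qed

lemma M_induct [consumes 1, case_names one gen_mult]: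
  assumes "x \<in> M" "Q \<one>" "\<And>s y. s \<in> \<Sigma> \<Longrightarrow> y \<in> M \<Longrightarrow> Q y \<Longrightarrow> Q (\<sigma> s \<odot> y)"
  shows "Q x"
proof -
  obtain w where "w \<in> lists \<Sigma>" "x = \<langle>w\<rangle>" using assms(1) by (rule M_cases)
  moreover from this(1) have "Q \<langle>w\<rangle>"
    by (induction w) (use assms(2,3) in \<open>auto simp: cls_Cons, auto simp: unit_e_def\<close>)
  ultimately show ?thesis by simp
qed

lemma finite_blen_eq [simp]: "finite {x \<in> M. blen x = m}"
proof (rule finite_subset)
  show "{x \<in> M. blen x = m} \<subseteq> cls k n ` {w. set w \<subseteq> \<Sigma> \<and> length w = m}"
    unfolding Mon_def lists_eq_set by auto
qed (simp add: finite_lists_length_eq)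

lemma countable_M: "countable M"
  unfolding Mon_def by (intro countable_image) (simp add: countable_lists countable_finite)

lemma dvsI [intro]: "z \<in> M \<Longrightarrow> x \<preceq> x \<odot> z"
  unfolding ldiv_def by blast

lemma dvsE: assumes "x \<preceq> y" obtains z where "z \<in> M" "y = x \<odot> z"
  using assms unfolding ldiv_def by blast

lemma dvs_refl [simp]: "x \<in> M \<Longrightarrow> x \<preceq> x"
  using dvsI[of \<one> x] by simp

lemma one_dvs [simp]: "x \<in> M \<Longrightarrow> \<one> \<preceq> x"
  using dvsI[of x \<one>] by simp

lemma dvs_trans: "x \<in> M \<Longrightarrow> x \<preceq> y \<Longrightarrow> y \<preceq> z \<Longrightarrow> x \<preceq> z"
  by (elim dvsE) (auto simp: mult_assoc)

lemma dvs_blen_le: "x \<in> M \<Longrightarrow> x \<preceq> y \<Longrightarrow> blen x \<le> blen y"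
  by (elim dvsE) auto

lemma dvs_eqI: "x \<in> M \<Longrightarrow> x \<preceq> y \<Longrightarrow> blen y \<le> blen x \<Longrightarrow> x = y"
  by (elim dvsE) auto

lemma dvs_antisym: "x \<in> M \<Longrightarrow> y \<in> M \<Longrightarrow> x \<preceq> y \<Longrightarrow> y \<preceq> x \<Longrightarrow> x = y"
  using dvs_blen_le dvs_eqI by blast

lemma dvs_one_iff [simp]: "x \<in> M \<Longrightarrow> x \<preceq> \<one> \<longleftrightarrow> x = \<one>"
  using dvs_antisym[of x \<one>] by auto

lemma mult_dvs_mono: "a \<in> M \<Longrightarrow> x \<in> M \<Longrightarrow> x \<preceq> y \<Longrightarrow> a \<odot> x \<preceq> a \<odot> y"
  by (elim dvsE) (auto simp flip: mult_assoc)

lemma dvs_mult_right: "x \<in> M \<Longrightarrow> x \<preceq> y \<Longrightarrow> z \<in> M \<Longrightarrow> x \<preceq> y \<odot> z"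
  by (elim dvsE) (auto simp: mult_assoc)

lemma not_mult_gen_dvs: "x \<in> M \<Longrightarrow> s \<in> \<Sigma> \<Longrightarrow> \<not> x \<odot> \<sigma> s \<preceq> x"
  using dvs_blen_le[of "x \<odot> \<sigma> s" x] by auto

lemma nontrivial_gen_dvs:
  assumes "x \<in> M" "x \<noteq> \<one>"
  obtains s where "s \<in> \<Sigma>" "\<sigma> s \<preceq> x"
  using M_gen_mult_cases[OF assms] dvsI by metis

end

section \<open>Garside normal forms\<close>

locale garside = braid_monoid +
  assumes left_cancel: "\<And>x a b. x \<in> M \<Longrightarrow> a \<in> M \<Longrightarrow> b \<in> M \<Longrightarrow> x \<odot> a = x \<odot> b \<Longrightarrow> a = b"
    and simple_right_factor: "\<And>a b. a \<in> M \<Longrightarrow> b \<in> M \<Longrightarrow> a \<odot> b \<in> Simples k n \<Longrightarrow> b \<in> Simples k n"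
    and simple_lub: "\<And>a b. a \<in> Simples k n \<Longrightarrow> b \<in> Simples k n \<Longrightarrow>
      \<exists>j\<in>Simples k n. a \<preceq> j \<and> b \<preceq> j \<and> (\<forall>m\<in>M. a \<preceq> m \<longrightarrow> b \<preceq> m \<longrightarrow> j \<preceq> m)"
    and DeltaX_closed: "\<And>X. X \<subseteq> \<Sigma> \<Longrightarrow> DeltaX k n X \<in> M"
    and DeltaX_dvs_iff: "\<And>X m. X \<subseteq> \<Sigma> \<Longrightarrow> m \<in> M \<Longrightarrow> DeltaX k n X \<preceq> m \<longleftrightarrow> (\<forall>s\<in>X. \<sigma> s \<preceq> m)"
    and gen_mult_Delta_inj: "\<And>s t. s \<in> \<Sigma> \<Longrightarrow> t \<in> \<Sigma> \<Longrightarrow> \<sigma> s \<odot> Delta k n = \<sigma> t \<odot> Delta k n \<Longrightarrow> s = t"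
begin

abbreviation "\<S> \<equiv> Simples k n"
abbreviation "\<Delta> \<equiv> Delta k n"
abbreviation "L \<equiv> Lset k n"
abbreviation "R \<equiv> Rset k n"
abbreviation arrow' (infix \<open>\<leadsto>\<close> 50) where "x \<leadsto> y \<equiv> arrow k n x y"

subsection \<open>Simple elements and complements\<close>

lemma Delta_closed [simp]: "\<Delta> \<in> M" unfolding Delta_def by (simp add: DeltaX_closed)

lemma Delta_dvs_iff: "m \<in> M \<Longrightarrow> \<Delta> \<preceq> m \<longleftrightarrow> (\<forall>s\<in>\<Sigma>. \<sigma> s \<preceq> m)"
  unfolding Delta_def by (simp add: DeltaX_dvs_iff)

lemma DeltaX_empty [simp]: "DeltaX k n {} = \<one>"
  using DeltaX_dvs_iff[of "{}" \<one>] DeltaX_closed[of "{}"] by simp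

lemma DeltaX_singleton: "s \<in> \<Sigma> \<Longrightarrow> DeltaX k n {s} = \<sigma> s"
  using DeltaX_dvs_iff[of "{s}" "\<sigma> s"] DeltaX_dvs_iff[of "{s}" "DeltaX k n {s}"] DeltaX_closed[of "{s}"]
  by (intro dvs_antisym) auto

lemma simple_iff: "x \<in> \<S> \<longleftrightarrow> x \<in> M \<and> x \<preceq> \<Delta>" unfolding Simples_def by blast

lemma simple_closed [simp]: "x \<in> \<S> \<Longrightarrow> x \<in> M" by (simp add: simple_iff)

lemma simple_left_factor: "x \<in> M \<Longrightarrow> x \<preceq> y \<Longrightarrow> y \<in> \<S> \<Longrightarrow> x \<in> \<S>"
  using simple_iff dvs_trans by blast

lemma Delta_simple [simp]: "\<Delta> \<in> \<S>" and one_simple [simp]: "\<one> \<in> \<S>"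
  by (simp_all add: simple_iff)

lemma gen_simple [simp]: "s \<in> \<Sigma> \<Longrightarrow> \<sigma> s \<in> \<S>"
  using Delta_dvs_iff[of \<Delta>] by (simp add: simple_iff)

lemma finite_simples [simp]: "finite \<S>"
proof (rule finite_subset)
  show "\<S> \<subseteq> (\<Union>m\<le>blen \<Delta>. {x \<in> M. blen x = m})" using dvs_blen_le simple_iff by auto
qed simp

lemma dvs_left_cancel:
  assumes "a \<in> M" "x \<in> M" "y \<in> M" "a \<odot> x \<preceq> a \<odot> y" shows "x \<preceq> y"
proof -
  obtain z where z: "z \<in> M" "a \<odot> y = a \<odot> x \<odot> z" using assms(4) by (rule dvsE)
  then have "y = x \<odot> z" using left_cancel[of a y "x \<odot> z"] assms by (simp add: mult_assoc)
  then show ?thesis using z by auto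
qed

lemma mult_dvs_mult_iff: "a \<in> M \<Longrightarrow> x \<in> M \<Longrightarrow> y \<in> M \<Longrightarrow> a \<odot> x \<preceq> a \<odot> y \<longleftrightarrow> x \<preceq> y"
  using dvs_left_cancel mult_dvs_mono by blast

definition complement :: "elt \<Rightarrow> elt" (\<open>\<partial>\<close>) where
  "\<partial> x = (SOME z. z \<in> M \<and> x \<odot> z = \<Delta>)"

lemma complement_mult: "x \<in> \<S> \<Longrightarrow> x \<odot> \<partial> x = \<Delta>" and complement_simple [simp]: "x \<in> \<S> \<Longrightarrow> \<partial> x \<in> \<S>"
proof -
  assume x: "x \<in> \<S>"
  then have "\<exists>z. z \<in> M \<and> x \<odot> z = \<Delta>" unfolding simple_iff by (auto elim!: dvsE)
  then have complement: "\<partial> x \<in> M \<and> x \<odot> \<partial> x = \<Delta>" unfolding complement_def by (rule someI_ex)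
  then show "x \<odot> \<partial> x = \<Delta>" by blast
  then show "\<partial> x \<in> \<S>" using simple_right_factor[of x "\<partial> x"] x complement Delta_simple by simp
qed

lemma simple_mult_iff: "x \<in> \<S> \<Longrightarrow> y \<in> M \<Longrightarrow> x \<odot> y \<in> \<S> \<longleftrightarrow> y \<preceq> \<partial> x"
  using mult_dvs_mult_iff[of x y "\<partial> x"] complement_mult[of x] simple_iff[of "x \<odot> y"] by simp

lemma Delta_dvs_complementD: assumes "x \<in> \<S>" "\<Delta> \<preceq> \<partial> x" shows "x = \<one>"
proof -
  have "blen \<Delta> = blen x + blen (\<partial> x)"
    using complement_mult[OF assms(1)] blen_mult[of x "\<partial> x"] assms(1) by simp
  moreover have "blen \<Delta> \<le> blen (\<partial> x)" using dvs_blen_le assms by simp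
  ultimately show ?thesis using assms(1) by simp
qed

lemma simple_lub_mult:
  assumes "x \<in> \<S>" "z \<in> \<S>" "m \<in> M" "z \<preceq> x \<odot> m"
  obtains w u where "w \<in> \<S>" "u \<in> \<S>" "x \<odot> w \<in> \<S>" "w \<preceq> m" "x \<odot> w = z \<odot> u"
proof -
  obtain j where j: "j \<in> \<S>" "x \<preceq> j" "z \<preceq> j" "\<forall>m\<in>M. x \<preceq> m \<longrightarrow> z \<preceq> m \<longrightarrow> j \<preceq> m"
    using simple_lub[OF assms(1,2)] by blast
  obtain w where w: "w \<in> M" "j = x \<odot> w" using j(2) by (rule dvsE)
  obtain u where u: "u \<in> M" "j = z \<odot> u" using j(3) by (rule dvsE)
  have "j \<preceq> x \<odot> m" using j(4) assms by auto
  then have "w \<preceq> m" using dvs_left_cancel[of x w m] w assms by simp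
  moreover have "w \<in> \<S>" "u \<in> \<S>" using simple_right_factor w u j(1) assms by (metis simple_closed)+
  ultimately show ?thesis using that w u j by simp
qed

lemma greatest_simple_divisor:
  assumes "m \<in> M"
  obtains a where "a \<in> \<S>" "a \<preceq> m" "\<And>z. z \<in> \<S> \<Longrightarrow> z \<preceq> m \<Longrightarrow> z \<preceq> a"
proof -
  let ?A = "{z \<in> \<S>. z \<preceq> m}"
  have "finite ?A" "?A \<noteq> {}" using assms by (auto intro: exI[of _ \<one>])
  then have "Max (blen ` ?A) \<in> blen ` ?A" by (intro Max_in) auto
  then obtain a where a: "a \<in> ?A" "blen a = Max (blen ` ?A)" by auto
  have "z \<preceq> a" if z: "z \<in> \<S>" "z \<preceq> m" for z
  proof -
    obtain j where j: "j \<in> \<S>" "a \<preceq> j" "z \<preceq> j" "j \<preceq> m"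
      using simple_lub[of a z] a z assms by blast
    then have "blen j \<le> blen a" using a(2) \<open>finite ?A\<close> by (auto intro!: Max_ge)
    then show ?thesis using dvs_eqI[of a j] j a by auto
  qed
  then show ?thesis using that a by blast
qed

lemma L_gen [simp]: "s \<in> \<Sigma> \<Longrightarrow> L (\<sigma> s) = {s}"
  unfolding Lset_def using dvs_eqI[of "\<sigma> _" "\<sigma> s"] by auto

lemma L_one [simp]: "L \<one> = {}"
  unfolding Lset_def by auto

lemma L_empty_iff: assumes "x \<in> M" shows "L x = {} \<longleftrightarrow> x = \<one>"
proof (cases "x = \<one>")
  case False
  then obtain s where "s \<in> \<Sigma>" "\<sigma> s \<preceq> x" using assms nontrivial_gen_dvs by blast
  then show ?thesis using False unfolding Lset_def by blast
qed simp

lemma R_one [simp]: "R \<one> = {}"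
  unfolding Rset_def by auto

lemma mem_R_iff: "x \<in> \<S> \<Longrightarrow> s \<in> \<Sigma> \<Longrightarrow> s \<in> R x \<longleftrightarrow> \<not> \<sigma> s \<preceq> \<partial> x"
  unfolding Rset_def using simple_mult_iff[of x "\<sigma> s"] by simp

lemma R_emptyD: "x \<in> \<S> \<Longrightarrow> R x = {} \<Longrightarrow> x = \<one>"
  using mem_R_iff Delta_dvs_complementD Delta_dvs_iff[of "\<partial> x"] by auto

lemma R_Delta [simp]: "R \<Delta> = \<Sigma>"
  using not_mult_gen_dvs[of \<Delta>] by (auto simp: Rset_def simple_iff)

lemma arrow_one [simp]: "x \<leadsto> \<one>" unfolding arrow_def by simp

lemma one_arrowD: "y \<in> \<S> \<Longrightarrow> \<one> \<leadsto> y \<Longrightarrow> y = \<one>"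
  unfolding arrow_def using L_empty_iff by auto

lemma Delta_arrow [simp]: "\<Delta> \<leadsto> x" unfolding arrow_def R_Delta Lset_def by blast

lemma arrow_gen_iff: "s \<in> \<Sigma> \<Longrightarrow> x \<leadsto> \<sigma> s \<longleftrightarrow> x \<odot> \<sigma> s \<notin> \<S>"
  unfolding arrow_def by (simp add: Rset_def)

lemma arrow_iff: "x \<leadsto> y \<longleftrightarrow> (\<forall>s\<in>\<Sigma>. \<sigma> s \<preceq> y \<longrightarrow> x \<odot> \<sigma> s \<notin> \<S>)"
  unfolding arrow_def Lset_def Rset_def by blast

subsection \<open>Conjugation by the Garside element\<close>

definition \<phi> :: "elt \<Rightarrow> elt" where "\<phi> x = (SOME y. y \<in> M \<and> x \<odot> \<Delta> = \<Delta> \<odot> y)"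

lemma simple_mult_Delta: "x \<in> \<S> \<Longrightarrow> x \<odot> \<Delta> = \<Delta> \<odot> \<partial> (\<partial> x)"
  using complement_mult[of x] complement_mult[of "\<partial> x"] mult_assoc[of x "\<partial> x" "\<partial> (\<partial> x)"] by simp

lemma \<phi>_closed [simp]: "x \<in> M \<Longrightarrow> \<phi> x \<in> M" and mult_Delta: "x \<in> M \<Longrightarrow> x \<odot> \<Delta> = \<Delta> \<odot> \<phi> x"
proof -
  assume "x \<in> M"
  then have "\<exists>y. y \<in> M \<and> x \<odot> \<Delta> = \<Delta> \<odot> y"
  proof (induction x rule: M_induct)
    case one
    then show ?case by (intro exI[of _ \<one>]) simp
  next
    case (gen_mult s x)
    then obtain y where y: "y \<in> M" "x \<odot> \<Delta> = \<Delta> \<odot> y" by blast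
    have closed: "\<partial> (\<partial> (\<sigma> s)) \<in> M" using gen_mult by simp
    have "\<sigma> s \<odot> x \<odot> \<Delta> = \<sigma> s \<odot> \<Delta> \<odot> y" using gen_mult y by (simp add: mult_assoc)
    also have "\<dots> = \<Delta> \<odot> (\<partial> (\<partial> (\<sigma> s)) \<odot> y)"
      using simple_mult_Delta[of "\<sigma> s"] gen_mult y closed by (simp add: mult_assoc)
    finally show ?case using y closed by (intro exI[of _ "\<partial> (\<partial> (\<sigma> s)) \<odot> y"]) simp
  qed
  then have "\<phi> x \<in> M \<and> x \<odot> \<Delta> = \<Delta> \<odot> \<phi> x" unfolding \<phi>_def by (rule someI_ex)
  then show "\<phi> x \<in> M" "x \<odot> \<Delta> = \<Delta> \<odot> \<phi> x" by auto
qed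

lemma \<phi>_eqI: "x \<in> M \<Longrightarrow> y \<in> M \<Longrightarrow> x \<odot> \<Delta> = \<Delta> \<odot> y \<Longrightarrow> \<phi> x = y"
  using mult_Delta[of x] left_cancel[of \<Delta> "\<phi> x" y] by simp

lemma \<phi>_simple_eq: "x \<in> \<S> \<Longrightarrow> \<phi> x = \<partial> (\<partial> x)"
  using \<phi>_eqI simple_mult_Delta by simp

lemma \<phi>_simple [simp]: "x \<in> \<S> \<Longrightarrow> \<phi> x \<in> \<S>"
  by (simp add: \<phi>_simple_eq)

lemma \<phi>_one [simp]: "\<phi> \<one> = \<one>" and \<phi>_Delta [simp]: "\<phi> \<Delta> = \<Delta>" by (rule \<phi>_eqI; simp)+

lemma \<phi>_mult: assumes "x \<in> M" "y \<in> M" shows "\<phi> (x \<odot> y) = \<phi> x \<odot> \<phi> y"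
proof (rule \<phi>_eqI)
  have "x \<odot> y \<odot> \<Delta> = x \<odot> \<Delta> \<odot> \<phi> y" using assms mult_Delta[of y] by (simp add: mult_assoc)
  also have "\<dots> = \<Delta> \<odot> (\<phi> x \<odot> \<phi> y)" using assms mult_Delta[of x] by (simp add: mult_assoc)
  finally show "x \<odot> y \<odot> \<Delta> = \<Delta> \<odot> (\<phi> x \<odot> \<phi> y)" .
qed (use assms in auto)

lemma blen_\<phi> [simp]: assumes "x \<in> M" shows "blen (\<phi> x) = blen x"
proof -
  have "blen (x \<odot> \<Delta>) = blen (\<Delta> \<odot> \<phi> x)" using mult_Delta[OF assms] by simp
  then show ?thesis using assms by simp
qed

lemma \<phi>_permutes_gens: "(\<lambda>s. \<phi> (\<sigma> s)) ` \<Sigma> = \<sigma> ` \<Sigma>"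
proof (rule card_seteq)
  show "(\<lambda>s. \<phi> (\<sigma> s)) ` \<Sigma> \<subseteq> \<sigma> ` \<Sigma>"
  proof
    fix x assume "x \<in> (\<lambda>s. \<phi> (\<sigma> s)) ` \<Sigma>"
    then obtain s where s: "s \<in> \<Sigma>" "x = \<phi> (\<sigma> s)" by blast
    then have x: "x \<in> M" "blen x = 1" by simp_all
    then have "x \<noteq> \<one>" by auto
    then obtain t y where t: "t \<in> \<Sigma>" "y \<in> M" "x = \<sigma> t \<odot> y" using M_gen_mult_cases x(1) by blast
    then show "x \<in> \<sigma> ` \<Sigma>" using x(2) by simp
  qed
  have "inj_on (\<lambda>s. \<phi> (\<sigma> s)) \<Sigma>"
  proof (rule inj_onI)
    fix s t assume "s \<in> \<Sigma>" "t \<in> \<Sigma>" "\<phi> (\<sigma> s) = \<phi> (\<sigma> t)"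
    then show "s = t" using mult_Delta[of "\<sigma> s"] mult_Delta[of "\<sigma> t"] gen_mult_Delta_inj by simp
  qed
  then show "card (\<sigma> ` \<Sigma>) \<le> card ((\<lambda>s. \<phi> (\<sigma> s)) ` \<Sigma>)"
    using card_image_le[OF finite_gens, of \<sigma> k n] by (simp add: card_image)
qed simp

lemma \<phi>_gen_surj:
  assumes "t \<in> \<Sigma>" obtains s where "s \<in> \<Sigma>" "\<phi> (\<sigma> s) = \<sigma> t"
  using \<phi>_permutes_gens assms by (metis (no_types, lifting) imageE image_eqI)

lemma \<phi>_surj: "y \<in> M \<Longrightarrow> \<exists>x\<in>M. \<phi> x = y"
proof (induction y rule: M_induct)
  case one
  then show ?case by (intro bexI[of _ \<one>]) auto
next
  case (gen_mult t y)
  then obtain x s where "x \<in> M" "\<phi> x = y" "s \<in> \<Sigma>" "\<phi> (\<sigma> s) = \<sigma> t" using \<phi>_gen_surj by metis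
  then show ?case by (intro bexI[of _ "\<sigma> s \<odot> x"]) (auto simp: \<phi>_mult)
qed

lemma \<phi>_inj: assumes "x \<in> M" "y \<in> M" "\<phi> x = \<phi> y" shows "x = y"
proof -
  let ?A = "{z \<in> M. blen z = blen x}"
  have "?A \<subseteq> \<phi> ` ?A"
  proof
    fix z assume z: "z \<in> ?A"
    then obtain w where "w \<in> M" "\<phi> w = z" using \<phi>_surj by blast
    then show "z \<in> \<phi> ` ?A" using z blen_\<phi> by force
  qed
  then have "inj_on \<phi> ?A" using finite_surj_inj[OF finite_blen_eq] by blast
  moreover have "blen y = blen x" using blen_\<phi> assms by metis
  ultimately show ?thesis using assms by (auto dest: inj_onD)
qed

lemma \<phi>_dvs_iff: assumes "x \<in> M" "y \<in> M" shows "\<phi> x \<preceq> \<phi> y \<longleftrightarrow> x \<preceq> y"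
proof
  assume "\<phi> x \<preceq> \<phi> y"
  then obtain z where z: "z \<in> M" "\<phi> y = \<phi> x \<odot> z" by (rule dvsE)
  then obtain z' where z': "z' \<in> M" "\<phi> z' = z" using \<phi>_surj by blast
  then have "\<phi> y = \<phi> (x \<odot> z')" using z assms by (auto simp: \<phi>_mult)
  then have "y = x \<odot> z'" using \<phi>_inj assms z' by simp
  then show "x \<preceq> y" using z' by auto
next
  assume "x \<preceq> y"
  then obtain z where "z \<in> M" "y = x \<odot> z" by (rule dvsE)
  then show "\<phi> x \<preceq> \<phi> y" using assms by (auto simp: \<phi>_mult)
qed

lemma \<phi>_simple_iff: "x \<in> M \<Longrightarrow> \<phi> x \<in> \<S> \<longleftrightarrow> x \<in> \<S>"
  using \<phi>_dvs_iff[of x \<Delta>] by (simp add: simple_iff)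

lemma \<phi>_arrow: assumes "x \<in> \<S>" "y \<in> \<S>" "x \<leadsto> y" shows "\<phi> x \<leadsto> \<phi> y"
  unfolding arrow_iff
proof (intro ballI impI)
  fix t assume t: "t \<in> \<Sigma>" "\<sigma> t \<preceq> \<phi> y"
  obtain s where s: "s \<in> \<Sigma>" "\<phi> (\<sigma> s) = \<sigma> t" using t(1) by (rule \<phi>_gen_surj)
  then have "\<sigma> s \<preceq> y" using \<phi>_dvs_iff[of "\<sigma> s" y] t assms by simp
  then have "x \<odot> \<sigma> s \<notin> \<S>" using assms(3) s unfolding arrow_iff by blast
  then show "\<phi> x \<odot> \<sigma> t \<notin> \<S>" using \<phi>_simple_iff[of "x \<odot> \<sigma> s"] s assms by (simp add: \<phi>_mult)
qed

lemma complement_arrow: assumes "x \<in> \<S>" "y \<in> \<S>" "x \<leadsto> y" shows "\<partial> y \<leadsto> \<phi> (\<partial> x)"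
  unfolding arrow_iff
proof (intro ballI impI)
  fix t assume t: "t \<in> \<Sigma>" "\<sigma> t \<preceq> \<phi> (\<partial> x)"
  obtain s where s: "s \<in> \<Sigma>" "\<phi> (\<sigma> s) = \<sigma> t" using t(1) by (rule \<phi>_gen_surj)
  then have "\<sigma> s \<preceq> \<partial> x" using \<phi>_dvs_iff[of "\<sigma> s" "\<partial> x"] t assms by simp
  then have "\<not> \<sigma> s \<preceq> y" using assms s simple_mult_iff[of x "\<sigma> s"] unfolding arrow_iff by auto
  then have "\<not> \<sigma> t \<preceq> \<phi> y" using \<phi>_dvs_iff[of "\<sigma> s" y] s assms by simp
  then show "\<partial> y \<odot> \<sigma> t \<notin> \<S>" using simple_mult_iff[of "\<partial> y" "\<sigma> t"] t assms by (simp add: \<phi>_simple_eq)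
qed

subsection \<open>Normal sequences\<close>

abbreviation shift :: "(nat \<Rightarrow> elt) \<Rightarrow> nat \<Rightarrow> elt" where "shift \<xi> \<equiv> \<lambda>i. \<xi> (Suc i)"

definition prefix_prod :: "(nat \<Rightarrow> elt) \<Rightarrow> nat \<Rightarrow> elt" where
  "prefix_prod \<xi> j = mprod k n (map \<xi> [0..<j])"

lemma prefix_prod_0 [simp]: "prefix_prod \<xi> 0 = \<one>"
  by (simp add: prefix_prod_def mprod_def)

lemma prefix_prod_Suc_shift: "prefix_prod \<xi> (Suc j) = \<xi> 0 \<odot> prefix_prod (shift \<xi>) j"
proof -
  have "map \<xi> [0..<Suc j] = \<xi> 0 # map (shift \<xi>) [0..<j]"
    by (simp add: upt_conv_Cons map_Suc_upt[symmetric] del: upt_Suc)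
  then show ?thesis by (simp add: prefix_prod_def mprod_def)
qed

lemma prefix_prod_closed [simp]: "(\<And>i. \<xi> i \<in> M) \<Longrightarrow> prefix_prod \<xi> j \<in> M"
  by (induction j arbitrary: \<xi>) (auto simp: prefix_prod_Suc_shift)

lemma prefix_prod_Suc: "(\<And>i. \<xi> i \<in> M) \<Longrightarrow> prefix_prod \<xi> (Suc j) = prefix_prod \<xi> j \<odot> \<xi> j"
proof (induction j arbitrary: \<xi>)
  case (Suc j)
  have "prefix_prod \<xi> (Suc (Suc j)) = \<xi> 0 \<odot> (prefix_prod (shift \<xi>) j \<odot> \<xi> (Suc j))"
    using Suc.IH[of "shift \<xi>"] Suc.prems by (simp add: prefix_prod_Suc_shift)
  then show ?case using Suc.prems by (simp add: prefix_prod_Suc_shift mult_assoc)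
qed (simp add: prefix_prod_Suc_shift)

lemma head_dvs_prefix_prod: "(\<And>i. \<xi> i \<in> M) \<Longrightarrow> \<xi> 0 \<preceq> prefix_prod \<xi> (Suc j)"
  by (simp add: prefix_prod_Suc_shift dvsI)

lemma prefix_prod_cong: "(\<And>i. i < j \<Longrightarrow> \<xi> i = \<eta> i) \<Longrightarrow> prefix_prod \<xi> j = prefix_prod \<eta> j"
  unfolding prefix_prod_def by (metis atLeastLessThan_iff map_cong set_upt)

lemma prefix_prod_dvs_mono:
  assumes "\<And>i. \<xi> i \<in> M" "i \<le> j" shows "prefix_prod \<xi> i \<preceq> prefix_prod \<xi> j"
  using assms(2)
proof (induction rule: dec_induct)
  case (step j)
  then show ?case using assms(1) dvs_mult_right by (simp add: prefix_prod_Suc)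
qed (use assms in simp)

lemma prefix_prod_trailing_ones:
  assumes "\<And>i. \<xi> i \<in> M" "\<And>l. i \<le> l \<Longrightarrow> \<xi> l = \<one>" "i \<le> j" shows "prefix_prod \<xi> j = prefix_prod \<xi> i"
  using assms(3)
proof (induction rule: dec_induct)
  case (step j)
  then show ?case using assms by (simp add: prefix_prod_Suc)
qed simp

lemma prefix_prod_\<phi>: "(\<And>i. \<xi> i \<in> M) \<Longrightarrow> prefix_prod (\<lambda>i. \<phi> (\<xi> i)) j = \<phi> (prefix_prod \<xi> j)"
  by (induction j) (auto simp: prefix_prod_Suc \<phi>_mult)

lemma Mbar_simple [simp]: "\<xi> \<in> Mbar k n \<Longrightarrow> \<xi> i \<in> \<S>"
  and Mbar_closed [simp]: "\<xi> \<in> Mbar k n \<Longrightarrow> \<xi> i \<in> M"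
  and Mbar_arrow: "\<xi> \<in> Mbar k n \<Longrightarrow> \<xi> i \<leadsto> \<xi> (Suc i)"
  and Mbar_shift: "\<xi> \<in> Mbar k n \<Longrightarrow> shift \<xi> \<in> Mbar k n"
  unfolding Mbar_def by auto

lemma ones_Mbar [simp]: "(\<lambda>_. \<one>) \<in> Mbar k n" and Deltas_Mbar [simp]: "(\<lambda>_. \<Delta>) \<in> Mbar k n"
  unfolding Mbar_def by auto

lemma Mbar_one_absorbing:
  assumes "\<xi> \<in> Mbar k n" "\<xi> i = \<one>" "i \<le> j" shows "\<xi> j = \<one>"
  using assms(3)
proof (induction rule: dec_induct)
  case (step j)
  then show ?case using one_arrowD Mbar_arrow[OF assms(1), of j] assms(1) by simp
qed (use assms in simp)

definition truncate :: "nat \<Rightarrow> (nat \<Rightarrow> elt) \<Rightarrow> nat \<Rightarrow> elt" where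
  "truncate j \<xi> = (\<lambda>i. if i < j then \<xi> i else \<one>)"

lemma truncate_Mbar [simp]: "\<xi> \<in> Mbar k n \<Longrightarrow> truncate j \<xi> \<in> Mbar k n"
  unfolding truncate_def Mbar_def by auto

lemma prefix_prod_truncate [simp]: "prefix_prod (truncate j \<xi>) j = prefix_prod \<xi> j"
  by (rule prefix_prod_cong) (simp add: truncate_def)

definition append_factor :: "(nat \<Rightarrow> elt) \<Rightarrow> nat \<Rightarrow> elt \<Rightarrow> nat \<Rightarrow> elt" where
  "append_factor \<xi> j y = (truncate j \<xi>)(j := y)"

lemma append_factor_0_Mbar: "y \<in> \<S> \<Longrightarrow> append_factor \<xi> 0 y \<in> Mbar k n"
  unfolding append_factor_def truncate_def Mbar_def by auto

lemma append_factor_Suc_Mbar: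
  "\<xi> \<in> Mbar k n \<Longrightarrow> y \<in> \<S> \<Longrightarrow> \<xi> j \<leadsto> y \<Longrightarrow> append_factor \<xi> (Suc j) y \<in> Mbar k n"
  unfolding append_factor_def truncate_def Mbar_def by (auto simp: less_Suc_eq)

lemma append_factor_last [simp]: "append_factor \<xi> j y j = y"
  by (simp add: append_factor_def)

lemma prefix_prod_append_factor:
  assumes "\<And>i. append_factor \<xi> j y i \<in> M"
  shows "prefix_prod (append_factor \<xi> j y) (Suc j) = prefix_prod \<xi> j \<odot> y"
proof -
  have "prefix_prod (append_factor \<xi> j y) j = prefix_prod \<xi> j"
    by (rule prefix_prod_cong) (simp add: append_factor_def truncate_def)
  then show ?thesis using prefix_prod_Suc[of "append_factor \<xi> j y" j] assms by simp
qed

lemma arrow_factor_trivial: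
  assumes "x \<in> \<S>" "x \<leadsto> y" "w \<in> M" "w \<preceq> y" "x \<odot> w \<in> \<S>" shows "w = \<one>"
proof (rule ccontr)
  assume "w \<noteq> \<one>"
  then obtain s where s: "s \<in> \<Sigma>" "\<sigma> s \<preceq> w" using nontrivial_gen_dvs assms(3) by blast
  then have "x \<odot> \<sigma> s \<notin> \<S>" using assms(2,4) dvs_trans gen_closed unfolding arrow_iff by blast
  moreover have "x \<odot> \<sigma> s \<preceq> x \<odot> w" using s assms by (intro mult_dvs_mono) auto
  ultimately show False using simple_left_factor assms s by simp
qed

lemma simple_dvs_prefix_prod:
  "\<xi> \<in> Mbar k n \<Longrightarrow> z \<in> \<S> \<Longrightarrow> z \<preceq> prefix_prod \<xi> j \<Longrightarrow> z \<preceq> \<xi> 0"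
proof (induction j arbitrary: \<xi> z)
  case (Suc j)
  have shift: "shift \<xi> \<in> Mbar k n" using Suc.prems Mbar_shift by blast
  obtain w u where w: "w \<in> \<S>" "u \<in> \<S>" "\<xi> 0 \<odot> w \<in> \<S>" "w \<preceq> prefix_prod (shift \<xi>) j" "\<xi> 0 \<odot> w = z \<odot> u"
    using simple_lub_mult[of "\<xi> 0" z "prefix_prod (shift \<xi>) j"] Suc.prems shift
    by (auto simp: prefix_prod_Suc_shift)
  have "w \<preceq> \<xi> 1" using Suc.IH[OF shift w(1) w(4)] by simp
  then have "w = \<one>"
    using arrow_factor_trivial[of "\<xi> 0" "\<xi> 1" w] Mbar_arrow[of \<xi> 0] Suc.prems w by simp
  then have "\<xi> 0 = z \<odot> u" using w(5) Suc.prems by simp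
  then show ?case using w(2) by auto
qed simp

fun simple_products :: "nat \<Rightarrow> elt set" where
  "simple_products 0 = {\<one>}"
| "simple_products (Suc j) = {a \<odot> b | a b. a \<in> \<S> \<and> b \<in> simple_products j}"

lemma simple_products_closed: "x \<in> simple_products j \<Longrightarrow> x \<in> M"
  by (induction j arbitrary: x) auto

lemma one_simple_products [simp]: "\<one> \<in> simple_products j"
  by (induction j) (auto intro!: exI[of _ \<one>])

lemma simple_products_blen: "x \<in> M \<Longrightarrow> x \<in> simple_products (blen x)"
proof (induction x rule: M_induct)
  case (gen_mult s y)
  then show ?case using gen_simple[of s] by (simp, blast)
qed simp

lemma simple_products_mono: "i \<le> j \<Longrightarrow> simple_products i \<subseteq> simple_products j"
proof (induction i arbitrary: j)
  case (Suc i)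
  then obtain j' where "j = Suc j'" "i \<le> j'" by (cases j) auto
  then show ?case using Suc.IH by auto
qed simp

lemma simple_products_blen_le: "x \<in> M \<Longrightarrow> blen x \<le> j \<Longrightarrow> x \<in> simple_products j"
  using simple_products_blen simple_products_mono by blast

lemma prefix_prod_simple_products: "(\<And>i. \<xi> i \<in> \<S>) \<Longrightarrow> prefix_prod \<xi> j \<in> simple_products j"
proof (induction j arbitrary: \<xi>)
  case (Suc j)
  have "prefix_prod (shift \<xi>) j \<in> simple_products j" by (rule Suc.IH) (simp add: Suc.prems)
  then show ?case unfolding prefix_prod_Suc_shift simple_products.simps using Suc.prems[of 0] by blast
qed simp

lemma simple_products_lub_mult:
  "u \<in> \<S> \<Longrightarrow> x \<in> simple_products j \<Longrightarrow> m \<in> M \<Longrightarrow> x \<preceq> u \<odot> m \<Longrightarrow>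
    \<exists>w\<in>simple_products j. w \<preceq> m \<and> x \<preceq> u \<odot> w"
proof (induction j arbitrary: u x m)
  case (Suc j)
  then obtain y x' where x: "x = y \<odot> x'" "y \<in> \<S>" "x' \<in> simple_products j" by auto
  have x'M: "x' \<in> M" using simple_products_closed x by blast
  have "y \<preceq> u \<odot> m" using dvs_trans[OF _ _ Suc.prems(4), of y] dvsI[OF x'M, of y] x by simp
  then obtain w\<^sub>1 u' where w\<^sub>1: "w\<^sub>1 \<in> \<S>" "u' \<in> \<S>" "u \<odot> w\<^sub>1 \<in> \<S>" "w\<^sub>1 \<preceq> m" "u \<odot> w\<^sub>1 = y \<odot> u'"
    using simple_lub_mult Suc.prems x by metis
  obtain m' where m': "m' \<in> M" "m = w\<^sub>1 \<odot> m'" using w\<^sub>1(4) by (rule dvsE)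
  have "u \<odot> m = y \<odot> (u' \<odot> m')" using w\<^sub>1 m' x Suc.prems by (simp flip: mult_assoc)
  then have "x' \<preceq> u' \<odot> m'" using Suc.prems(4) dvs_left_cancel[of y x' "u' \<odot> m'"] x x'M w\<^sub>1 m' by simp
  then obtain w\<^sub>2 where w\<^sub>2: "w\<^sub>2 \<in> simple_products j" "w\<^sub>2 \<preceq> m'" "x' \<preceq> u' \<odot> w\<^sub>2" using Suc.IH w\<^sub>1 x m' by blast
  have w\<^sub>2M: "w\<^sub>2 \<in> M" using simple_products_closed w\<^sub>2 by blast
  have "y \<odot> x' \<preceq> y \<odot> (u' \<odot> w\<^sub>2)" using w\<^sub>2 x x'M by (intro mult_dvs_mono) auto
  also have "y \<odot> (u' \<odot> w\<^sub>2) = u \<odot> (w\<^sub>1 \<odot> w\<^sub>2)" using w\<^sub>1 x w\<^sub>2M Suc.prems by (simp flip: mult_assoc)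
  finally have "x \<preceq> u \<odot> (w\<^sub>1 \<odot> w\<^sub>2)" using x by simp
  moreover have "w\<^sub>1 \<odot> w\<^sub>2 \<in> simple_products (Suc j)" using w\<^sub>1 w\<^sub>2 by auto
  moreover have "w\<^sub>1 \<odot> w\<^sub>2 \<preceq> m" using m' w\<^sub>1 w\<^sub>2 w\<^sub>2M by (auto intro: mult_dvs_mono)
  ultimately show ?case by blast
qed simp

lemma simple_products_dvs_prefix_prod:
  "\<xi> \<in> Mbar k n \<Longrightarrow> x \<in> simple_products j \<Longrightarrow> x \<preceq> prefix_prod \<xi> i \<Longrightarrow> x \<preceq> prefix_prod \<xi> j"
proof (induction j arbitrary: \<xi> i x)
  case (Suc j)
  obtain x\<^sub>1 x' where x: "x = x\<^sub>1 \<odot> x'" "x\<^sub>1 \<in> \<S>" "x' \<in> simple_products j" using Suc.prems by auto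
  have x'M: "x' \<in> M" using simple_products_closed x by blast
  let ?\<xi> = "shift \<xi>"
  have shift: "?\<xi> \<in> Mbar k n" using Suc.prems Mbar_shift by blast
  show ?case
  proof (cases i)
    case 0
    then have "x = \<one>" using Suc.prems(3) x x'M by simp
    then show ?thesis using Suc.prems by simp
  next
    case (Suc i')
    have prodM: "prefix_prod ?\<xi> i' \<in> M" using Suc.prems(1) by simp
    have "x\<^sub>1 \<preceq> prefix_prod \<xi> i" using dvs_trans[OF _ _ Suc.prems(3), of x\<^sub>1] dvsI[OF x'M, of x\<^sub>1] x by simp
    then have "x\<^sub>1 \<preceq> \<xi> 0" using simple_dvs_prefix_prod Suc.prems x by blast
    then obtain u where u: "u \<in> M" "\<xi> 0 = x\<^sub>1 \<odot> u" by (rule dvsE)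
    then have uS: "u \<in> \<S>" using simple_right_factor[of x\<^sub>1 u] x Mbar_simple[OF Suc.prems(1), of 0] by simp
    have "x\<^sub>1 \<odot> x' \<preceq> x\<^sub>1 \<odot> (u \<odot> prefix_prod ?\<xi> i')"
      using Suc.prems(3) x u Suc prodM by (simp add: prefix_prod_Suc_shift mult_assoc)
    then have "x' \<preceq> u \<odot> prefix_prod ?\<xi> i'"
      using dvs_left_cancel[of x\<^sub>1 x' "u \<odot> prefix_prod ?\<xi> i'"] x x'M u prodM by simp
    then obtain w where w: "w \<in> simple_products j" "w \<preceq> prefix_prod ?\<xi> i'" "x' \<preceq> u \<odot> w"
      using simple_products_lub_mult[OF uS x(3) prodM] by blast
    have wM: "w \<in> M" using simple_products_closed w by blast
    have "x \<preceq> x\<^sub>1 \<odot> (u \<odot> w)" using w(3) x x'M by (auto intro: mult_dvs_mono)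
    then have "x \<preceq> \<xi> 0 \<odot> w" using u wM x by (simp add: mult_assoc)
    moreover have "\<xi> 0 \<odot> w \<preceq> prefix_prod \<xi> (Suc j)"
      using Suc.IH[OF shift w(1,2)] wM Suc.prems by (auto simp: prefix_prod_Suc_shift intro: mult_dvs_mono)
    ultimately show ?thesis using dvs_trans x x'M by (meson simple_closed mult_closed)
  qed
qed simp

lemma prefix_prod_inj:
  "\<xi> \<in> Mbar k n \<Longrightarrow> \<eta> \<in> Mbar k n \<Longrightarrow> prefix_prod \<xi> i = prefix_prod \<eta> i \<Longrightarrow> l < i \<Longrightarrow> \<xi> l = \<eta> l"
proof (induction i arbitrary: \<xi> \<eta> l)
  case (Suc i)
  have "\<xi> 0 \<preceq> prefix_prod \<xi> (Suc i)" "\<eta> 0 \<preceq> prefix_prod \<eta> (Suc i)"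
    using Suc.prems(1,2) by (simp_all add: head_dvs_prefix_prod)
  then have "\<xi> 0 \<preceq> \<eta> 0" "\<eta> 0 \<preceq> \<xi> 0" using simple_dvs_prefix_prod Suc.prems Mbar_simple by metis+
  then have head: "\<xi> 0 = \<eta> 0" using dvs_antisym Suc.prems by auto
  then have "prefix_prod (shift \<xi>) i = prefix_prod (shift \<eta>) i"
    using left_cancel[of "\<xi> 0"] Suc.prems by (simp add: prefix_prod_Suc_shift)
  then show ?case
    using Suc.IH[of "shift \<xi>" "shift \<eta>" "l - 1"] Suc.prems Mbar_shift head by (cases l) auto
qed simp

lemma greatest_simple_divisor_arrow:
  assumes "a \<in> \<S>" "m \<in> M" "\<And>z. z \<in> \<S> \<Longrightarrow> z \<preceq> a \<odot> m \<Longrightarrow> z \<preceq> a" "y \<preceq> m"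
  shows "a \<leadsto> y"
  unfolding arrow_iff
proof (intro ballI impI notI)
  fix t assume t: "t \<in> \<Sigma>" "\<sigma> t \<preceq> y" and simple: "a \<odot> \<sigma> t \<in> \<S>"
  have "\<sigma> t \<preceq> m" using dvs_trans[OF _ t(2) assms(4)] t(1) by simp
  then have "a \<odot> \<sigma> t \<preceq> a \<odot> m" using assms(1) t(1) by (intro mult_dvs_mono) auto
  then have "a \<odot> \<sigma> t \<preceq> a" using assms(3) simple by blast
  then show False using not_mult_gen_dvs assms(1) t(1) by simp
qed

lemma normal_form_exists:
  "m \<in> M \<Longrightarrow> \<exists>\<xi>\<in>Mbar k n. (\<forall>i\<ge>blen m. \<xi> i = \<one>) \<and> prefix_prod \<xi> (blen m) = m"
proof (induction "blen m" arbitrary: m rule: less_induct)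
  case less
  show ?case
  proof (cases "m = \<one>")
    case True
    then show ?thesis by (intro bexI[of _ "\<lambda>_. \<one>"]) auto
  next
    case False
    obtain a where a: "a \<in> \<S>" "a \<preceq> m" "\<And>z. z \<in> \<S> \<Longrightarrow> z \<preceq> m \<Longrightarrow> z \<preceq> a"
      using greatest_simple_divisor[OF less.prems] by blast
    obtain m' where m': "m' \<in> M" "m = a \<odot> m'" using a(2) by (rule dvsE)
    obtain s where "s \<in> \<Sigma>" "\<sigma> s \<preceq> m" using nontrivial_gen_dvs less.prems False by blast
    then have "1 \<le> blen a" using a(3)[of "\<sigma> s"] dvs_blen_le[of "\<sigma> s" a] by simp
    then have shorter: "blen m' < blen m" using m' a by simp
    then obtain \<xi> where \<xi>: "\<xi> \<in> Mbar k n" "\<And>i. blen m' \<le> i \<Longrightarrow> \<xi> i = \<one>" "prefix_prod \<xi> (blen m') = m'"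
      using less.hyps m' by blast
    have prod: "prefix_prod \<xi> i = m'" if "blen m' \<le> i" for i
      using prefix_prod_trailing_ones[of \<xi> "blen m'" i] \<xi> that by simp
    have "\<xi> 0 \<preceq> prefix_prod \<xi> (Suc (blen m'))" using \<xi>(1) by (simp add: head_dvs_prefix_prod)
    then have "a \<leadsto> \<xi> 0" using greatest_simple_divisor_arrow[OF a(1) m'(1)] a(3) m'(2) prod by simp
    then have "case_nat a \<xi> \<in> Mbar k n" using \<xi>(1) a(1) unfolding Mbar_def by (auto split: nat.split)
    moreover have "\<forall>i\<ge>blen m. case_nat a \<xi> i = \<one>" using \<xi>(2) shorter by (auto split: nat.split)
    moreover have "prefix_prod (case_nat a \<xi>) (blen m) = m"
      using shorter prod[of "blen m - 1"] m'(2) prefix_prod_Suc_shift[of "case_nat a \<xi>" "blen m - 1"]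
      by simp
    ultimately show ?thesis by blast
  qed
qed

lemma nfs_eqI:
  assumes "\<xi> \<in> Mbar k n" "\<And>i. N \<le> i \<Longrightarrow> \<xi> i = \<one>" "prefix_prod \<xi> N = m"
  shows "nfs k n m = \<xi>"
  unfolding nfs_def prefix_prod_def[symmetric]
proof (rule the_equality)
  show "\<xi> \<in> Mbar k n \<and> (\<exists>N. (\<forall>i\<ge>N. \<xi> i = \<one>) \<and> prefix_prod \<xi> N = m)" using assms by blast
next
  fix \<eta> assume "\<eta> \<in> Mbar k n \<and> (\<exists>N. (\<forall>i\<ge>N. \<eta> i = \<one>) \<and> prefix_prod \<eta> N = m)"
  then obtain N' where \<eta>: "\<eta> \<in> Mbar k n" "\<forall>i\<ge>N'. \<eta> i = \<one>" "prefix_prod \<eta> N' = m" by blast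
  have eq: "prefix_prod \<xi> i = prefix_prod \<eta> i" if "N \<le> i" "N' \<le> i" for i
    using prefix_prod_trailing_ones[of \<xi> N i] prefix_prod_trailing_ones[of \<eta> N' i] assms \<eta> that by simp
  show "\<eta> = \<xi>"
  proof
    fix l show "\<eta> l = \<xi> l"
      using prefix_prod_inj[OF \<eta>(1) assms(1), of "Suc (max l (max N N'))" l]
        eq[of "Suc (max l (max N N'))"] by simp
  qed
qed

lemma nfs_Mbar [simp]: "m \<in> M \<Longrightarrow> nfs k n m \<in> Mbar k n"
  and nfs_tail: "m \<in> M \<Longrightarrow> blen m \<le> i \<Longrightarrow> nfs k n m i = \<one>"
  and prefix_prod_nfs: "m \<in> M \<Longrightarrow> blen m \<le> i \<Longrightarrow> prefix_prod (nfs k n m) i = m"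
proof -
  assume "m \<in> M"
  then obtain \<xi> where \<xi>: "\<xi> \<in> Mbar k n" "\<And>i. blen m \<le> i \<Longrightarrow> \<xi> i = \<one>" "prefix_prod \<xi> (blen m) = m"
    using normal_form_exists by blast
  then have nf: "nfs k n m = \<xi>" using nfs_eqI by blast
  show "nfs k n m \<in> Mbar k n" using nf \<xi> by simp
  show "nfs k n m i = \<one>" if "blen m \<le> i" using nf \<xi> that by simp
  show "prefix_prod (nfs k n m) i = m" if "blen m \<le> i"
    using nf \<xi> prefix_prod_trailing_ones[of \<xi> "blen m" i] that by simp
qed

lemma nfs_inj: "x \<in> M \<Longrightarrow> y \<in> M \<Longrightarrow> nfs k n x = nfs k n y \<Longrightarrow> x = y"
  by (metis prefix_prod_nfs max.cobounded1 max.cobounded2)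

lemma nfs_one [simp]: "nfs k n \<one> = (\<lambda>_. \<one>)"
  by (rule nfs_eqI[where N = 0]) auto

lemma nfs_prefix_prod: "\<xi> \<in> Mbar k n \<Longrightarrow> nfs k n (prefix_prod \<xi> j) = truncate j \<xi>"
  by (rule nfs_eqI[where N = j]) (simp, simp add: truncate_def, simp)

subsection \<open>Complements in powers of the Garside element\<close>

text \<open>The complements of the factors of a normal sequence, read backwards and twisted by \<open>\<phi>\<close>, form the
  normal sequence of the complement in a power of \<open>\<Delta>\<close>.\<close>

definition complement_sequence :: "(nat \<Rightarrow> elt) \<Rightarrow> nat \<Rightarrow> nat \<Rightarrow> elt" where
  "complement_sequence \<xi> r i = (if i < r then (\<phi> ^^ i) (\<partial> (\<xi> (r - 1 - i))) else \<one>)"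

lemma \<phi>_funpow_simple: "x \<in> \<S> \<Longrightarrow> (\<phi> ^^ i) x \<in> \<S>"
  by (induction i) auto

lemma \<phi>_funpow_arrow: "x \<in> \<S> \<Longrightarrow> y \<in> \<S> \<Longrightarrow> x \<leadsto> y \<Longrightarrow> (\<phi> ^^ i) x \<leadsto> (\<phi> ^^ i) y"
  by (induction i) (auto simp: \<phi>_arrow \<phi>_funpow_simple)

lemma complement_sequence_Mbar:
  assumes "\<xi> \<in> Mbar k n" shows "complement_sequence \<xi> r \<in> Mbar k n"
proof -
  have "complement_sequence \<xi> r i \<in> \<S>" for i
    unfolding complement_sequence_def using assms by (auto simp: \<phi>_funpow_simple)
  moreover have "complement_sequence \<xi> r i \<leadsto> complement_sequence \<xi> r (Suc i)" for i
  proof (cases "Suc i < r")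
    case True
    then have "r - 1 - i = Suc (r - 1 - Suc i)" by simp
    then have "\<partial> (\<xi> (r - 1 - i)) \<leadsto> \<phi> (\<partial> (\<xi> (r - 1 - Suc i)))"
      using complement_arrow[OF _ _ Mbar_arrow[OF assms, of "r - 1 - Suc i"]] assms by simp
    then show ?thesis
      using True \<phi>_funpow_arrow assms unfolding complement_sequence_def by (simp add: funpow_swap1)
  qed (simp add: complement_sequence_def)
  ultimately show ?thesis unfolding Mbar_def by blast
qed

lemma prefix_prod_mult_complement_sequence:
  assumes "\<xi> \<in> Mbar k n"
  shows "prefix_prod \<xi> r \<odot> prefix_prod (complement_sequence \<xi> r) r = prefix_prod (\<lambda>_. \<Delta>) r"
proof (induction r)
  case (Suc r)
  let ?y = "prefix_prod (complement_sequence \<xi> r) r"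
  have closed: "complement_sequence \<xi> r i \<in> M" for r i using complement_sequence_Mbar[OF assms] by simp
  then have yM: "?y \<in> M" by simp
  have cM: "\<partial> (\<xi> r) \<in> M" using assms by simp
  have "prefix_prod (shift (complement_sequence \<xi> (Suc r))) r = prefix_prod (\<lambda>i. \<phi> (complement_sequence \<xi> r i)) r"
    by (rule prefix_prod_cong) (simp add: complement_sequence_def)
  also have "\<dots> = \<phi> ?y" using closed by (rule prefix_prod_\<phi>)
  finally have y': "prefix_prod (complement_sequence \<xi> (Suc r)) (Suc r) = \<partial> (\<xi> r) \<odot> \<phi> ?y"
    by (simp add: prefix_prod_Suc_shift) (simp add: complement_sequence_def)
  have "prefix_prod \<xi> (Suc r) \<odot> prefix_prod (complement_sequence \<xi> (Suc r)) (Suc r) =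
      prefix_prod \<xi> r \<odot> (\<xi> r \<odot> \<partial> (\<xi> r) \<odot> \<phi> ?y)"
    unfolding y' using assms yM cM by (simp add: prefix_prod_Suc mult_assoc)
  also have "\<xi> r \<odot> \<partial> (\<xi> r) \<odot> \<phi> ?y = ?y \<odot> \<Delta>" using complement_mult assms mult_Delta[OF yM] by simp
  also have "prefix_prod \<xi> r \<odot> (?y \<odot> \<Delta>) = prefix_prod (\<lambda>_. \<Delta>) r \<odot> \<Delta>"
    using Suc.IH assms yM by (simp flip: mult_assoc)
  finally show ?case by (simp add: prefix_prod_Suc)
qed simp

lemma prefix_prod_Suc_dvs_prefix_prodD:
  assumes \<xi>: "\<xi> \<in> Mbar k n" and \<eta>: "\<eta> \<in> Mbar k n" and dvs: "prefix_prod \<xi> (Suc r) \<preceq> prefix_prod \<eta> r"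
  shows "\<xi> r = \<one>"
proof -
  let ?c = "complement_sequence \<xi> (Suc r)" and ?d = "complement_sequence \<eta> r"
  have closed: "?c i \<in> M" "?d i \<in> M" for i using complement_sequence_Mbar \<xi> \<eta> by simp_all
  obtain y where y: "y \<in> M" "prefix_prod \<eta> r = prefix_prod \<xi> (Suc r) \<odot> y" using dvs by (rule dvsE)
  define y' where "y' = y \<odot> prefix_prod ?d r"
  have y'M: "y' \<in> M" unfolding y'_def using y closed by simp
  have "prefix_prod (\<lambda>_. \<Delta>) r = prefix_prod \<xi> (Suc r) \<odot> y'"
    unfolding y'_def prefix_prod_mult_complement_sequence[OF \<eta>, symmetric] y(2)
    using y closed \<xi> by (simp add: mult_assoc)
  then have "prefix_prod \<xi> (Suc r) \<odot> prefix_prod ?c (Suc r) = prefix_prod \<xi> (Suc r) \<odot> (\<Delta> \<odot> \<phi> y')"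
    unfolding prefix_prod_mult_complement_sequence[OF \<xi>]
    using y'M \<xi> mult_Delta[OF y'M] by (simp add: prefix_prod_Suc mult_assoc)
  then have "prefix_prod ?c (Suc r) = \<Delta> \<odot> \<phi> y'"
    using left_cancel[of "prefix_prod \<xi> (Suc r)" "prefix_prod ?c (Suc r)" "\<Delta> \<odot> \<phi> y'"] \<xi> closed y'M by simp
  then have "\<Delta> \<preceq> prefix_prod ?c (Suc r)" using dvsI[of "\<phi> y'" \<Delta>] y'M by simp
  then have "\<Delta> \<preceq> ?c 0" by (rule simple_dvs_prefix_prod[OF complement_sequence_Mbar[OF \<xi>] Delta_simple])
  then show ?thesis using Delta_dvs_complementD \<xi> by (simp add: complement_sequence_def)
qed

lemma prefix_prod_mult_gen_dvsD:
  assumes \<xi>: "\<xi> \<in> Mbar k n" and \<eta>: "\<eta> \<in> Mbar k n"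
    and s: "s \<in> \<Sigma>" "prefix_prod \<xi> (Suc j) \<odot> \<sigma> s \<preceq> prefix_prod \<eta> (Suc j)"
  shows "\<xi> j \<odot> \<sigma> s \<in> \<S>"
proof (rule ccontr)
  assume "\<xi> j \<odot> \<sigma> s \<notin> \<S>"
  then have \<zeta>: "append_factor \<xi> (Suc j) (\<sigma> s) \<in> Mbar k n" (is "?\<zeta> \<in> _")
    using \<xi> s by (simp add: arrow_gen_iff append_factor_Suc_Mbar)
  then have "prefix_prod ?\<zeta> (Suc (Suc j)) \<preceq> prefix_prod \<eta> (Suc j)"
    using s(2) by (simp add: prefix_prod_append_factor)
  then have "?\<zeta> (Suc j) = \<one>" by (rule prefix_prod_Suc_dvs_prefix_prodD[OF \<zeta> \<eta>])
  then show False by simp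
qed

lemma blen_prefix_prod_ge:
  assumes "\<zeta> \<in> Mbar k n" "\<zeta> j \<noteq> \<one>"
  shows "Suc j \<le> blen (prefix_prod \<zeta> (Suc j))"
proof -
  have "i \<le> blen (prefix_prod \<zeta> i)" if "i \<le> Suc j" for i
    using that
  proof (induction i)
    case (Suc i)
    then have "\<zeta> i \<noteq> \<one>" using Mbar_one_absorbing[OF assms(1), of i j] assms(2) by auto
    then have "0 < blen (\<zeta> i)" using assms(1) blen_eq_0_iff[of "\<zeta> i"] Mbar_closed gr0I by blast
    then show ?case using Suc assms(1) by (simp add: prefix_prod_Suc)
  qed simp
  then show ?thesis by blast
qed

end

section \<open>Cylinders\<close>

lemma prob_onD:
  assumes "prob_on k n \<nu>"
  shows "prob_space \<nu>" and "sets \<nu> = sets (Bbar k n)"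
  using assms unfolding prob_on_def by auto

context garside
begin

lemma topspace_Tbar [simp]: "topspace (Tbar k n) = Mbar k n"
  unfolding Tbar_def Mbar_def by auto

lemma space_Bbar [simp]: "space (Bbar k n) = Mbar k n"
  unfolding Bbar_def borel_of_top_def by (simp add: space_measure_of_conv)

subsection \<open>The cylinder topology\<close>

definition cylinder :: "(nat \<Rightarrow> elt) \<Rightarrow> nat \<Rightarrow> (nat \<Rightarrow> elt) set" where
  "cylinder \<xi> j = {\<eta> \<in> Mbar k n. \<forall>i<j. \<eta> i = \<xi> i}"

lemma mem_cylinder_self [simp]: "\<xi> \<in> Mbar k n \<Longrightarrow> \<xi> \<in> cylinder \<xi> j"
  unfolding cylinder_def by simp

lemma cylinder_0 [simp]: "cylinder \<xi> 0 = Mbar k n"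
  unfolding cylinder_def by simp

lemma cylinder_truncate [simp]: "cylinder (truncate j \<xi>) j = cylinder \<xi> j"
  unfolding cylinder_def truncate_def by auto

lemma cylinder_eq: "\<eta> \<in> cylinder \<xi> j \<Longrightarrow> cylinder \<xi> j = cylinder \<eta> j"
  unfolding cylinder_def by auto

lemma prefix_prod_cylinder: "\<eta> \<in> cylinder \<xi> j \<Longrightarrow> prefix_prod \<eta> j = prefix_prod \<xi> j"
  by (rule prefix_prod_cong) (simp add: cylinder_def)

lemma mem_cylinder_iff_prefix_prod:
  assumes "\<xi> \<in> Mbar k n" "\<eta> \<in> Mbar k n"
  shows "\<eta> \<in> cylinder \<xi> j \<longleftrightarrow> prefix_prod \<eta> j = prefix_prod \<xi> j"
proof
  assume "prefix_prod \<eta> j = prefix_prod \<xi> j"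
  then show "\<eta> \<in> cylinder \<xi> j" unfolding cylinder_def using assms prefix_prod_inj by blast
qed (rule prefix_prod_cylinder)

lemma openin_cylinder: "openin (Tbar k n) (cylinder \<xi> j)"
proof -
  define V where "V i = (if i < j then {\<xi> i} \<inter> \<S> else \<S>)" for i
  have "finite {i. V i \<noteq> \<S>}" by (rule finite_subset[of _ "{..<j}"]) (auto simp: V_def)
  then have "openin (product_topology (\<lambda>_. discrete_topology \<S>) UNIV) (PiE UNIV V)"
    by (intro product_topology_basis) (auto simp: V_def)
  moreover have "cylinder \<xi> j = PiE UNIV V \<inter> Mbar k n"
    unfolding cylinder_def V_def by (auto simp: PiE_iff split: if_splits) (metis Mbar_simple)
  ultimately show ?thesis unfolding Tbar_def openin_subtopology by blast
qed

lemma openin_Tbar_contains_cylinder: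
  assumes "openin (Tbar k n) T" "\<xi> \<in> T" shows "\<exists>j. cylinder \<xi> j \<subseteq> T"
proof -
  obtain T' where T': "openin (product_topology (\<lambda>_. discrete_topology \<S>) (UNIV :: nat set)) T'"
      "T = T' \<inter> Mbar k n"
    using assms(1) unfolding Tbar_def openin_subtopology by blast
  then obtain V where V: "finite {i. V i \<noteq> \<S>}" "\<xi> \<in> PiE UNIV V" "PiE UNIV V \<subseteq> T'"
    using assms(2) unfolding openin_product_topology_alt by fastforce
  obtain j where j: "\<And>i. V i \<noteq> \<S> \<Longrightarrow> i < j"
    using V(1) unfolding finite_nat_set_iff_bounded by auto
  have "cylinder \<xi> j \<subseteq> T"
  proof
    fix \<eta> assume \<eta>: "\<eta> \<in> cylinder \<xi> j"
    have "\<eta> i \<in> V i" for i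
      using \<eta> V(2) j[of i] Mbar_simple[of \<eta> i] unfolding cylinder_def by (cases "V i = \<S>") (auto simp: PiE_iff)
    then have "\<eta> \<in> PiE UNIV V" by auto
    then show "\<eta> \<in> T" using V(3) T' \<eta> unfolding cylinder_def by auto
  qed
  then show ?thesis by blast
qed

definition normal_words :: "nat \<Rightarrow> (nat \<Rightarrow> elt) set" where
  "normal_words j = truncate j ` Mbar k n"

lemma normal_words_Mbar [simp]: "\<zeta> \<in> normal_words j \<Longrightarrow> \<zeta> \<in> Mbar k n"
  unfolding normal_words_def by auto

lemma finite_normal_words [simp]: "finite (normal_words j)"
proof (rule finite_subset)
  show "normal_words j \<subseteq> (\<lambda>f i. if i < j then f i else \<one>) ` (PiE {..<j} (\<lambda>_. \<S>))"
  proof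
    fix \<zeta> assume "\<zeta> \<in> normal_words j"
    then obtain \<xi> where \<xi>: "\<xi> \<in> Mbar k n" "\<zeta> = truncate j \<xi>" unfolding normal_words_def by blast
    have "\<zeta> = (\<lambda>i. if i < j then restrict \<xi> {..<j} i else \<one>)"
      using \<xi> by (simp add: truncate_def fun_eq_iff)
    moreover have "restrict \<xi> {..<j} \<in> PiE {..<j} (\<lambda>_. \<S>)" using \<xi> by auto
    ultimately show "\<zeta> \<in> (\<lambda>f i. if i < j then f i else \<one>) ` (PiE {..<j} (\<lambda>_. \<S>))" by blast
  qed
qed (simp add: finite_PiE)

lemma disjoint_cylinders: "disjoint_family_on (\<lambda>\<zeta>. cylinder \<zeta> j) (normal_words j)"
  unfolding disjoint_family_on_def
proof (intro ballI impI)
  fix \<zeta> \<zeta>' assume words: "\<zeta> \<in> normal_words j" "\<zeta>' \<in> normal_words j" "\<zeta> \<noteq> \<zeta>'"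
  then obtain i where i: "\<zeta> i \<noteq> \<zeta>' i" by (meson ext)
  then have "i < j" using words unfolding normal_words_def truncate_def by (auto split: if_splits)
  then show "cylinder \<zeta> j \<inter> cylinder \<zeta>' j = {}" using i unfolding cylinder_def by auto
qed

definition cylinders :: "(nat \<Rightarrow> elt) set set" where
  "cylinders = {cylinder \<xi> j | \<xi> j. True}"

lemma empty_in_cylinders: "{} \<in> cylinders"
proof -
  have "w \<in> cls k n w" for w by (simp add: cls_def beq_refl)
  then have "{} \<notin> M" unfolding Mon_def by auto
  then have "\<eta> 0 \<noteq> {}" if "\<eta> \<in> Mbar k n" for \<eta> using Mbar_closed[OF that, of 0] by metis
  then have "cylinder (\<lambda>_. {}) 1 = {}" unfolding cylinder_def by auto
  then show ?thesis unfolding cylinders_def by blast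
qed

lemma cylinders_subset_Pow: "cylinders \<subseteq> Pow (Mbar k n)"
  unfolding cylinders_def cylinder_def by auto

lemma countable_cylinders: "countable cylinders"
proof (rule countable_subset)
  show "cylinders \<subseteq> insert {} (\<Union>j. (\<lambda>\<zeta>. cylinder \<zeta> j) ` normal_words j)"
  proof
    fix A assume "A \<in> cylinders"
    then obtain \<xi> j where A: "A = cylinder \<xi> j" unfolding cylinders_def by blast
    show "A \<in> insert {} (\<Union>j. (\<lambda>\<zeta>. cylinder \<zeta> j) ` normal_words j)"
    proof (cases "A = {}")
      case False
      then obtain \<eta> where \<eta>: "\<eta> \<in> cylinder \<xi> j" unfolding A by blast
      then have "truncate j \<eta> \<in> normal_words j" unfolding normal_words_def cylinder_def by blast
      moreover have "A = cylinder (truncate j \<eta>) j" using A cylinder_eq[OF \<eta>] by simp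
      ultimately show ?thesis by blast
    qed simp
  qed
qed (simp add: countable_finite)

lemma Int_stable_cylinders: "Int_stable cylinders"
proof (rule Int_stableI)
  have le: "cylinder \<xi> i \<inter> cylinder \<eta> j \<in> cylinders" if "i \<le> j" for \<xi> \<eta> i j
  proof (cases "\<forall>l<i. \<xi> l = \<eta> l")
    case True
    then have "cylinder \<xi> i \<inter> cylinder \<eta> j = cylinder \<eta> j" using that unfolding cylinder_def by auto
    then show ?thesis unfolding cylinders_def by auto
  next
    case False
    then have "cylinder \<xi> i \<inter> cylinder \<eta> j = {}" using that unfolding cylinder_def by fastforce
    then show ?thesis using empty_in_cylinders by simp
  qed
  fix A B assume "A \<in> cylinders" "B \<in> cylinders"
  then obtain \<xi> i \<eta> j where "A = cylinder \<xi> i" "B = cylinder \<eta> j" unfolding cylinders_def by blast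
  then show "A \<inter> B \<in> cylinders" using le[of i j \<xi> \<eta>] le[of j i \<eta> \<xi>] by (cases "i \<le> j") (auto simp: Int_commute)
qed

lemma openin_Tbar_sigma_sets:
  assumes "openin (Tbar k n) T" shows "T \<in> sigma_sets (Mbar k n) cylinders"
proof -
  have "T \<subseteq> \<Union>{A \<in> cylinders. A \<subseteq> T}"
  proof
    fix \<xi> assume \<xi>: "\<xi> \<in> T"
    then have "\<xi> \<in> Mbar k n" using openin_subset[OF assms] by auto
    moreover obtain j where "cylinder \<xi> j \<subseteq> T" using openin_Tbar_contains_cylinder[OF assms \<xi>] by blast
    ultimately show "\<xi> \<in> \<Union>{A \<in> cylinders. A \<subseteq> T}" unfolding cylinders_def by fastforce
  qed
  then have "T = \<Union>{A \<in> cylinders. A \<subseteq> T}" by blast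
  also have "\<dots> \<in> sigma_sets (Mbar k n) cylinders"
    using countable_cylinders by (intro sigma_sets_UNION) (auto intro: countable_subset[of _ cylinders])
  finally show ?thesis .
qed

lemma sets_Bbar: "sets (Bbar k n) = sigma_sets (Mbar k n) cylinders"
proof -
  have "{U. openin (Tbar k n) U} \<subseteq> Pow (Mbar k n)" using openin_subset by fastforce
  then have "sets (Bbar k n) = sigma_sets (Mbar k n) {U. openin (Tbar k n) U}"
    unfolding Bbar_def borel_of_top_def by simp
  also have "\<dots> = sigma_sets (Mbar k n) cylinders"
    using openin_Tbar_sigma_sets openin_cylinder
    by (intro sigma_sets_eqI) (auto simp: cylinders_def)
  finally show ?thesis .
qed

lemma cylinder_sets [measurable]: "cylinder \<xi> j \<in> sets (Bbar k n)"
  unfolding sets_Bbar cylinders_def by auto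

lemma prob_on_eqI:
  assumes \<nu>: "prob_on k n \<nu>" and \<nu>': "prob_on k n \<nu>'"
    and eq: "\<And>\<xi> j. \<xi> \<in> Mbar k n \<Longrightarrow> measure \<nu> (cylinder \<xi> (Suc j)) = measure \<nu>' (cylinder \<xi> (Suc j))"
  shows "\<nu> = \<nu>'"
proof -
  interpret \<nu>: prob_space \<nu> using \<nu> by (rule prob_onD)
  interpret \<nu>': prob_space \<nu>' using \<nu>' by (rule prob_onD)
  have sets: "sets \<nu> = sets (Bbar k n)" "sets \<nu>' = sets (Bbar k n)" using \<nu> \<nu>' by (simp_all add: prob_onD)
  then have space: "space \<nu> = Mbar k n" "space \<nu>' = Mbar k n" using sets_eq_imp_space_eq space_Bbar by metis+
  have measure_eq: "measure \<nu> A = measure \<nu>' A" if A: "A \<in> cylinders" for A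
  proof (cases "A = {}")
    case False
    obtain \<xi> j where \<xi>: "A = cylinder \<xi> j" using A unfolding cylinders_def by blast
    then obtain \<eta> where \<eta>: "\<eta> \<in> cylinder \<xi> j" using False by blast
    then have "\<eta> \<in> Mbar k n" "A = cylinder \<eta> j" using \<xi> cylinder_eq by (auto simp: cylinder_def)
    then show ?thesis using eq[of \<eta>] \<nu>.prob_space \<nu>'.prob_space space by (cases j) auto
  qed simp
  show ?thesis
  proof (rule measure_eqI_generator_eq[OF Int_stable_cylinders cylinders_subset_Pow])
    show "emeasure \<nu> A = emeasure \<nu>' A" if "A \<in> cylinders" for A
      using measure_eq[OF that] by (simp add: \<nu>.emeasure_eq_measure \<nu>'.emeasure_eq_measure)
    show "range (\<lambda>_ :: nat. Mbar k n) \<subseteq> cylinders"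
      using cylinder_0 unfolding cylinders_def by blast
  qed (auto simp: sets sets_Bbar)
qed

lemma cylinder_eq_UN_append_factor:
  "cylinder \<xi> (Suc j) = (\<Union>y\<in>{y \<in> \<S>. \<xi> j \<leadsto> y}. cylinder (append_factor \<xi> (Suc j) y) (Suc (Suc j)))"
proof (intro set_eqI iffI)
  fix \<eta> assume \<eta>: "\<eta> \<in> cylinder \<xi> (Suc j)"
  then have "\<eta> (Suc j) \<in> {y \<in> \<S>. \<xi> j \<leadsto> y}" using Mbar_arrow[of \<eta> j] unfolding cylinder_def by auto
  moreover have "\<eta> \<in> cylinder (append_factor \<xi> (Suc j) (\<eta> (Suc j))) (Suc (Suc j))"
    using \<eta> unfolding cylinder_def append_factor_def truncate_def by (auto simp: less_Suc_eq)
  ultimately show "\<eta> \<in> (\<Union>y\<in>{y \<in> \<S>. \<xi> j \<leadsto> y}. cylinder (append_factor \<xi> (Suc j) y) (Suc (Suc j)))" by blast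
qed (auto simp: cylinder_def append_factor_def truncate_def)

lemma measure_cylinder_eq_sum_append_factor:
  assumes "prob_on k n \<nu>"
  shows "measure \<nu> (cylinder \<xi> (Suc j)) =
    (\<Sum>y\<in>{y \<in> \<S>. \<xi> j \<leadsto> y}. measure \<nu> (cylinder (append_factor \<xi> (Suc j) y) (Suc (Suc j))))"
proof -
  interpret \<nu>: prob_space \<nu> using assms by (rule prob_onD)
  have "disjoint_family_on (\<lambda>y. cylinder (append_factor \<xi> (Suc j) y) (Suc (Suc j))) {y \<in> \<S>. \<xi> j \<leadsto> y}"
    unfolding disjoint_family_on_def cylinder_def append_factor_def by auto
  then show ?thesis
    unfolding cylinder_eq_UN_append_factor[of \<xi> j]
    by (intro \<nu>.finite_measure_finite_Union) (auto simp: prob_onD[OF assms])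
qed

subsection \<open>The sets of multiples\<close>

lemma Up_eq:
  assumes "x \<in> simple_products j" shows "Up k n x = {\<eta> \<in> Mbar k n. x \<preceq> prefix_prod \<eta> j}"
proof (intro set_eqI iffI)
  have xM: "x \<in> M" using assms simple_products_closed by blast
  {
    fix \<xi> assume \<xi>: "\<xi> \<in> Up k n x"
    then have \<xi>M: "\<xi> \<in> Mbar k n" unfolding Up_def in_closure_of by simp
    obtain z where z: "z \<in> M" "nfs k n (x \<odot> z) \<in> cylinder \<xi> j"
      using \<xi> openin_cylinder[of \<xi> j] \<xi>M unfolding Up_def in_closure_of by (auto dest: mem_cylinder_self)
    have xzM: "x \<odot> z \<in> M" using xM z by simp
    have "x \<preceq> prefix_prod (nfs k n (x \<odot> z)) (blen (x \<odot> z))"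
      using prefix_prod_nfs[OF xzM order_refl] z by auto
    then have "x \<preceq> prefix_prod (nfs k n (x \<odot> z)) j"
      using simple_products_dvs_prefix_prod[OF nfs_Mbar[OF xzM] assms] by blast
    then show "\<xi> \<in> {\<eta> \<in> Mbar k n. x \<preceq> prefix_prod \<eta> j}"
      using \<xi>M prefix_prod_cylinder[OF z(2)] by simp
  next
    fix \<xi> assume "\<xi> \<in> {\<eta> \<in> Mbar k n. x \<preceq> prefix_prod \<eta> j}"
    then have \<xi>: "\<xi> \<in> Mbar k n" "x \<preceq> prefix_prod \<xi> j" by auto
    have "\<exists>\<eta>. \<eta> \<in> {nfs k n (x \<odot> z) |z. z \<in> M} \<and> \<eta> \<in> T" if T: "\<xi> \<in> T" "openin (Tbar k n) T" for T
    proof -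
      obtain i where i: "cylinder \<xi> i \<subseteq> T" using openin_Tbar_contains_cylinder T by blast
      let ?m = "max i j"
      have "x \<preceq> prefix_prod \<xi> ?m"
        using dvs_trans[OF xM \<xi>(2)] prefix_prod_dvs_mono[of \<xi> j ?m] \<xi>(1) by simp
      then obtain z where z: "z \<in> M" "prefix_prod \<xi> ?m = x \<odot> z" by (rule dvsE)
      have "truncate ?m \<xi> \<in> cylinder \<xi> i"
        using truncate_Mbar[OF \<xi>(1), of ?m] by (auto simp: cylinder_def truncate_def less_max_iff_disj)
      then have "nfs k n (x \<odot> z) \<in> T" using nfs_prefix_prod[OF \<xi>(1), of ?m] z(2) i by auto
      then show ?thesis using z(1) by blast
    qed
    then show "\<xi> \<in> Up k n x" using \<xi> unfolding Up_def in_closure_of by auto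
  }
qed

lemma Up_blen_eq: "x \<in> M \<Longrightarrow> blen x \<le> j \<Longrightarrow> Up k n x = {\<eta> \<in> Mbar k n. x \<preceq> prefix_prod \<eta> j}"
  by (intro Up_eq simple_products_blen_le)

definition normal_multiples :: "elt \<Rightarrow> nat \<Rightarrow> (nat \<Rightarrow> elt) set" where
  "normal_multiples x j = {\<zeta> \<in> normal_words j. x \<preceq> prefix_prod \<zeta> j}"

lemma finite_normal_multiples [simp]: "finite (normal_multiples x j)"
  and normal_multiples_Mbar [simp]: "\<zeta> \<in> normal_multiples x j \<Longrightarrow> \<zeta> \<in> Mbar k n"
  unfolding normal_multiples_def by auto

lemma normal_multiples_one [simp]: "normal_multiples \<one> j = normal_words j"
  unfolding normal_multiples_def by auto

lemma Up_eq_UN_cylinder: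
  assumes "x \<in> simple_products j" shows "Up k n x = (\<Union>\<zeta>\<in>normal_multiples x j. cylinder \<zeta> j)"
proof (intro set_eqI iffI)
  fix \<xi> assume "\<xi> \<in> Up k n x"
  then have \<xi>: "\<xi> \<in> Mbar k n" "x \<preceq> prefix_prod \<xi> j" unfolding Up_eq[OF assms] by auto
  then have "truncate j \<xi> \<in> normal_multiples x j"
    unfolding normal_multiples_def normal_words_def by simp
  moreover have "\<xi> \<in> cylinder (truncate j \<xi>) j" using \<xi>(1) by simp
  ultimately show "\<xi> \<in> (\<Union>\<zeta>\<in>normal_multiples x j. cylinder \<zeta> j)" by blast
next
  fix \<xi> assume "\<xi> \<in> (\<Union>\<zeta>\<in>normal_multiples x j. cylinder \<zeta> j)"
  then obtain \<zeta> where \<zeta>: "x \<preceq> prefix_prod \<zeta> j" "\<xi> \<in> cylinder \<zeta> j" unfolding normal_multiples_def by blast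
  then show "\<xi> \<in> Up k n x"
    unfolding Up_eq[OF assms] using prefix_prod_cylinder[OF \<zeta>(2)] by (simp add: cylinder_def)
qed

lemma Up_sets [measurable]: "x \<in> M \<Longrightarrow> Up k n x \<in> sets (Bbar k n)"
  unfolding Up_eq_UN_cylinder[OF simple_products_blen] by (intro sets.finite_UN) auto

lemma measure_Up_eq_sum:
  assumes \<nu>: "prob_on k n \<nu>" and x: "x \<in> simple_products j"
  shows "measure \<nu> (Up k n x) = (\<Sum>\<zeta>\<in>normal_multiples x j. measure \<nu> (cylinder \<zeta> j))"
proof -
  interpret \<nu>: prob_space \<nu> using \<nu> by (rule prob_onD)
  have "disjoint_family_on (\<lambda>\<zeta>. cylinder \<zeta> j) (normal_multiples x j)"
    using disjoint_cylinders[of j] unfolding disjoint_family_on_def normal_multiples_def by blast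
  then show ?thesis unfolding Up_eq_UN_cylinder[OF x]
    by (intro \<nu>.finite_measure_finite_Union) (auto simp: prob_onD[OF \<nu>])
qed

lemma prefix_prod_eq_iff_dvs:
  fixes j :: nat
  assumes \<xi>: "\<xi> \<in> Mbar k n" and \<eta>: "\<eta> \<in> Mbar k n"
  defines "x \<equiv> prefix_prod \<xi> (Suc j)"
  shows "prefix_prod \<eta> (Suc j) = x \<longleftrightarrow>
    x \<preceq> prefix_prod \<eta> (Suc j) \<and> (\<forall>s\<in>\<Sigma> - R (\<xi> j). \<not> x \<odot> \<sigma> s \<preceq> prefix_prod \<eta> (Suc j))"
proof
  have xM: "x \<in> M" using \<xi> unfolding x_def by simp
  show "x \<preceq> prefix_prod \<eta> (Suc j) \<and> (\<forall>s\<in>\<Sigma> - R (\<xi> j). \<not> x \<odot> \<sigma> s \<preceq> prefix_prod \<eta> (Suc j))"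
    if "prefix_prod \<eta> (Suc j) = x" unfolding that using xM not_mult_gen_dvs by simp
  assume dvs: "x \<preceq> prefix_prod \<eta> (Suc j) \<and> (\<forall>s\<in>\<Sigma> - R (\<xi> j). \<not> x \<odot> \<sigma> s \<preceq> prefix_prod \<eta> (Suc j))"
  then obtain y where y: "y \<in> M" "prefix_prod \<eta> (Suc j) = x \<odot> y" by (auto elim: dvsE)
  have "y = \<one>"
  proof (rule ccontr)
    assume "y \<noteq> \<one>"
    then obtain s where s: "s \<in> \<Sigma>" "\<sigma> s \<preceq> y" using nontrivial_gen_dvs y(1) by blast
    then have below: "x \<odot> \<sigma> s \<preceq> prefix_prod \<eta> (Suc j)" using y xM by (simp add: mult_dvs_mono)
    then have "\<xi> j \<odot> \<sigma> s \<in> \<S>" using prefix_prod_mult_gen_dvsD[OF \<xi> \<eta> s(1)] unfolding x_def by blast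
    then show False using dvs below s unfolding Rset_def by blast
  qed
  then show "prefix_prod \<eta> (Suc j) = x" using y xM by simp
qed

lemma cylinder_eq_Up_Diff:
  fixes j :: nat
  assumes \<xi>: "\<xi> \<in> Mbar k n"
  defines "x \<equiv> prefix_prod \<xi> (Suc j)"
  shows "cylinder \<xi> (Suc j) = Up k n x - (\<Union>s\<in>\<Sigma> - R (\<xi> j). Up k n (x \<odot> \<sigma> s))"
proof -
  have x: "x \<in> simple_products (Suc j)" unfolding x_def using \<xi> by (intro prefix_prod_simple_products) simp
  have xs: "x \<odot> \<sigma> s \<in> simple_products (Suc j)" if s: "s \<in> \<Sigma> - R (\<xi> j)" for s
  proof -
    have simple: "\<xi> j \<odot> \<sigma> s \<in> \<S>" "s \<in> \<Sigma>" using s unfolding Rset_def by auto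
    then have factors: "append_factor \<xi> j (\<xi> j \<odot> \<sigma> s) i \<in> \<S>" for i
      using \<xi> by (simp add: append_factor_def truncate_def)
    have "x \<odot> \<sigma> s = prefix_prod (append_factor \<xi> j (\<xi> j \<odot> \<sigma> s)) (Suc j)"
      unfolding x_def using \<xi> simple factors prefix_prod_append_factor[of \<xi> j "\<xi> j \<odot> \<sigma> s"] prefix_prod_Suc[of \<xi> j]
      by (simp add: mult_assoc)
    then show ?thesis using factors by (simp only: prefix_prod_simple_products)
  qed
  have "\<eta> \<in> cylinder \<xi> (Suc j) \<longleftrightarrow> \<eta> \<in> Mbar k n \<and> x \<preceq> prefix_prod \<eta> (Suc j) \<and>
      (\<forall>s\<in>\<Sigma> - R (\<xi> j). \<not> x \<odot> \<sigma> s \<preceq> prefix_prod \<eta> (Suc j))" for \<eta>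
  proof (cases "\<eta> \<in> Mbar k n")
    case True
    then show ?thesis
      unfolding x_def using mem_cylinder_iff_prefix_prod[OF \<xi> True] prefix_prod_eq_iff_dvs[OF \<xi> True] by blast
  qed (simp add: cylinder_def)
  moreover have "(\<Union>s\<in>\<Sigma> - R (\<xi> j). Up k n (x \<odot> \<sigma> s)) =
      (\<Union>s\<in>\<Sigma> - R (\<xi> j). {\<eta> \<in> Mbar k n. x \<odot> \<sigma> s \<preceq> prefix_prod \<eta> (Suc j)})"
    by (rule SUP_cong[OF refl Up_eq[OF xs]])
  ultimately show ?thesis unfolding Up_eq[OF x] by blast
qed

lemma mult_DeltaX_dvs_iff:
  assumes x: "x \<in> M" and X: "X \<subseteq> \<Sigma>" and m: "m \<in> M"
  shows "x \<odot> DeltaX k n X \<preceq> m \<longleftrightarrow> x \<preceq> m \<and> (\<forall>s\<in>X. x \<odot> \<sigma> s \<preceq> m)"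
proof (cases "x \<preceq> m")
  case True
  then obtain y where y: "y \<in> M" "m = x \<odot> y" by (rule dvsE)
  have "\<sigma> s \<in> M" if "s \<in> X" for s using X that by auto
  then show ?thesis
    using True mult_dvs_mult_iff[OF x _ y(1)] DeltaX_dvs_iff[OF X y(1)] DeltaX_closed[OF X] y(2) by auto
next
  case False
  then show ?thesis using dvs_trans[OF x dvsI[OF DeltaX_closed[OF X]]] by blast
qed

lemma Up_mult_DeltaX:
  assumes x: "x \<in> M" and X: "X \<subseteq> \<Sigma>"
  shows "Up k n (x \<odot> DeltaX k n X) = Up k n x \<inter> (\<Inter>s\<in>X. Up k n (x \<odot> \<sigma> s))"
proof -
  define N where "N = blen x + blen (DeltaX k n X) + 1"
  have "Up k n (x \<odot> DeltaX k n X) = {\<eta> \<in> Mbar k n. x \<odot> DeltaX k n X \<preceq> prefix_prod \<eta> N}"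
    using x DeltaX_closed[OF X] by (intro Up_blen_eq) (auto simp: N_def)
  moreover have "Up k n x = {\<eta> \<in> Mbar k n. x \<preceq> prefix_prod \<eta> N}"
    using x by (intro Up_blen_eq) (auto simp: N_def)
  moreover have "Up k n (x \<odot> \<sigma> s) = {\<eta> \<in> Mbar k n. x \<odot> \<sigma> s \<preceq> prefix_prod \<eta> N}" if "s \<in> X" for s
    using x X that by (intro Up_blen_eq) (auto simp: N_def)
  ultimately show ?thesis using mult_DeltaX_dvs_iff[OF x X] by auto
qed

lemma Up_one [simp]: "Up k n \<one> = Mbar k n"
  using Up_eq[of \<one> 0] by simp

lemma singleton_nfs_eq_cylinder:
  assumes "x \<in> M" shows "{nfs k n x} = cylinder (nfs k n x) (Suc (blen x))"
proof (intro set_eqI iffI)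
  fix \<eta> assume "\<eta> \<in> cylinder (nfs k n x) (Suc (blen x))"
  then have \<eta>: "\<eta> \<in> Mbar k n" "\<And>i. i \<le> blen x \<Longrightarrow> \<eta> i = nfs k n x i" unfolding cylinder_def by auto
  then have "\<eta> (blen x) = \<one>" using nfs_tail[OF assms] by simp
  then have "\<eta> i = nfs k n x i" for i
    using \<eta> Mbar_one_absorbing[of \<eta> "blen x" i] nfs_tail[OF assms, of i] by (cases "i \<le> blen x") auto
  then show "\<eta> \<in> {nfs k n x}" by auto
qed (use assms in simp)

lemma singleton_nfs_sets: "x \<in> M \<Longrightarrow> {nfs k n x} \<in> sets (Bbar k n)"
  using singleton_nfs_eq_cylinder cylinder_sets by metis

lemma Mimg_sets: "Mimg k n \<in> sets (Bbar k n)"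
proof -
  have "Mimg k n = (\<Union>x\<in>M. {nfs k n x})" unfolding Mimg_def by auto
  then show ?thesis using singleton_nfs_sets countable_M by (simp add: sets.countable_UN'')
qed

lemma bdry_sets: "bdry k n \<in> sets (Bbar k n)"
  unfolding bdry_def using Mimg_sets sets.compl_sets[of "Mimg k n" "Bbar k n"] by simp

lemma nfs_in_Up_iff:
  assumes "x \<in> M" "y \<in> M" shows "nfs k n y \<in> Up k n x \<longleftrightarrow> x \<preceq> y"
  using assms Up_blen_eq[of x "max (blen x) (blen y)"] prefix_prod_nfs[of y "max (blen x) (blen y)"] by simp

lemma Up_Int_Mimg: "x \<in> M \<Longrightarrow> Up k n x \<inter> Mimg k n = nfs k n ` {y \<in> M. x \<preceq> y}"
  unfolding Mimg_def using nfs_in_Up_iff by auto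

lemma Deltas_in_Up: assumes "x \<in> M" shows "(\<lambda>_. \<Delta>) \<in> Up k n x"
proof -
  let ?c = "complement_sequence (nfs k n x) (blen x)"
  have "?c i \<in> M" for i using complement_sequence_Mbar nfs_Mbar assms Mbar_closed by blast
  then have "x \<preceq> prefix_prod (\<lambda>_. \<Delta>) (blen x)"
    using prefix_prod_mult_complement_sequence[OF nfs_Mbar[OF assms], of "blen x"]
      dvsI[of "prefix_prod ?c (blen x)" x] assms by (simp add: prefix_prod_nfs)
  then show ?thesis using Up_blen_eq[OF assms order_refl] by simp
qed

subsection \<open>Cylinders under a uniform measure\<close>

definition moebius_weight :: "real \<Rightarrow> elt \<Rightarrow> real" where
  "moebius_weight p x = (\<Sum>X\<in>Pow (\<Sigma> - R x). (- 1) ^ card X * p ^ blen (DeltaX k n X))"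

definition cylinder_weight :: "real \<Rightarrow> (nat \<Rightarrow> elt) \<Rightarrow> nat \<Rightarrow> real" where
  "cylinder_weight p \<xi> j = p ^ blen (prefix_prod \<xi> (Suc j)) * moebius_weight p (\<xi> j)"

lemma moebius_weight_one: "moebius_weight p \<one> = Hn k n p"
  unfolding moebius_weight_def Hn_def by simp

lemma moebius_weight_Delta: "moebius_weight p \<Delta> = 1"
  unfolding moebius_weight_def by simp

lemma moebius_weight_card_le_1:
  assumes "card (\<Sigma> - R x) \<le> 1"
  shows "moebius_weight p x = 1 \<or> moebius_weight p x = 1 - p"
proof -
  have "finite (\<Sigma> - R x)" by simp
  then consider "\<Sigma> - R x = {}" | t where "\<Sigma> - R x = {t}"
    using assms by (metis card_0_eq card_1_singletonE le_neq_implies_less less_one)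
  then show ?thesis
  proof cases
    case 1
    show ?thesis unfolding moebius_weight_def 1 by simp
  next
    case 2
    then have "t \<in> \<Sigma>" by blast
    have "Pow {t} = {{}, {t}}" by auto
    then have "moebius_weight p x = 1 - p"
      unfolding moebius_weight_def 2 using DeltaX_singleton[OF \<open>t \<in> \<Sigma>\<close>] by simp
    then show ?thesis ..
  qed
qed

lemma continuous_on_moebius_weight [continuous_intros]: "continuous_on A (\<lambda>p. moebius_weight p x)"
  unfolding moebius_weight_def by (intro continuous_intros)

lemma continuous_on_cylinder_weight [continuous_intros]: "continuous_on A (\<lambda>p. cylinder_weight p \<xi> j)"
  unfolding cylinder_weight_def by (intro continuous_intros)

lemma uniform_prob_on: "uniform k n p \<nu> \<Longrightarrow> prob_on k n \<nu>"
  and uniform_Up: "uniform k n p \<nu> \<Longrightarrow> x \<in> M \<Longrightarrow> measure \<nu> (Up k n x) = p ^ blen x"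
  unfolding uniform_def by auto

lemma uniform_cylinder:
  assumes u: "uniform k n p \<nu>" and \<xi>: "\<xi> \<in> Mbar k n"
  shows "measure \<nu> (cylinder \<xi> (Suc j)) = cylinder_weight p \<xi> j"
proof -
  interpret \<nu>: prob_space \<nu> using uniform_prob_on[OF u] by (rule prob_onD)
  let ?A = "\<Sigma> - R (\<xi> j)" and ?x = "prefix_prod \<xi> (Suc j)"
  have xM: "?x \<in> M" using \<xi> by simp
  have "measure \<nu> (cylinder \<xi> (Suc j)) =
      (\<Sum>X\<in>Pow ?A. (- 1) ^ card X * measure \<nu> (Up k n ?x \<inter> (\<Inter>s\<in>X. Up k n (?x \<odot> \<sigma> s))))"
    unfolding cylinder_eq_Up_Diff[OF \<xi>]
    using xM by (intro \<nu>.measure_Diff_UN_inclusion_exclusion) (auto simp: prob_onD[OF uniform_prob_on[OF u]])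
  also have "\<dots> = (\<Sum>X\<in>Pow ?A. p ^ blen ?x * ((- 1) ^ card X * p ^ blen (DeltaX k n X)))"
  proof (rule sum.cong[OF refl])
    fix X assume "X \<in> Pow ?A"
    then have "X \<subseteq> \<Sigma>" by blast
    then show "(- 1) ^ card X * measure \<nu> (Up k n ?x \<inter> (\<Inter>s\<in>X. Up k n (?x \<odot> \<sigma> s))) =
        p ^ blen ?x * ((- 1) ^ card X * p ^ blen (DeltaX k n X))"
      using Up_mult_DeltaX[OF xM] uniform_Up[OF u, of "?x \<odot> DeltaX k n X"] xM DeltaX_closed[of X]
      by (simp add: power_add)
  qed
  finally show ?thesis unfolding cylinder_weight_def moebius_weight_def sum_distrib_left .
qed

theorem uniform_unique: "uniform k n p \<nu> \<Longrightarrow> uniform k n p \<nu>' \<Longrightarrow> \<nu> = \<nu>'"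
  by (rule prob_on_eqI) (auto simp: uniform_prob_on uniform_cylinder)

lemma uniform_singleton:
  assumes "uniform k n p \<nu>" "x \<in> M"
  shows "measure \<nu> {nfs k n x} = Hn k n p * p ^ blen x"
  unfolding singleton_nfs_eq_cylinder[OF assms(2)]
  using assms prefix_prod_nfs[OF assms(2)] nfs_tail[OF assms(2)]
  by (simp add: uniform_cylinder cylinder_weight_def moebius_weight_one)

lemma uniform_sum_normal_multiples:
  assumes "uniform k n p \<nu>" "x \<in> simple_products (Suc j)"
  shows "(\<Sum>\<zeta>\<in>normal_multiples x (Suc j). cylinder_weight p \<zeta> j) = p ^ blen x"
proof -
  have "p ^ blen x = (\<Sum>\<zeta>\<in>normal_multiples x (Suc j). measure \<nu> (cylinder \<zeta> (Suc j)))"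
    using measure_Up_eq_sum[OF uniform_prob_on] uniform_Up assms simple_products_closed by metis
  also have "\<dots> = (\<Sum>\<zeta>\<in>normal_multiples x (Suc j). cylinder_weight p \<zeta> j)"
    using assms(1) by (intro sum.cong refl uniform_cylinder) auto
  finally show ?thesis by simp
qed

lemma uniform_moebius_weight_nonneg:
  assumes "uniform k n p \<nu>" "0 < p" "x \<in> \<S>" shows "0 \<le> moebius_weight p x"
proof -
  have "0 \<le> cylinder_weight p (append_factor (\<lambda>_. \<one>) 0 x) 0"
    using uniform_cylinder[OF assms(1) append_factor_0_Mbar[OF assms(3)], symmetric] by simp
  then show ?thesis
    using zero_less_power[OF assms(2)] by (simp add: cylinder_weight_def zero_le_mult_iff not_le[symmetric])
qed

lemma uniform_moebius_weight_le_1: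
  assumes u: "uniform k n p \<nu>" "0 < p" and x: "x \<in> \<S>" shows "moebius_weight p x \<le> 1"
proof -
  interpret \<nu>: prob_space \<nu> using uniform_prob_on[OF u(1)] by (rule prob_onD)
  let ?\<xi> = "append_factor (\<lambda>_. \<one>) 0 x"
  have \<xi>: "?\<xi> \<in> Mbar k n" using x by (rule append_factor_0_Mbar)
  then have xM: "prefix_prod ?\<xi> (Suc 0) \<in> M" by simp
  have "measure \<nu> (cylinder ?\<xi> (Suc 0)) \<le> measure \<nu> (Up k n (prefix_prod ?\<xi> (Suc 0)))"
    using cylinder_eq_Up_Diff[OF \<xi>, of 0] xM
    by (intro \<nu>.finite_measure_mono) (auto simp: prob_onD[OF uniform_prob_on[OF u(1)]])
  then have "p ^ blen (prefix_prod ?\<xi> (Suc 0)) * moebius_weight p x \<le> p ^ blen (prefix_prod ?\<xi> (Suc 0)) * 1"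
    using uniform_cylinder[OF u(1) \<xi>, of 0] uniform_Up[OF u(1) xM] by (simp add: cylinder_weight_def)
  then show ?thesis using u(2) by simp
qed

lemma uniform_moebius_weight_rec:
  assumes u: "uniform k n p \<nu>" "0 < p" and x: "x \<in> \<S>"
  shows "moebius_weight p x = (\<Sum>y\<in>{y \<in> \<S>. x \<leadsto> y}. p ^ blen y * moebius_weight p y)"
proof -
  let ?\<xi> = "append_factor (\<lambda>_. \<one>) 0 x"
  have \<xi>: "?\<xi> \<in> Mbar k n" using x by (rule append_factor_0_Mbar)
  have xM: "prefix_prod ?\<xi> (Suc 0) \<in> M" using \<xi> by simp
  have "cylinder_weight p ?\<xi> 0 = (\<Sum>y\<in>{y \<in> \<S>. x \<leadsto> y}. measure \<nu> (cylinder (append_factor ?\<xi> (Suc 0) y) (Suc (Suc 0))))"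
    using measure_cylinder_eq_sum_append_factor[OF uniform_prob_on[OF u(1)], of ?\<xi> 0] uniform_cylinder[OF u(1) \<xi>, of 0]
    by simp
  also have "\<dots> = (\<Sum>y\<in>{y \<in> \<S>. x \<leadsto> y}. p ^ blen (prefix_prod ?\<xi> (Suc 0)) * (p ^ blen y * moebius_weight p y))"
  proof (rule sum.cong[OF refl])
    fix y assume y: "y \<in> {y \<in> \<S>. x \<leadsto> y}"
    then have \<zeta>: "append_factor ?\<xi> (Suc 0) y \<in> Mbar k n" using \<xi> by (intro append_factor_Suc_Mbar) auto
    show "measure \<nu> (cylinder (append_factor ?\<xi> (Suc 0) y) (Suc (Suc 0))) =
        p ^ blen (prefix_prod ?\<xi> (Suc 0)) * (p ^ blen y * moebius_weight p y)"
      using uniform_cylinder[OF u(1) \<zeta>, of "Suc 0"] prefix_prod_append_factor[of ?\<xi> "Suc 0" y] \<zeta> xM y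
      by (simp add: cylinder_weight_def power_add)
  qed
  finally show ?thesis using u(2) by (simp add: cylinder_weight_def flip: sum_distrib_left)
qed

end

section \<open>The growth series\<close>

locale nontrivial_garside = garside +
  assumes gens_nonempty: "\<Sigma> \<noteq> {}"
begin

abbreviation "layer m \<equiv> {x \<in> M. blen x = m}"
abbreviation "growth m \<equiv> card (layer m)"
abbreviation "q \<equiv> qn k n"

lemma growth_0 [simp]: "growth 0 = 1"
proof -
  have "layer 0 = {\<one>}" by auto
  then show ?thesis by simp
qed

lemma growth_pos: "0 < growth m"
proof -
  obtain s where "s \<in> \<Sigma>" using gens_nonempty by blast
  then have "\<langle>replicate m s\<rangle> \<in> layer m" by auto
  then show ?thesis by (metis card_gt_0_iff empty_iff finite_blen_eq)
qed

lemma layer_nonempty: "layer m \<noteq> {}"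
  using growth_pos[of m] by (metis card.empty less_numeral_extra(3))

lemma growth_submultiplicative: "growth (m + l) \<le> growth m * growth l"
proof -
  have "layer (m + l) \<subseteq> (\<lambda>(x, y). x \<odot> y) ` (layer m \<times> layer l)"
  proof
    fix x assume x: "x \<in> layer (m + l)"
    then obtain w where w: "w \<in> lists \<Sigma>" "x = \<langle>w\<rangle>" using M_cases by blast
    then have "length w = m + l" using x by simp
    then have "\<langle>take m w\<rangle> \<in> layer m" "\<langle>drop m w\<rangle> \<in> layer l"
      using w(1) by (auto simp: in_lists_conv_set dest: in_set_takeD in_set_dropD)
    moreover have "x = \<langle>take m w\<rangle> \<odot> \<langle>drop m w\<rangle>" using w by (simp add: mult_cls)
    ultimately show "x \<in> (\<lambda>(x, y). x \<odot> y) ` (layer m \<times> layer l)" by force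
  qed
  then have "growth (m + l) \<le> card (layer m \<times> layer l)" by (intro surj_card_le) auto
  then show ?thesis by (simp add: card_cartesian_product)
qed

lemma real_growth_submultiplicative: "real (growth (m + l)) \<le> real (growth m) * real (growth l)"
  using growth_submultiplicative[of m l] by (simp flip: of_nat_mult)

lemma conv_radius_growth: "conv_radius (\<lambda>m. real (growth m)) = ereal q" and q_pos: "0 < q"
proof -
  let ?r = "conv_radius (\<lambda>m. real (growth m))"
  have "ereal (1 / real (growth 1)) \<le> ?r"
    using growth_pos[of 1] real_growth_submultiplicative
    by (intro submultiplicative_conv_radius_ge[where m = 1]) auto
  moreover have "(0::ereal) < ereal (1 / real (growth 1))" using growth_pos[of 1] by simp
  ultimately have pos: "0 < ?r" by order
  have "?r \<le> 1"
  proof (rule ccontr)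
    assume "\<not> ?r \<le> 1"
    then have "summable (\<lambda>m. real (growth m) * 1 ^ m)"
      by (intro summable_in_conv_radius) (simp add: not_le one_ereal_def)
    then have "(\<lambda>m. real (growth m)) \<longlonglongrightarrow> 0" using summable_LIMSEQ_zero by fastforce
    then have "eventually (\<lambda>m. real (growth m) < 1) sequentially" by (rule order_tendstoD) simp
    then obtain m where "growth m < 1" by (auto simp: eventually_sequentially)
    then show False using growth_pos[of m] by linarith
  qed
  then show radius: "?r = ereal q" unfolding qn_def using pos by (cases ?r) auto
  then show "0 < q" using pos by auto
qed

lemma growth_mult_power_ge_1:
  assumes "q \<le> p" shows "1 \<le> real (growth m) * p ^ m"
proof (cases "m = 0")
  case False
  then have "1 \<le> real (growth m) * q ^ m"
    using conv_radius_growth growth_pos real_growth_submultiplicative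
    by (intro submultiplicative_ge_1_at_conv_radius) auto
  also have "\<dots> \<le> real (growth m) * p ^ m" using assms q_pos by (intro mult_left_mono power_mono) auto
  finally show ?thesis .
qed simp

definition Gn :: "real \<Rightarrow> real" where "Gn p = (\<Sum>m. real (growth m) * p ^ m)"

lemma sums_Gn: assumes "0 \<le> p" "p < q" shows "(\<lambda>m. real (growth m) * p ^ m) sums Gn p"
  unfolding Gn_def using assms conv_radius_growth by (intro summable_sums summable_in_conv_radius) auto

lemma card_multiples:
  assumes "d \<in> M"
  shows "card {x \<in> layer m. d \<preceq> x} = (if blen d \<le> m then growth (m - blen d) else 0)"
proof (cases "blen d \<le> m")
  case True
  have "{x \<in> layer m. d \<preceq> x} = (\<lambda>y. d \<odot> y) ` layer (m - blen d)"
  proof (intro set_eqI iffI)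
    fix x assume x: "x \<in> {x \<in> layer m. d \<preceq> x}"
    then obtain y where y: "y \<in> M" "x = d \<odot> y" by (auto elim: dvsE)
    then have "y \<in> layer (m - blen d)" using x assms by auto
    then show "x \<in> (\<lambda>y. d \<odot> y) ` layer (m - blen d)" using y by blast
  qed (use True assms in auto)
  moreover have "inj_on (\<lambda>y. d \<odot> y) (layer (m - blen d))"
    by (rule inj_onI) (use left_cancel[OF assms] in blast)
  ultimately show ?thesis using True by (simp add: card_image)
next
  case False
  then have "{x \<in> layer m. d \<preceq> x} = {}" using dvs_blen_le[OF assms] by auto
  then show ?thesis using False by (simp only: card.empty if_False)
qed

lemma sums_multiples:
  assumes "0 \<le> p" "p < q" "d \<in> M"
  shows "(\<lambda>m. real (card {x \<in> layer m. d \<preceq> x}) * p ^ m) sums (p ^ blen d * Gn p)"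
proof -
  have "(\<lambda>m. p ^ blen d * (real (growth m) * p ^ m)) sums (p ^ blen d * Gn p)"
    using sums_Gn[OF assms(1,2)] by (rule sums_mult)
  then have "(\<lambda>m. real (card {x \<in> layer (m + blen d). d \<preceq> x}) * p ^ (m + blen d)) sums (p ^ blen d * Gn p)"
    unfolding card_multiples[OF assms(3)] by (simp add: power_add mult_ac)
  then show ?thesis
    using sums_iff_shift[of "\<lambda>m. real (card {x \<in> layer m. d \<preceq> x}) * p ^ m" "blen d" "p ^ blen d * Gn p"]
    unfolding card_multiples[OF assms(3)] by simp
qed

lemma alternating_sum_multiples:
  "(\<Sum>X\<in>Pow \<Sigma>. (- 1) ^ card X * real (card {x \<in> layer m. DeltaX k n X \<preceq> x})) = (if m = 0 then 1 else 0)"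
proof -
  have "(\<Sum>X\<in>Pow \<Sigma>. (- 1) ^ card X * real (card {x \<in> layer m. DeltaX k n X \<preceq> x})) =
      (\<Sum>X\<in>Pow \<Sigma>. \<Sum>x\<in>layer m. if X \<subseteq> L x then (- 1) ^ card X else 0)"
  proof (rule sum.cong[OF refl])
    fix X assume "X \<in> Pow \<Sigma>"
    then have "{x \<in> layer m. DeltaX k n X \<preceq> x} = {x \<in> layer m. X \<subseteq> L x}"
      using DeltaX_dvs_iff[of X] unfolding Lset_def by auto
    moreover have "(\<Sum>x\<in>layer m. if X \<subseteq> L x then (- 1) ^ card X else 0) = (\<Sum>x\<in>{x \<in> layer m. X \<subseteq> L x}. (- 1) ^ card X :: real)"
      by (rule sum.inter_filter[symmetric]) (rule finite_blen_eq)
    ultimately show "(- 1) ^ card X * real (card {x \<in> layer m. DeltaX k n X \<preceq> x}) =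
        (\<Sum>x\<in>layer m. if X \<subseteq> L x then (- 1) ^ card X else 0)" by (simp only: sum_constant mult.commute)
  qed
  also have "\<dots> = (\<Sum>x\<in>layer m. \<Sum>X\<in>Pow \<Sigma>. if X \<subseteq> L x then (- 1) ^ card X else 0)"
    by (rule sum.swap)
  also have "\<dots> = (\<Sum>x\<in>layer m. if x = \<one> then 1 else 0)"
  proof (rule sum.cong[OF refl])
    fix x assume x: "x \<in> layer m"
    have sub: "L x \<subseteq> \<Sigma>" unfolding Lset_def by blast
    then have "(\<Sum>X\<in>Pow \<Sigma>. if X \<subseteq> L x then (- 1) ^ card X else (0::real)) = (\<Sum>X\<in>Pow (L x). (- 1) ^ card X)"
      by (intro sum.mono_neutral_cong_right) auto
    then show "(\<Sum>X\<in>Pow \<Sigma>. if X \<subseteq> L x then (- 1) ^ card X else (0::real)) = (if x = \<one> then 1 else 0)"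
      using sum_Pow_alternating[OF finite_subset[OF sub finite_gens]] L_empty_iff x by simp
  qed
  also have "\<dots> = (if m = 0 then 1 else 0)" by auto
  finally show ?thesis .
qed

lemma Hn_mult_Gn: assumes "0 \<le> p" "p < q" shows "Hn k n p * Gn p = 1"
proof -
  have "(\<lambda>m. \<Sum>X\<in>Pow \<Sigma>. (- 1) ^ card X * (real (card {x \<in> layer m. DeltaX k n X \<preceq> x}) * p ^ m)) sums
      (\<Sum>X\<in>Pow \<Sigma>. (- 1) ^ card X * (p ^ blen (DeltaX k n X) * Gn p))"
    using sums_multiples[OF assms DeltaX_closed] by (intro sums_sum sums_mult) auto
  moreover have "(\<Sum>X\<in>Pow \<Sigma>. (- 1) ^ card X * (real (card {x \<in> layer m. DeltaX k n X \<preceq> x}) * p ^ m)) =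
      (if m = 0 then 1 else 0)" for m
    using alternating_sum_multiples[of m] by (simp flip: sum_distrib_right mult.assoc)
  moreover have "(\<lambda>m. if m = 0 then 1 else 0 :: real) sums 1" using sums_single[of 0 "\<lambda>_. 1 :: real"] by simp
  ultimately show ?thesis
    unfolding Hn_def sum_distrib_right using sums_unique2 by (fastforce simp: mult.assoc)
qed

lemma Gn_ge_1: assumes "0 \<le> p" "p < q" shows "1 \<le> Gn p"
proof -
  have "(\<Sum>m\<in>{0}. real (growth m) * p ^ m) \<le> Gn p"
    unfolding Gn_def using sums_summable[OF sums_Gn[OF assms]] assms by (intro sum_le_suminf) auto
  then show ?thesis by simp
qed

lemma Hn_pos: assumes "0 \<le> p" "p < q" shows "0 < Hn k n p"
  using Hn_mult_Gn[OF assms] Gn_ge_1[OF assms] by (metis less_le_trans zero_less_mult_pos2 zero_less_one)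

section \<open>Uniform measures below the radius of convergence\<close>

lemma sums_measure_nfs_image:
  assumes \<nu>: "prob_on k n \<nu>" and A: "A \<subseteq> M"
    and singleton: "\<And>x. x \<in> A \<Longrightarrow> measure \<nu> {nfs k n x} = h * p ^ blen x"
  shows "(\<lambda>m. h * (real (card {x \<in> A. blen x = m}) * p ^ m)) sums measure \<nu> (nfs k n ` A)"
proof -
  interpret \<nu>: prob_space \<nu> using \<nu> by (rule prob_onD)
  let ?A = "\<lambda>m. {x \<in> A. blen x = m}"
  have fin: "finite (?A m)" for m using A by (intro finite_subset[OF _ finite_blen_eq[of m]]) auto
  have image: "nfs k n ` B = (\<Union>x\<in>B. {nfs k n x})" for B by auto
  have sets: "nfs k n ` ?A m \<in> sets \<nu>" for m
    unfolding prob_onD(2)[OF \<nu>] image using A by (intro sets.finite_UN fin singleton_nfs_sets) auto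
  have inj: "inj_on (nfs k n) A" using A nfs_inj by (auto simp: inj_on_def)
  have "measure \<nu> (nfs k n ` ?A m) = h * (real (card (?A m)) * p ^ m)" for m
  proof -
    have "measure \<nu> (nfs k n ` ?A m) = (\<Sum>x\<in>?A m. measure \<nu> {nfs k n x})"
      unfolding image using fin A singleton_nfs_sets inj
      by (intro \<nu>.finite_measure_finite_Union) (auto simp: prob_onD[OF \<nu>] disjoint_family_on_def inj_on_def)
    then show ?thesis using singleton by simp
  qed
  moreover have "(\<lambda>m. measure \<nu> (nfs k n ` ?A m)) sums measure \<nu> (\<Union>m. nfs k n ` ?A m)"
    using sets inj by (intro \<nu>.finite_measure_UNION) (auto simp: disjoint_family_on_def inj_on_def)
  moreover have "(\<Union>m. nfs k n ` ?A m) = nfs k n ` A" by auto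
  ultimately show ?thesis by simp
qed

lemma measure_multiples_Mimg:
  assumes p: "0 \<le> p" "p < q" and \<nu>: "prob_on k n \<nu>" and x: "x \<in> M"
    and singleton: "\<And>x. x \<in> M \<Longrightarrow> measure \<nu> {nfs k n x} = Hn k n p * p ^ blen x"
  shows "measure \<nu> (nfs k n ` {y \<in> M. x \<preceq> y}) = p ^ blen x"
proof -
  have layers: "{y \<in> {y \<in> M. x \<preceq> y}. blen y = m} = {y \<in> layer m. x \<preceq> y}" for m by auto
  have "(\<lambda>m. Hn k n p * (real (card {y \<in> layer m. x \<preceq> y}) * p ^ m)) sums measure \<nu> (nfs k n ` {y \<in> M. x \<preceq> y})"
    by (rule sums_measure_nfs_image[OF \<nu>, of "{y \<in> M. x \<preceq> y}", unfolded layers]) (auto simp: singleton)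
  moreover have "(\<lambda>m. Hn k n p * (real (card {y \<in> layer m. x \<preceq> y}) * p ^ m)) sums (Hn k n p * (p ^ blen x * Gn p))"
    using sums_multiples[OF p x] by (rule sums_mult)
  ultimately have "measure \<nu> (nfs k n ` {y \<in> M. x \<preceq> y}) = Hn k n p * (p ^ blen x * Gn p)"
    by (rule sums_unique2)
  then show ?thesis using Hn_mult_Gn[OF p] by (simp add: mult_ac)
qed

lemma measure_Mimg_eq_1:
  assumes "0 \<le> p" "p < q" "prob_on k n \<nu>"
    and "\<And>x. x \<in> M \<Longrightarrow> measure \<nu> {nfs k n x} = Hn k n p * p ^ blen x"
  shows "measure \<nu> (Mimg k n) = 1"
proof -
  have "{y \<in> M. \<one> \<preceq> y} = M" by auto
  then show ?thesis using measure_multiples_Mimg[OF assms(1-3) one_closed assms(4)] by (simp add: Mimg_def)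
qed

lemma uniform_if_singletons:
  assumes p: "0 \<le> p" "p < q" and \<nu>: "prob_on k n \<nu>"
    and singleton: "\<And>x. x \<in> M \<Longrightarrow> measure \<nu> {nfs k n x} = Hn k n p * p ^ blen x"
  shows "uniform k n p \<nu>"
  unfolding uniform_def
proof (intro conjI ballI)
  interpret \<nu>: prob_space \<nu> using \<nu> by (rule prob_onD)
  fix x assume x: "x \<in> M"
  have "AE \<xi> in \<nu>. \<xi> \<in> Mimg k n"
    using measure_Mimg_eq_1[OF p \<nu> singleton] \<nu>.AE_prob_1 by blast
  then have "measure \<nu> (Up k n x) = measure \<nu> (Up k n x \<inter> Mimg k n)"
    using x Mimg_sets by (intro \<nu>.finite_measure_eq_AE) (auto simp: prob_onD[OF \<nu>])
  also have "\<dots> = p ^ blen x"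
    unfolding Up_Int_Mimg[OF x] using p \<nu> x singleton by (rule measure_multiples_Mimg)
  finally show "measure \<nu> (Up k n x) = p ^ blen x" .
qed (rule \<nu>)

theorem uniform_iff_singletons:
  assumes "0 \<le> p" "p < q" "prob_on k n \<nu>"
  shows "uniform k n p \<nu> \<longleftrightarrow> (\<forall>x\<in>M. measure \<nu> {nfs k n x} = Hn k n p * p ^ blen x)"
  using uniform_if_singletons[OF assms] uniform_singleton by blast

lemma uniform_exists_below:
  assumes p: "0 \<le> p" "p < q"
  shows "\<exists>\<nu>. uniform k n p \<nu>"
proof -
  have "(\<lambda>m. real (growth m) * (Hn k n p * p ^ m)) sums 1"
    using sums_mult[OF sums_Gn[OF p], of "Hn k n p"] Hn_mult_Gn[OF p] by (simp add: mult_ac)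
  then obtain Q where Q: "set_pmf Q \<subseteq> M" "\<And>x. x \<in> M \<Longrightarrow> pmf Q x = Hn k n p * p ^ blen x"
    using ex_pmf_constant_on_fibres[of M blen "\<lambda>m. Hn k n p * p ^ m"] layer_nonempty Hn_pos[OF p] p by auto
  define f where "f x = nfs k n (if x \<in> M then x else \<one>)" for x
  have f: "f \<in> measurable Q (Bbar k n)" unfolding f_def by (auto simp: measurable_def)
  define \<nu> where "\<nu> = distr Q (Bbar k n) f"
  have \<nu>: "prob_on k n \<nu>"
    unfolding prob_on_def \<nu>_def using measure_pmf.prob_space_distr[OF f] by simp
  have "measure \<nu> {nfs k n x} = Hn k n p * p ^ blen x" if x: "x \<in> M" for x
  proof -
    have "measure \<nu> {nfs k n x} = measure Q (f -` {nfs k n x})"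
      unfolding \<nu>_def using measure_distr[OF f singleton_nfs_sets[OF x]] by simp
    also have "\<dots> = measure Q {x}"
      using Q(1) nfs_inj x
      by (intro measure_pmf.finite_measure_eq_AE) (auto simp: f_def AE_measure_pmf_iff)
    finally show ?thesis using Q(2)[OF x] by (simp add: measure_pmf_single)
  qed
  then show ?thesis using uniform_if_singletons[OF p \<nu>] by blast
qed

lemma uniform_ge_q:
  assumes "q \<le> p" "uniform k n p \<nu>"
  shows "Hn k n p = 0" and "measure \<nu> (Mimg k n) = 0"
proof -
  note singleton = uniform_singleton[OF assms(2)]
  let ?f = "\<lambda>m. Hn k n p * (real (growth m) * p ^ m)"
  have sums: "?f sums measure \<nu> (Mimg k n)"
    using sums_measure_nfs_image[OF uniform_prob_on[OF assms(2)] order_refl singleton] unfolding Mimg_def .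
  have nonneg: "0 \<le> Hn k n p" using singleton[of \<one>] measure_nonneg[of \<nu> "{nfs k n \<one>}"] by simp
  have "Hn k n p \<le> 0"
  proof (rule LIMSEQ_le_const)
    show "?f \<longlonglongrightarrow> 0" using sums sums_summable summable_LIMSEQ_zero by blast
    show "\<exists>N. \<forall>m\<ge>N. Hn k n p \<le> ?f m"
      using mult_left_mono[OF growth_mult_power_ge_1[OF assms(1)] nonneg] by auto
  qed
  then show "Hn k n p = 0" using nonneg by simp
  then show "measure \<nu> (Mimg k n) = 0" using sums_unique2[OF sums, of 0] by simp
qed

section \<open>The uniform measure at the radius of convergence\<close>

lemma continuous_eq_at_q:
  fixes f :: "real \<Rightarrow> real"
  assumes "continuous_on UNIV f" "\<And>p. 0 < p \<Longrightarrow> p < q \<Longrightarrow> f p = c" shows "f q = c"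
  using continuous_constant_on_closure[of "{0<..<q}" f c q] assms q_pos
  by (auto intro: continuous_on_subset)

lemma moebius_weight_q_nonneg: assumes "x \<in> \<S>" shows "0 \<le> moebius_weight q x"
proof (rule continuous_ge_on_closure[of "{0<..<q}" "\<lambda>p. moebius_weight p x"])
  fix p assume "p \<in> {0<..<q}"
  then show "0 \<le> moebius_weight p x"
    using uniform_exists_below[of p] uniform_moebius_weight_nonneg assms by auto
qed (use q_pos continuous_on_moebius_weight in auto)

lemma moebius_weight_q_rec:
  assumes "x \<in> \<S>"
  shows "moebius_weight q x = (\<Sum>y\<in>{y \<in> \<S>. x \<leadsto> y}. q ^ blen y * moebius_weight q y)"
proof -
  let ?f = "\<lambda>p. moebius_weight p x - (\<Sum>y\<in>{y \<in> \<S>. x \<leadsto> y}. p ^ blen y * moebius_weight p y)"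
  have "?f q = 0"
  proof (rule continuous_eq_at_q[of ?f])
    show "continuous_on UNIV ?f" by (intro continuous_intros)
    fix p assume "0 < p" "p < q"
    then show "?f p = 0" using uniform_exists_below[of p] uniform_moebius_weight_rec assms by auto
  qed
  then show ?thesis by simp
qed

lemma sum_normal_multiples_q:
  assumes x: "x \<in> simple_products (Suc j)"
  shows "(\<Sum>\<zeta>\<in>normal_multiples x (Suc j). cylinder_weight q \<zeta> j) = q ^ blen x"
proof -
  let ?f = "\<lambda>p. (\<Sum>\<zeta>\<in>normal_multiples x (Suc j). cylinder_weight p \<zeta> j) - p ^ blen x"
  have "?f q = 0"
  proof (rule continuous_eq_at_q[of ?f])
    show "continuous_on UNIV ?f" by (intro continuous_intros)
    fix p assume "0 < p" "p < q"
    then show "?f p = 0" using uniform_exists_below[of p] uniform_sum_normal_multiples[OF _ x] by auto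
  qed
  then show ?thesis by simp
qed

subsection \<open>The Markov chain of Garside factors\<close>

definition transition :: "real \<Rightarrow> elt \<Rightarrow> elt pmf" where
  "transition p x = (if x \<in> \<S> \<and> 0 < moebius_weight p x
    then embed_pmf (\<lambda>y. if y \<in> \<S> \<and> x \<leadsto> y then p ^ blen y * moebius_weight p y / moebius_weight p x else 0)
    else return_pmf \<one>)"

context
  fixes p :: real
  assumes p_pos: "0 < p" and nonneg: "\<And>x. x \<in> \<S> \<Longrightarrow> 0 \<le> moebius_weight p x"
    and rec: "\<And>x. x \<in> \<S> \<Longrightarrow> moebius_weight p x = (\<Sum>y\<in>{y \<in> \<S>. x \<leadsto> y}. p ^ blen y * moebius_weight p y)"
begin

lemma pmf_transition:
  assumes x: "x \<in> \<S>" and pos: "0 < moebius_weight p x"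
  shows "pmf (transition p x) y =
    (if y \<in> \<S> \<and> x \<leadsto> y then p ^ blen y * moebius_weight p y / moebius_weight p x else 0)"
proof -
  let ?f = "\<lambda>y. if y \<in> \<S> \<and> x \<leadsto> y then p ^ blen y * moebius_weight p y / moebius_weight p x else 0"
  have f: "0 \<le> ?f y" for y using p_pos nonneg pos by simp
  have "(\<integral>\<^sup>+y. ennreal (?f y) \<partial>count_space UNIV) = (\<Sum>y\<in>{y \<in> \<S>. x \<leadsto> y}. ennreal (?f y))"
    by (rule nn_integral_count_space') auto
  also have "\<dots> = ennreal (\<Sum>y\<in>{y \<in> \<S>. x \<leadsto> y}. ?f y)" by (rule sum_ennreal) (rule f)
  also have "(\<Sum>y\<in>{y \<in> \<S>. x \<leadsto> y}. ?f y) = (\<Sum>y\<in>{y \<in> \<S>. x \<leadsto> y}. p ^ blen y * moebius_weight p y) / moebius_weight p x"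
    unfolding sum_divide_distrib by (rule sum.cong) auto
  also have "\<dots> = 1" using rec[OF x] pos by simp
  finally show ?thesis unfolding transition_def using x pos f by (simp add: pmf_embed_pmf)
qed

lemma set_pmf_transition: "set_pmf (transition p x) \<subseteq> {y \<in> \<S>. x \<leadsto> y}"
proof (cases "x \<in> \<S> \<and> 0 < moebius_weight p x")
  case True
  then show ?thesis using pmf_transition by (auto simp: set_pmf_eq split: if_splits)
next
  case False
  then show ?thesis unfolding transition_def by auto
qed

lemma moebius_weight_mult_pmf_transition:
  assumes x: "x \<in> \<S>" and y: "y \<in> \<S>" "x \<leadsto> y"
  shows "moebius_weight p x * pmf (transition p x) y = p ^ blen y * moebius_weight p y"
proof (cases "0 < moebius_weight p x")
  case True
  then show ?thesis using pmf_transition[OF x] y by simp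
next
  case False
  then have zero: "moebius_weight p x = 0" using nonneg[OF x] by simp
  have "p ^ blen y * moebius_weight p y = 0"
  proof (rule sum_nonneg_0[where s = "{y \<in> \<S>. x \<leadsto> y}" and f = "\<lambda>y. p ^ blen y * moebius_weight p y"])
    show "(\<Sum>y\<in>{y \<in> \<S>. x \<leadsto> y}. p ^ blen y * moebius_weight p y) = 0" using rec[OF x] zero by simp
    show "0 \<le> p ^ blen z * moebius_weight p z" if "z \<in> {y \<in> \<S>. x \<leadsto> y}" for z using that nonneg[of z] p_pos by simp
  qed (use y in simp_all)
  then show ?thesis using zero by simp
qed

lemma prod_pmf_transition:
  assumes \<zeta>: "\<zeta> \<in> Mbar k n"
  shows "(\<Prod>i<Suc j. pmf (transition p (case_nat \<Delta> \<zeta> i)) (\<zeta> i)) = cylinder_weight p \<zeta> j"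
proof (induction j)
  case 0
  show ?case using moebius_weight_mult_pmf_transition[of \<Delta> "\<zeta> 0"] \<zeta>
    by (simp add: cylinder_weight_def moebius_weight_Delta prefix_prod_Suc_shift)
next
  case (Suc j)
  have "(\<Prod>i<Suc (Suc j). pmf (transition p (case_nat \<Delta> \<zeta> i)) (\<zeta> i)) =
      p ^ blen (prefix_prod \<zeta> (Suc j)) * (moebius_weight p (\<zeta> j) * pmf (transition p (\<zeta> j)) (\<zeta> (Suc j)))"
    using Suc by (simp add: cylinder_weight_def)
  also have "\<dots> = cylinder_weight p \<zeta> (Suc j)"
    using moebius_weight_mult_pmf_transition[of "\<zeta> j" "\<zeta> (Suc j)"] \<zeta> Mbar_arrow[OF \<zeta>]
      prefix_prod_Suc[of \<zeta> "Suc j"]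
    by (simp add: cylinder_weight_def power_add)
  finally show ?case .
qed

lemma ex_prob_on_cylinder_weight:
  "\<exists>\<nu>. prob_on k n \<nu> \<and> (\<forall>\<zeta>\<in>Mbar k n. \<forall>j. measure \<nu> (cylinder \<zeta> (Suc j)) = cylinder_weight p \<zeta> j)"
proof -
  have paths: "{\<xi>. \<forall>i. \<xi> i \<in> {y \<in> \<S>. case_nat \<Delta> \<xi> i \<leadsto> y}} = Mbar k n" (is "?P = _")
  proof (intro set_eqI iffI)
    fix \<xi> assume \<xi>: "\<xi> \<in> ?P"
    then have factor: "\<xi> i \<in> {y \<in> \<S>. case_nat \<Delta> \<xi> i \<leadsto> y}" for i by blast
    then have "\<xi> i \<leadsto> \<xi> (Suc i)" for i using factor[of "Suc i"] by simp
    then show "\<xi> \<in> Mbar k n" using factor unfolding Mbar_def by blast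
  qed (auto simp: Mbar_arrow split: nat.split)
  obtain \<nu> where \<nu>: "prob_space \<nu>" "sets \<nu> = sigma_sets (Mbar k n) cylinders"
    "\<And>\<zeta> j. measure \<nu> (cylinder \<zeta> j) = (\<Prod>i<j. pmf (transition p (case_nat \<Delta> \<zeta> i)) (\<zeta> i))"
    using ex_markov_chain[of "transition p" "\<lambda>x. {y \<in> \<S>. x \<leadsto> y}" \<Delta>, OF set_pmf_transition]
    unfolding paths cylinder_def[symmetric] cylinders_def[symmetric] by blast
  then show ?thesis
    unfolding prob_on_def sets_Bbar using prod_pmf_transition by (intro exI[of _ \<nu>]) simp
qed

end

theorem uniform_exists_q: "\<exists>\<nu>. uniform k n q \<nu>"
proof -
  obtain \<nu> where \<nu>: "prob_on k n \<nu>"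
    "\<And>\<zeta> j. \<zeta> \<in> Mbar k n \<Longrightarrow> measure \<nu> (cylinder \<zeta> (Suc j)) = cylinder_weight q \<zeta> j"
    using ex_prob_on_cylinder_weight[OF q_pos moebius_weight_q_nonneg moebius_weight_q_rec] by blast
  have "measure \<nu> (Up k n x) = q ^ blen x" if x: "x \<in> M" for x
  proof -
    have products: "x \<in> simple_products (Suc (blen x))" using x by (intro simple_products_blen_le) auto
    show ?thesis
      unfolding measure_Up_eq_sum[OF \<nu>(1) products] sum_normal_multiples_q[OF products, symmetric]
      by (intro sum.cong refl \<nu>(2)) auto
  qed
  then show ?thesis using \<nu>(1) unfolding uniform_def by blast
qed

lemma uniform_q_bdry: assumes "uniform k n q \<nu>" shows "measure \<nu> (bdry k n) = 1"
proof -
  note \<nu> = uniform_prob_on[OF assms]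
  interpret \<nu>: prob_space \<nu> using \<nu> by (rule prob_onD)
  have "space \<nu> = Mbar k n" using sets_eq_imp_space_eq[OF prob_onD(2)[OF \<nu>]] by simp
  moreover have "measure \<nu> (space \<nu> - Mimg k n) = 1 - measure \<nu> (Mimg k n)"
    by (rule \<nu>.prob_compl) (simp add: prob_onD[OF \<nu>] Mimg_sets)
  ultimately show ?thesis using uniform_ge_q(2)[OF order_refl assms] unfolding bdry_def by simp
qed

lemma measure_up:
  assumes \<nu>: "prob_on k n \<nu>" and bdry: "measure \<nu> (bdry k n) = 1" and x: "x \<in> M"
  shows "measure \<nu> (up k n x) = measure \<nu> (Up k n x)"
proof -
  interpret \<nu>: prob_space \<nu> using \<nu> by (rule prob_onD)
  have "AE \<xi> in \<nu>. \<xi> \<in> bdry k n" using \<nu>.AE_prob_1 bdry by blast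
  then show ?thesis
    unfolding up_def using Up_sets[OF x] bdry_sets
    by (intro \<nu>.finite_measure_eq_AE) (auto simp: prob_onD[OF \<nu>])
qed

theorem uniform_q_iff_up:
  assumes \<nu>: "prob_on k n \<nu>"
  shows "uniform k n q \<nu> \<longleftrightarrow> (\<forall>x\<in>M. measure \<nu> (up k n x) = q ^ blen x)"
proof
  assume "uniform k n q \<nu>"
  then show "\<forall>x\<in>M. measure \<nu> (up k n x) = q ^ blen x"
    using measure_up[OF \<nu>] uniform_q_bdry uniform_Up by simp
next
  assume up: "\<forall>x\<in>M. measure \<nu> (up k n x) = q ^ blen x"
  have "up k n \<one> = bdry k n" unfolding up_def bdry_def by auto
  then have "measure \<nu> (bdry k n) = 1" using up[rule_format, of \<one>] by simp
  then show "uniform k n q \<nu>" using measure_up[OF \<nu>] up \<nu> unfolding uniform_def by simp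
qed

section \<open>The Dirac measures at parameters 0 and 1\<close>

lemma prob_on_return: "\<xi> \<in> Mbar k n \<Longrightarrow> prob_on k n (return (Bbar k n) \<xi>)"
  unfolding prob_on_def by (simp add: prob_space_return)

theorem uniform_0: "uniform k n 0 (return (Bbar k n) (nfs k n \<one>))"
  unfolding uniform_def
proof (intro conjI ballI)
  show "prob_on k n (return (Bbar k n) (nfs k n \<one>))" by (rule prob_on_return) simp
  fix x assume x: "x \<in> M"
  then have "nfs k n \<one> \<in> Up k n x \<longleftrightarrow> blen x = 0" by (simp only: nfs_in_Up_iff one_closed) simp
  then show "measure (return (Bbar k n) (nfs k n \<one>)) (Up k n x) = 0 ^ blen x"
    using Up_sets[OF x] by (auto simp: measure_return indicator_def power_0_left)
qed

theorem uniform_1: "uniform k n 1 (return (Bbar k n) (\<lambda>_. \<Delta>))"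
  unfolding uniform_def
proof (intro conjI ballI)
  show "prob_on k n (return (Bbar k n) (\<lambda>_. \<Delta>))" by (rule prob_on_return) simp
  fix x assume x: "x \<in> M"
  then show "measure (return (Bbar k n) (\<lambda>_. \<Delta>)) (Up k n x) = 1 ^ blen x"
    using Up_sets[OF x] Deltas_in_Up by (simp add: measure_return)
qed

end

section \<open>Parameters above the radius of convergence\<close>

definition (in garside) simple_arrows :: "(elt \<times> elt) set" where
  "simple_arrows = {(x, y). x \<in> \<S> \<and> y \<in> \<S> \<and> x \<leadsto> y}"

locale irreducible_garside = nontrivial_garside +
  assumes irreducibility: "\<And>s. s \<in> \<Sigma> \<Longrightarrow> \<exists>z. (\<sigma> s, z) \<in> simple_arrows\<^sup>* \<and> card (\<Sigma> - R z) \<le> 1"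
begin

lemma uniform_moebius_weight_zero_arrow:
  assumes u: "uniform k n p \<nu>" and p: "0 < p" and arrow: "(x, y) \<in> simple_arrows"
    and zero: "moebius_weight p x = 0"
  shows "moebius_weight p y = 0"
proof -
  have xy: "x \<in> \<S>" "y \<in> \<S>" "x \<leadsto> y" using arrow unfolding simple_arrows_def by auto
  have "p ^ blen y * moebius_weight p y = 0"
  proof (rule sum_nonneg_0[where s = "{y \<in> \<S>. x \<leadsto> y}" and f = "\<lambda>y. p ^ blen y * moebius_weight p y"])
    show "(\<Sum>y\<in>{y \<in> \<S>. x \<leadsto> y}. p ^ blen y * moebius_weight p y) = 0"
      using uniform_moebius_weight_rec[OF u p xy(1)] zero by simp
    show "0 \<le> p ^ blen z * moebius_weight p z" if "z \<in> {y \<in> \<S>. x \<leadsto> y}" for z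
      using that uniform_moebius_weight_nonneg[OF u p, of z] p by simp
  qed (use xy in simp_all)
  then show ?thesis using p by simp
qed

lemma uniform_moebius_weight_pos:
  assumes u: "uniform k n p \<nu>" and p: "0 < p" "p < 1" and x: "x \<in> \<S>" "x \<noteq> \<one>"
  shows "0 < moebius_weight p x"
proof (rule ccontr)
  assume "\<not> 0 < moebius_weight p x"
  then have zero: "moebius_weight p x = 0" using uniform_moebius_weight_nonneg[OF u p(1) x(1)] by simp
  obtain s where s: "s \<in> \<Sigma>" "s \<in> R x" using R_emptyD x unfolding Rset_def by blast
  then have "(x, \<sigma> s) \<in> simple_arrows"
    using x(1) by (simp add: simple_arrows_def arrow_gen_iff) (simp add: Rset_def)
  moreover obtain z where z: "(\<sigma> s, z) \<in> simple_arrows\<^sup>*" "card (\<Sigma> - R z) \<le> 1" using irreducibility[OF s(1)] by blast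
  ultimately have "(x, z) \<in> simple_arrows\<^sup>*" using converse_rtrancl_into_rtrancl by metis
  then have "moebius_weight p z = 0"
    by (induction rule: rtrancl_induct) (use zero uniform_moebius_weight_zero_arrow[OF u p(1)] in auto)
  then show False using moebius_weight_card_le_1[OF z(2), of p] p by auto
qed

abbreviation "full_words j \<equiv> {\<zeta> \<in> normal_words (Suc j). \<zeta> j \<noteq> \<one>}"

lemma uniform_sum_full_words:
  assumes "uniform k n p \<nu>" "Hn k n p = 0"
  shows "(\<Sum>\<zeta>\<in>full_words j. cylinder_weight p \<zeta> j) = 1"
proof -
  have "(\<Sum>\<zeta>\<in>full_words j. cylinder_weight p \<zeta> j) = (\<Sum>\<zeta>\<in>normal_words (Suc j). cylinder_weight p \<zeta> j)"
    using assms(2) by (intro sum.mono_neutral_left) (auto simp: cylinder_weight_def moebius_weight_one)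
  then show ?thesis
    using uniform_sum_normal_multiples[OF assms(1) one_simple_products, of j] by simp
qed

lemma sum_full_words_q_ge_1: "1 \<le> (\<Sum>\<zeta>\<in>full_words j. q ^ blen (prefix_prod \<zeta> (Suc j)))"
proof -
  obtain \<mu> where \<mu>: "uniform k n q \<mu>" using uniform_exists_q by blast
  have "1 = (\<Sum>\<zeta>\<in>full_words j. cylinder_weight q \<zeta> j)"
    using uniform_sum_full_words[OF \<mu>] uniform_ge_q(1)[OF order_refl \<mu>] by simp
  also have "\<dots> \<le> (\<Sum>\<zeta>\<in>full_words j. q ^ blen (prefix_prod \<zeta> (Suc j)) * 1)"
    unfolding cylinder_weight_def
    using uniform_moebius_weight_le_1[OF \<mu> q_pos] q_pos by (intro sum_mono mult_left_mono) auto
  finally show ?thesis by simp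
qed

lemma uniform_power_quotient_bounded:
  assumes u: "uniform k n p \<nu>" and p: "q < p"
    and c: "0 \<le> c" "\<And>y. y \<in> \<S> \<Longrightarrow> y \<noteq> \<one> \<Longrightarrow> c \<le> moebius_weight p y"
  shows "c * (p / q) ^ Suc j \<le> 1"
proof -
  have "0 < p" using p q_pos by simp
  have "c * (p / q) ^ Suc j * 1 \<le> c * (p / q) ^ Suc j * (\<Sum>\<zeta>\<in>full_words j. q ^ blen (prefix_prod \<zeta> (Suc j)))"
    using sum_full_words_q_ge_1 c(1) \<open>0 < p\<close> q_pos by (intro mult_left_mono) auto
  also have "\<dots> = (\<Sum>\<zeta>\<in>full_words j. c * ((p / q) ^ Suc j * q ^ blen (prefix_prod \<zeta> (Suc j))))"
    by (simp add: sum_distrib_left mult.assoc)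
  also have "\<dots> \<le> (\<Sum>\<zeta>\<in>full_words j. cylinder_weight p \<zeta> j)"
  proof (rule sum_mono)
    fix \<zeta> assume "\<zeta> \<in> full_words j"
    then have \<zeta>: "\<zeta> \<in> Mbar k n" "\<zeta> j \<noteq> \<one>" by auto
    let ?l = "blen (prefix_prod \<zeta> (Suc j))"
    have "(p / q) ^ Suc j \<le> (p / q) ^ ?l"
      using blen_prefix_prod_ge[OF \<zeta>] p q_pos by (intro power_increasing) auto
    then have "(p / q) ^ Suc j * q ^ ?l \<le> (p / q) ^ ?l * q ^ ?l" using q_pos by (intro mult_right_mono) auto
    also have "\<dots> = p ^ ?l" using q_pos by (simp add: power_divide)
    finally have "c * ((p / q) ^ Suc j * q ^ ?l) \<le> moebius_weight p (\<zeta> j) * p ^ ?l"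
      using c(1) c(2)[of "\<zeta> j"] \<zeta> \<open>0 < p\<close> q_pos by (intro mult_mono) auto
    then show "c * ((p / q) ^ Suc j * q ^ ?l) \<le> cylinder_weight p \<zeta> j"
      by (simp add: cylinder_weight_def mult.commute)
  qed
  also have "\<dots> = 1" using uniform_sum_full_words[OF u uniform_ge_q(1)[OF less_imp_le[OF p] u]] .
  finally show ?thesis by simp
qed

theorem no_uniform_above_q:
  assumes "q < p" "p \<noteq> 1" shows "\<not> uniform k n p \<nu>"
proof
  assume u: "uniform k n p \<nu>"
  interpret \<nu>: prob_space \<nu> using uniform_prob_on[OF u] by (rule prob_onD)
  obtain s where s: "s \<in> \<Sigma>" using gens_nonempty by blast
  then have "measure \<nu> (Up k n (\<sigma> s)) = p" using uniform_Up[OF u, of "\<sigma> s"] by simp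
  then have p: "0 < p" "p < 1" using \<nu>.prob_le_1[of "Up k n (\<sigma> s)"] assms q_pos by auto
  define c where "c = Min (moebius_weight p ` (\<S> - {\<one>}))"
  have fin: "finite (\<S> - {\<one>})" by simp
  have "\<sigma> s \<in> \<S> - {\<one>}" using s by simp
  then have "moebius_weight p ` (\<S> - {\<one>}) \<noteq> {}" by blast
  then have "0 < c" unfolding c_def using uniform_moebius_weight_pos[OF u p] fin by (subst Min_gr_iff) auto
  moreover have "c \<le> moebius_weight p y" if "y \<in> \<S>" "y \<noteq> \<one>" for y unfolding c_def using fin that by simp
  ultimately have bound: "c * (p / q) ^ Suc j \<le> 1" for j
    using uniform_power_quotient_bounded[OF u assms(1), of c] by simp
  have "1 < p / q" using assms q_pos by simp
  then obtain j where "1 / c < (p / q) ^ j" using real_arch_pow by blast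
  also have "\<dots> \<le> (p / q) ^ Suc j" using \<open>1 < p / q\<close> by (intro power_increasing) auto
  finally have "1 < c * (p / q) ^ Suc j" using \<open>0 < c\<close> by (simp add: field_simps)
  then show False using bound[of j] by simp
qed

theorem uniform_exists_iff:
  assumes "0 \<le> p" shows "(\<exists>\<nu>. uniform k n p \<nu>) \<longleftrightarrow> p \<le> q \<or> p = 1"
proof
  assume "\<exists>\<nu>. uniform k n p \<nu>"
  then show "p \<le> q \<or> p = 1" using no_uniform_above_q by (meson not_le)
next
  assume "p \<le> q \<or> p = 1"
  then consider "p < q" | "p = q" | "p = 1" by linarith
  then show "\<exists>\<nu>. uniform k n p \<nu>"
    using uniform_exists_below[OF assms] uniform_exists_q uniform_1 by cases auto
qed

end

section \<open>Lattices of simple elements\<close>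

text \<open>The family \<open>P\<close> is only assumed to be cancellative and to have joins inside itself; both properties
  are then propagated to the whole monoid by induction on the word length.\<close>

locale simple_elements = braid_monoid +
  fixes P :: "elt set" and \<delta> :: elt
  assumes P_subset: "P \<subseteq> M"
    and P_factors: "\<And>a b. a \<in> M \<Longrightarrow> b \<in> M \<Longrightarrow> a \<odot> b \<in> P \<Longrightarrow> a \<in> P \<and> b \<in> P"
    and P_cancel: "\<And>a b b'. a \<in> M \<Longrightarrow> b \<in> M \<Longrightarrow> b' \<in> M \<Longrightarrow> a \<odot> b \<in> P \<Longrightarrow> a \<odot> b = a \<odot> b' \<Longrightarrow> b = b'"
    and top_in_P: "\<delta> \<in> P" and dvs_top: "\<And>x. x \<in> P \<Longrightarrow> x \<preceq> \<delta>"
    and gen_dvs_top: "\<And>s. s \<in> \<Sigma> \<Longrightarrow> \<sigma> s \<preceq> \<delta>"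
    and top_unique: "\<And>x. x \<in> P \<Longrightarrow> (\<And>s. s \<in> \<Sigma> \<Longrightarrow> \<sigma> s \<preceq> x) \<Longrightarrow> x = \<delta>"
    and gens_join: "\<And>s t. s \<in> \<Sigma> \<Longrightarrow> t \<in> \<Sigma> \<Longrightarrow>
      \<exists>j\<in>P. \<sigma> s \<preceq> j \<and> \<sigma> t \<preceq> j \<and> (\<forall>x\<in>P. \<sigma> s \<preceq> x \<longrightarrow> \<sigma> t \<preceq> x \<longrightarrow> j \<preceq> x)"
    and rels_join: "\<And>s t u v x. (s # u, t # v) \<in> rels k n \<Longrightarrow>
      \<langle>s # u\<rangle> \<in> P \<and> (x \<in> P \<longrightarrow> \<sigma> s \<preceq> x \<longrightarrow> \<sigma> t \<preceq> x \<longrightarrow> \<langle>s # u\<rangle> \<preceq> x)"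
begin

lemma P_closed [simp]: "x \<in> P \<Longrightarrow> x \<in> M" using P_subset by blast

lemma top_closed [simp]: "\<delta> \<in> M" using top_in_P by simp

lemma P_iff: "x \<in> P \<longleftrightarrow> x \<in> M \<and> x \<preceq> \<delta>"
proof
  assume "x \<in> M \<and> x \<preceq> \<delta>"
  then obtain z where "x \<in> M" "z \<in> M" "\<delta> = x \<odot> z" by (auto elim: dvsE)
  then show "x \<in> P" using P_factors top_in_P by metis
qed (simp add: dvs_top)

lemma P_left_factor: "x \<in> M \<Longrightarrow> x \<preceq> y \<Longrightarrow> y \<in> P \<Longrightarrow> x \<in> P"
  using P_iff dvs_trans by blast

lemma gen_in_P [simp]: "s \<in> \<Sigma> \<Longrightarrow> \<sigma> s \<in> P" using P_iff gen_dvs_top by simp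

lemma one_in_P [simp]: "\<one> \<in> P" using P_iff by simp

lemma P_dvs_cancel:
  assumes "a \<in> M" "x \<in> M" "y \<in> M" "a \<odot> y \<in> P" "a \<odot> x \<preceq> a \<odot> y"
  shows "x \<preceq> y"
proof -
  obtain z where z: "z \<in> M" "a \<odot> y = a \<odot> x \<odot> z" using assms(5) by (rule dvsE)
  then have "a \<odot> y = a \<odot> (x \<odot> z)" using assms by (simp add: mult_assoc)
  then have "y = x \<odot> z" using P_cancel assms z by (metis mult_closed)
  then show ?thesis using z by auto
qed

subsection \<open>Joins in the family\<close>

definition is_lub :: "elt \<Rightarrow> elt \<Rightarrow> elt \<Rightarrow> bool" where
  "is_lub x y j \<longleftrightarrow> j \<in> P \<and> x \<preceq> j \<and> y \<preceq> j \<and> (\<forall>z\<in>P. x \<preceq> z \<longrightarrow> y \<preceq> z \<longrightarrow> j \<preceq> z)"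

lemma is_lubD:
  assumes "is_lub x y j"
  shows "j \<in> P" "j \<in> M" "x \<preceq> j" "y \<preceq> j" "\<And>z. z \<in> P \<Longrightarrow> x \<preceq> z \<Longrightarrow> y \<preceq> z \<Longrightarrow> j \<preceq> z"
  using assms unfolding is_lub_def by auto

lemma is_lub_unique: "is_lub x y i \<Longrightarrow> is_lub x y j \<Longrightarrow> i = j"
  by (meson is_lubD dvs_antisym)

lemma is_lub_self: "x \<in> P \<Longrightarrow> x \<preceq> y \<Longrightarrow> y \<in> P \<Longrightarrow> is_lub x y y \<and> is_lub y x y"
  unfolding is_lub_def by simp

lemma gens_is_lub: "s \<in> \<Sigma> \<Longrightarrow> t \<in> \<Sigma> \<Longrightarrow> \<exists>j. is_lub (\<sigma> s) (\<sigma> t) j"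
  using gens_join unfolding is_lub_def by blast

lemma is_lub_mult:
  assumes a: "a \<in> M" and xy: "x \<in> M" "y \<in> M" and j: "is_lub x y j"
    and ub: "z \<in> P" "a \<odot> x \<preceq> z" "a \<odot> y \<preceq> z"
  shows "is_lub (a \<odot> x) (a \<odot> y) (a \<odot> j)"
proof -
  have least: "a \<odot> j \<preceq> w" if w: "w \<in> P" "a \<odot> x \<preceq> w" "a \<odot> y \<preceq> w" for w
  proof -
    obtain w' where w': "w' \<in> M" "w = a \<odot> x \<odot> w'" using w(2) by (rule dvsE)
    define v where "v = x \<odot> w'"
    have v: "v \<in> M" "w = a \<odot> v" using w' a xy unfolding v_def by (auto simp: mult_assoc)
    have "v \<in> P" using P_factors[OF a v(1)] w(1) v(2) by auto
    moreover have "x \<preceq> v" "y \<preceq> v" using P_dvs_cancel[OF a _ v(1)] w v xy by auto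
    ultimately have "j \<preceq> v" using is_lubD(5)[OF j] by blast
    then show ?thesis using v a is_lubD(2)[OF j] by (auto intro: mult_dvs_mono)
  qed
  have "a \<odot> j \<in> P" using P_left_factor[OF _ least[OF ub]] ub a is_lubD(2)[OF j] by simp
  then show ?thesis
    using least a xy is_lubD(3,4)[OF j] unfolding is_lub_def by (auto intro: mult_dvs_mono)
qed

lemma is_lub_via:
  assumes i: "is_lub c d i" and cd: "c \<in> M" "d \<in> M" "c \<preceq> u" "d \<preceq> v" and u: "u \<in> M"
    and a: "is_lub u i a" and b: "is_lub a v b"
  shows "is_lub u v b"
proof -
  have "b \<preceq> w" if w: "w \<in> P" "u \<preceq> w" "v \<preceq> w" for w
  proof -
    have "c \<preceq> w" "d \<preceq> w" using w cd dvs_trans by blast+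
    then have "i \<preceq> w" using is_lubD(5)[OF i] w by blast
    then have "a \<preceq> w" using is_lubD(5)[OF a] w by blast
    then show ?thesis using is_lubD(5)[OF b] w by blast
  qed
  moreover have "u \<preceq> b" using dvs_trans[OF u is_lubD(3)[OF a] is_lubD(3)[OF b]] .
  ultimately show ?thesis using is_lubD(1,4)[OF b] unfolding is_lub_def by blast
qed

lemma P_proper_gen_mult:
  assumes "z \<in> P" "u \<in> P" "z \<preceq> u" "z \<noteq> u"
  obtains s where "s \<in> \<Sigma>" "z \<odot> \<sigma> s \<in> P" "z \<odot> \<sigma> s \<preceq> u"
proof -
  obtain u' where u': "u' \<in> M" "u = z \<odot> u'" using assms(3) by (rule dvsE)
  then have "u' \<noteq> \<one>" using assms by auto
  then obtain s where s: "s \<in> \<Sigma>" "\<sigma> s \<preceq> u'" using nontrivial_gen_dvs u'(1) by blast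
  then have "z \<odot> \<sigma> s \<preceq> u" using u' assms(1) by (simp add: mult_dvs_mono)
  then show ?thesis using that[OF s(1)] P_left_factor[OF _ _ assms(2), of "z \<odot> \<sigma> s"] assms(1) s(1) by simp
qed

lemma is_lub_exists_above:
  assumes "z \<in> P" "u \<in> P" "v \<in> P" "z \<preceq> u" "z \<preceq> v"
  shows "\<exists>j. is_lub u v j"
  using assms
proof (induction "blen \<delta> - blen z" arbitrary: z u v rule: less_induct)
  case less
  show ?case
  proof (cases "z = u \<or> z = v")
    case True
    then show ?thesis using less.prems is_lub_self by blast
  next
    case False
    have shorter: "blen \<delta> - blen (z \<odot> \<sigma> s) < blen \<delta> - blen z" if "s \<in> \<Sigma>" "z \<odot> \<sigma> s \<in> P" for s
      using dvs_blen_le[OF _ dvs_top[OF that(2)]] that less.prems(1) by simp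
    obtain s where s: "s \<in> \<Sigma>" "z \<odot> \<sigma> s \<in> P" "z \<odot> \<sigma> s \<preceq> u"
      using P_proper_gen_mult less.prems(1,2,4) False by blast
    obtain t where t: "t \<in> \<Sigma>" "z \<odot> \<sigma> t \<in> P" "z \<odot> \<sigma> t \<preceq> v"
      using P_proper_gen_mult less.prems(1,3,5) False by blast
    obtain i where "is_lub (\<sigma> s) (\<sigma> t) i" using gens_is_lub s(1) t(1) by blast
    then have i: "is_lub (z \<odot> \<sigma> s) (z \<odot> \<sigma> t) (z \<odot> i)"
      using is_lub_mult[OF _ _ _ _ top_in_P] dvs_top s t less.prems(1) by simp
    obtain a where a: "is_lub u (z \<odot> i) a"
      using less.hyps[OF shorter[OF s(1,2)] s(2) less.prems(2) is_lubD(1)[OF i] s(3) is_lubD(3)[OF i]] by blast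
    have "z \<odot> \<sigma> t \<preceq> a" using dvs_trans[OF _ is_lubD(4)[OF i] is_lubD(4)[OF a]] t(2) by simp
    then obtain b where b: "is_lub a v b"
      using less.hyps[OF shorter[OF t(1,2)] t(2) is_lubD(1)[OF a] less.prems(3)] t(3) by blast
    have "is_lub u v b" using is_lub_via[OF i _ _ s(3) t(3) _ a b] s(2) t(2) less.prems(2) by simp
    then show ?thesis by blast
  qed
qed

lemma is_lub_exists: "u \<in> P \<Longrightarrow> v \<in> P \<Longrightarrow> \<exists>j. is_lub u v j"
  using is_lub_exists_above[of \<one> u v] by simp

subsection \<open>Cancellation and joins up to a given length\<close>

definition cancel_upto :: "nat \<Rightarrow> bool" where
  "cancel_upto N \<longleftrightarrow> (\<forall>s\<in>\<Sigma>. \<forall>a\<in>M. \<forall>b\<in>M. \<sigma> s \<odot> a = \<sigma> s \<odot> b \<longrightarrow> blen a < N \<longrightarrow> a = b)"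

definition lub_upto :: "nat \<Rightarrow> bool" where
  "lub_upto N \<longleftrightarrow> (\<forall>s\<in>\<Sigma>. \<forall>t\<in>\<Sigma>. \<forall>m\<in>M. \<forall>j. blen m \<le> N \<longrightarrow> \<sigma> s \<preceq> m \<longrightarrow> \<sigma> t \<preceq> m \<longrightarrow>
    is_lub (\<sigma> s) (\<sigma> t) j \<longrightarrow> j \<preceq> m)"

lemma cancel_upto_mult:
  assumes "cancel_upto N" "x \<in> M" "a \<in> M" "b \<in> M" "x \<odot> a = x \<odot> b" "blen (x \<odot> a) \<le> N"
  shows "a = b"
  using assms(2-)
proof (induction x rule: M_induct)
  case (gen_mult s y)
  then have "\<sigma> s \<odot> (y \<odot> a) = \<sigma> s \<odot> (y \<odot> b)" by (simp add: mult_assoc)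
  moreover have "blen (\<sigma> s \<odot> y \<odot> a) = Suc (blen (y \<odot> a))" using gen_mult(1,2,4) by simp
  then have "blen (y \<odot> a) < N" using gen_mult.prems(4) by simp
  ultimately have "y \<odot> a = y \<odot> b" using assms(1) gen_mult unfolding cancel_upto_def by (meson mult_closed)
  then show ?case using gen_mult by auto
qed simp

lemma cancel_upto_dvs:
  assumes N: "cancel_upto N" and M: "x \<in> M" "z \<in> M" "m \<in> M" and dvs: "x \<odot> z \<preceq> x \<odot> m" and "blen (x \<odot> m) \<le> N"
  shows "z \<preceq> m"
proof -
  obtain w where w: "w \<in> M" "x \<odot> m = x \<odot> z \<odot> w" using dvs by (rule dvsE)
  then have "m = z \<odot> w" using cancel_upto_mult[OF N M(1,3), of "z \<odot> w"] M assms(6) by (simp add: mult_assoc)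
  then show ?thesis using w by auto
qed

lemma is_lub_gen_mult_dvs:
  assumes N: "cancel_upto N" and s: "s \<in> \<Sigma>" and M: "x \<in> M" "y \<in> M" "m \<in> M" "blen (\<sigma> s \<odot> m) \<le> N"
    and j: "is_lub (\<sigma> s \<odot> x) (\<sigma> s \<odot> y) j" and dvs: "\<sigma> s \<odot> x \<preceq> \<sigma> s \<odot> m" "\<sigma> s \<odot> y \<preceq> \<sigma> s \<odot> m"
    and factor: "\<And>i. is_lub x y i \<Longrightarrow> x \<preceq> m \<Longrightarrow> y \<preceq> m \<Longrightarrow> i \<preceq> m"
    and P: "\<sigma> s \<odot> x \<in> P" "\<sigma> s \<odot> y \<in> P"
  shows "j \<preceq> \<sigma> s \<odot> m"
proof -
  have "x \<in> P" "y \<in> P" using P_factors P M s by (meson gen_closed)+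
  then obtain i where i: "is_lub x y i" using is_lub_exists by blast
  have "x \<preceq> m" "y \<preceq> m" using cancel_upto_dvs[OF N gen_closed[OF s]] M dvs by blast+
  then have "i \<preceq> m" using factor i by blast
  then have "\<sigma> s \<odot> i \<preceq> \<sigma> s \<odot> m" using s is_lubD(2)[OF i] by (intro mult_dvs_mono) auto
  moreover have "is_lub (\<sigma> s \<odot> x) (\<sigma> s \<odot> y) (\<sigma> s \<odot> i)"
    using is_lub_mult[OF _ M(1,2) i is_lubD(1,3,4)[OF j]] s by simp
  ultimately show ?thesis using is_lub_unique j by blast
qed

lemma lub_upto_is_lub_dvs:
  assumes N: "cancel_upto N" "lub_upto N"
  shows "x \<in> P \<Longrightarrow> y \<in> P \<Longrightarrow> is_lub x y j \<Longrightarrow> m \<in> M \<Longrightarrow> blen m \<le> N \<Longrightarrow> x \<preceq> m \<Longrightarrow> y \<preceq> m \<Longrightarrow> j \<preceq> m"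
proof (induction "blen m" arbitrary: x y j m rule: less_induct)
  case less
  have common_gen: "i \<preceq> m"
    if s: "s \<in> \<Sigma>" "\<sigma> s \<preceq> x" "\<sigma> s \<preceq> y" and P: "x \<in> P" "y \<in> P" and i: "is_lub x y i" "x \<preceq> m" "y \<preceq> m" for s x y i
  proof -
    have "\<sigma> s \<preceq> m" using s i dvs_trans gen_closed by blast
    then obtain x' y' m' where factors: "x' \<in> M" "x = \<sigma> s \<odot> x'" "y' \<in> M" "y = \<sigma> s \<odot> y'" "m' \<in> M" "m = \<sigma> s \<odot> m'"
      using s(2,3) by (auto elim!: dvsE)
    then have P': "x' \<in> P" "y' \<in> P" using P_factors P s by (meson gen_closed)+
    show ?thesis
      unfolding factors(6)
    proof (rule is_lub_gen_mult_dvs[OF N(1) s(1) factors(1,3,5)])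
      show "i' \<preceq> m'" if "is_lub x' y' i'" "x' \<preceq> m'" "y' \<preceq> m'" for i'
        using less.hyps[OF _ P' that(1) factors(5) _ that(2,3)] less.prems(5) s(1) factors by simp
    qed (use less.prems(5) i P factors in auto)
  qed
  show ?case
  proof (cases "x = \<one> \<or> y = \<one>")
    case True
    then have "is_lub x y (if x = \<one> then y else x)" using less.prems(1,2) is_lub_self by auto
    then have "j = (if x = \<one> then y else x)" using is_lub_unique less.prems(3) by blast
    then show ?thesis using less.prems(6,7) by (simp split: if_splits)
  next
    case False
    obtain s where s: "s \<in> \<Sigma>" "\<sigma> s \<preceq> x" using False less.prems(1) nontrivial_gen_dvs P_closed by blast
    obtain t where t: "t \<in> \<Sigma>" "\<sigma> t \<preceq> y" using False less.prems(2) nontrivial_gen_dvs P_closed by blast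
    have "\<sigma> s \<preceq> m" "\<sigma> t \<preceq> m" using s t less.prems dvs_trans gen_closed by blast+
    moreover obtain i where i: "is_lub (\<sigma> s) (\<sigma> t) i" using gens_is_lub s t by blast
    ultimately have im: "i \<preceq> m" using N(2) s t less.prems unfolding lub_upto_def by blast
    obtain a where a: "is_lub x i a" using is_lub_exists less.prems(1) is_lubD(1)[OF i] by blast
    have am: "a \<preceq> m"
      using common_gen[OF s is_lubD(3)[OF i] less.prems(1) is_lubD(1)[OF i] a less.prems(6) im] .
    obtain b where b: "is_lub a y b" using is_lub_exists less.prems(2) is_lubD(1)[OF a] by blast
    have "\<sigma> t \<preceq> a" using dvs_trans[OF _ is_lubD(4)[OF i] is_lubD(4)[OF a]] t(1) by simp
    then have "b \<preceq> m" using common_gen[OF t(1) _ t(2) is_lubD(1)[OF a] less.prems(2) b am less.prems(7)] by blast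
    moreover have "is_lub x y b" using is_lub_via[OF i _ _ s(2) t(2) _ a b] s(1) t(1) less.prems(1) by simp
    ultimately show ?thesis using is_lub_unique less.prems(3) by blast
  qed
qed

subsection \<open>Multiples of joins of generators\<close>

definition factors_through_lub :: "gen \<Rightarrow> elt \<Rightarrow> gen \<Rightarrow> elt \<Rightarrow> bool" where
  "factors_through_lub s x t y \<longleftrightarrow> (\<exists>a b z. a \<in> M \<and> b \<in> M \<and> z \<in> M \<and>
    is_lub (\<sigma> s) (\<sigma> t) (\<sigma> s \<odot> a) \<and> \<sigma> s \<odot> a = \<sigma> t \<odot> b \<and> x = a \<odot> z \<and> y = b \<odot> z)"

lemma factors_through_lub_refl: "s \<in> \<Sigma> \<Longrightarrow> x \<in> M \<Longrightarrow> factors_through_lub s x s x"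
  unfolding factors_through_lub_def using is_lub_self[of "\<sigma> s" "\<sigma> s"]
  by (intro exI[of _ \<one>] exI[of _ x]) simp

lemma factors_through_lub_rels:
  assumes rel: "(s # u, t # v) \<in> rels k n \<or> (t # v, s # u) \<in> rels k n" and w: "w \<in> lists \<Sigma>"
  shows "factors_through_lub s \<langle>u @ w\<rangle> t \<langle>v @ w\<rangle>"
proof -
  have eq: "\<langle>s # u\<rangle> = \<langle>t # v\<rangle>" using beq_rel[OF rel, of "[]" "[]"] by (simp add: cls_eq_iff)
  have letters: "s \<in> \<Sigma>" "t \<in> \<Sigma>" "u \<in> lists \<Sigma>" "v \<in> lists \<Sigma>" using rel by (auto dest: rels_length_and_letters)
  have "\<sigma> s \<preceq> \<langle>s # u\<rangle>" "\<sigma> t \<preceq> \<langle>s # u\<rangle>"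
    using dvsI[of "\<langle>u\<rangle>" "\<sigma> s"] dvsI[of "\<langle>v\<rangle>" "\<sigma> t"] letters eq by (simp_all add: cls_Cons)
  then have "is_lub (\<sigma> s) (\<sigma> t) (\<sigma> s \<odot> \<langle>u\<rangle>)"
    using rel rels_join[of s u t v] rels_join[of t v s u] eq unfolding is_lub_def by (auto simp flip: cls_Cons)
  then show ?thesis
    unfolding factors_through_lub_def using eq letters w
    by (intro exI[of _ "\<langle>u\<rangle>"] exI[of _ "\<langle>v\<rangle>"] exI[of _ "\<langle>w\<rangle>"]) (simp add: mult_cls cls_Cons)
qed

lemma factors_through_lub_mult:
  assumes "factors_through_lub s x t y" "w \<in> M"
  shows "factors_through_lub s (x \<odot> w) t (y \<odot> w)"
proof -
  obtain a b z where "a \<in> M" "b \<in> M" "z \<in> M" "is_lub (\<sigma> s) (\<sigma> t) (\<sigma> s \<odot> a)" "\<sigma> s \<odot> a = \<sigma> t \<odot> b"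
      "x = a \<odot> z" "y = b \<odot> z" using assms(1) unfolding factors_through_lub_def by blast
  then show ?thesis
    unfolding factors_through_lub_def using assms(2)
    by (intro exI[of _ a] exI[of _ b] exI[of _ "z \<odot> w"]) (simp add: mult_assoc)
qed

lemma factors_through_lub_in_P:
  assumes gens: "s \<in> \<Sigma>" "t \<in> \<Sigma>" and M: "x \<in> M" "y \<in> M" and eq: "\<sigma> s \<odot> x = \<sigma> t \<odot> y" and P: "\<sigma> s \<odot> x \<in> P"
  shows "factors_through_lub s x t y"
proof -
  obtain i where i: "is_lub (\<sigma> s) (\<sigma> t) i" using gens_is_lub gens by blast
  obtain a where a: "a \<in> M" "i = \<sigma> s \<odot> a" using is_lubD(3)[OF i] by (rule dvsE)
  obtain b where b: "b \<in> M" "i = \<sigma> t \<odot> b" using is_lubD(4)[OF i] by (rule dvsE)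
  have "\<sigma> s \<preceq> \<sigma> s \<odot> x" using M(1) by (rule dvsI)
  moreover have "\<sigma> t \<preceq> \<sigma> s \<odot> x" unfolding eq using M(2) by (rule dvsI)
  ultimately have "i \<preceq> \<sigma> s \<odot> x" by (rule is_lubD(5)[OF i P])
  then obtain f where f: "f \<in> M" "\<sigma> s \<odot> x = i \<odot> f" by (rule dvsE)
  have "\<sigma> s \<odot> x = \<sigma> s \<odot> (a \<odot> f)" unfolding f(2) a(2) using gens a(1) f(1) by (simp add: mult_assoc)
  then have "x = a \<odot> f" using P_cancel[OF gen_closed[OF gens(1)] M(1) _ P] a(1) f(1) by (meson mult_closed)
  moreover have "\<sigma> t \<odot> y = \<sigma> t \<odot> (b \<odot> f)"
    unfolding eq[symmetric] f(2) b(2) using gens b(1) f(1) by (simp add: mult_assoc)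
  then have "y = b \<odot> f"
    using P_cancel[OF gen_closed[OF gens(2)] M(2) _ P[unfolded eq]] b(1) f(1) by (meson mult_closed)
  ultimately show ?thesis
    unfolding factors_through_lub_def using i a b f(1) by (intro exI[of _ a] exI[of _ b] exI[of _ f]) simp
qed

lemma lub_upto_common_multiple:
  assumes N: "cancel_upto N" "lub_upto N" and P: "b \<in> P" "c \<in> P" and z: "z\<^sub>1 \<in> M" "z\<^sub>2 \<in> M"
    and y: "b \<odot> z\<^sub>1 = c \<odot> z\<^sub>2" "blen (b \<odot> z\<^sub>1) \<le> N" and e: "is_lub b c e"
  obtains a' b' z where "a' \<in> M" "b' \<in> M" "z \<in> M" "e = b \<odot> a'" "e = c \<odot> b'" "z\<^sub>1 = a' \<odot> z" "z\<^sub>2 = b' \<odot> z"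
proof -
  have "e \<preceq> b \<odot> z\<^sub>1"
    using lub_upto_is_lub_dvs[OF N P e _ y(2)] P z y(1) dvsI[of z\<^sub>1 b] dvsI[of z\<^sub>2 c] by simp
  then obtain z where z': "z \<in> M" "b \<odot> z\<^sub>1 = e \<odot> z" by (rule dvsE)
  obtain a' where a': "a' \<in> M" "e = b \<odot> a'" using is_lubD(3)[OF e] by (rule dvsE)
  obtain b' where b': "b' \<in> M" "e = c \<odot> b'" using is_lubD(4)[OF e] by (rule dvsE)
  have "b \<odot> z\<^sub>1 = b \<odot> (a' \<odot> z)" using z' a' P by (simp add: mult_assoc)
  then have "z\<^sub>1 = a' \<odot> z" using cancel_upto_mult[OF N(1) _ z(1) _ _ y(2)] P a'(1) z'(1) by simp
  moreover have "c \<odot> z\<^sub>2 = c \<odot> (b' \<odot> z)" using z' b' P y(1) by (simp add: mult_assoc)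
  then have "z\<^sub>2 = b' \<odot> z" using cancel_upto_mult[OF N(1) _ z(2) _ _ y(2)[unfolded y(1)]] P b'(1) z'(1) by simp
  ultimately show ?thesis using that a' b' z'(1) by blast
qed

text \<open>The cube condition: the joins of the generators \<open>r\<close>, \<open>s\<close>, \<open>t\<close> all divide the join of the two given ones.\<close>

lemma factors_through_lub_trans:
  assumes N: "cancel_upto N" "lub_upto N" and gens: "s \<in> \<Sigma>" "r \<in> \<Sigma>" "t \<in> \<Sigma>" and y: "blen y \<le> N"
    and sr: "factors_through_lub s x r y" and rt: "factors_through_lub r y t w"
  shows "factors_through_lub s x t w"
proof -
  obtain a b z\<^sub>1 where ab: "a \<in> M" "b \<in> M" "z\<^sub>1 \<in> M" "is_lub (\<sigma> s) (\<sigma> r) (\<sigma> s \<odot> a)" "\<sigma> s \<odot> a = \<sigma> r \<odot> b"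
      "x = a \<odot> z\<^sub>1" "y = b \<odot> z\<^sub>1" using sr unfolding factors_through_lub_def by blast
  obtain c d z\<^sub>2 where cd: "c \<in> M" "d \<in> M" "z\<^sub>2 \<in> M" "is_lub (\<sigma> r) (\<sigma> t) (\<sigma> r \<odot> c)" "\<sigma> r \<odot> c = \<sigma> t \<odot> d"
      "y = c \<odot> z\<^sub>2" "w = d \<odot> z\<^sub>2" using rt unfolding factors_through_lub_def by blast
  have rP: "\<sigma> r \<odot> b \<in> P" "\<sigma> r \<odot> c \<in> P" using is_lubD(1)[OF ab(4)] is_lubD(1)[OF cd(4)] ab(5) by auto
  then have P: "b \<in> P" "c \<in> P" using P_factors gens ab(2) cd(1) by (meson gen_closed)+
  obtain e where e: "is_lub b c e" using is_lub_exists P by blast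
  obtain a' b' z where z: "a' \<in> M" "b' \<in> M" "z \<in> M" "e = b \<odot> a'" "e = c \<odot> b'" "z\<^sub>1 = a' \<odot> z" "z\<^sub>2 = b' \<odot> z"
    using lub_upto_common_multiple[OF N P ab(3) cd(3) _ _ e] y ab(7) cd(6) by metis
  obtain j where "is_lub (\<sigma> r \<odot> b) (\<sigma> r \<odot> c) j" using is_lub_exists rP by blast
  then have J: "\<sigma> r \<odot> e \<in> P"
    using is_lub_mult[OF gen_closed[OF gens(2)] ab(2) cd(1) e] is_lubD by meson
  have "\<sigma> r \<odot> e = \<sigma> s \<odot> (a \<odot> a')" unfolding z(4) using ab(1,2,5) z(1) gens by (simp flip: mult_assoc)
  moreover have "\<sigma> r \<odot> e = \<sigma> t \<odot> (d \<odot> b')" unfolding z(5) using cd(1,2,5) z(2) gens by (simp flip: mult_assoc)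
  ultimately have "factors_through_lub s (a \<odot> a') t (d \<odot> b')"
    using factors_through_lub_in_P[OF gens(1,3)] J ab(1) cd(2) z(1,2) by simp
  then have "factors_through_lub s (a \<odot> a' \<odot> z) t (d \<odot> b' \<odot> z)" using z(3) by (rule factors_through_lub_mult)
  moreover have "x = a \<odot> a' \<odot> z" "w = d \<odot> b' \<odot> z"
    using ab(1,6) cd(2,7) z by (simp_all add: mult_assoc)
  ultimately show ?thesis by simp
qed

lemma word_eq_factors_through_lub:
  assumes N: "cancel_upto N" "lub_upto N"
    and "w \<doteq> w'" "w = s # x" "w \<in> lists \<Sigma>" "length w = Suc N"
  shows "\<exists>t y. w' = t # y \<and> factors_through_lub s \<langle>x\<rangle> t \<langle>y\<rangle>"
  using assms(3-)
proof (induction rule: beq.induct)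
  case (beq_refl w)
  then show ?case using factors_through_lub_refl by simp
next
  case (beq_step u v w a b)
  have s: "s \<in> \<Sigma>" using beq_step.prems by auto
  have letters: "a @ u @ b \<in> lists \<Sigma>" and len: "length (a @ u @ b) = Suc N"
    using beq_lists_iff[OF beq_step.hyps(2)] beq_length[OF beq_step.hyps(2)] beq_step.prems by simp_all
  obtain r y where y: "a @ u @ b = r # y" "factors_through_lub s \<langle>x\<rangle> r \<langle>y\<rangle>" using beq_step by blast
  show ?case
  proof (cases a)
    case (Cons r' a')
    then have "y = a' @ u @ b" "r' = r" using y(1) by auto
    then have "\<langle>y\<rangle> = \<langle>a' @ v @ b\<rangle>" using beq_rel[OF beq_step.hyps(1)] by (simp add: cls_eq_iff)
    then show ?thesis using y(2) Cons \<open>r' = r\<close> by simp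
  next
    case Nil
    obtain r' u' t v' where uv: "u = r' # u'" "v = t # v'" using rels_ConsE[OF beq_step.hyps(1)] .
    then have "r' = r" "y = u' @ b" using y(1) Nil by auto
    then have "factors_through_lub r \<langle>y\<rangle> t \<langle>v' @ b\<rangle>"
      using factors_through_lub_rels[of r u' t v' b] beq_step.hyps(1) letters uv by auto
    moreover have "r \<in> \<Sigma>" using letters unfolding y(1) by simp
    moreover have "t \<in> \<Sigma>" using uv(2) beq_step.hyps(1) by (auto dest: rels_length_and_letters)
    moreover have "blen \<langle>y\<rangle> \<le> N" using len y(1) by simp
    ultimately have "factors_through_lub s \<langle>x\<rangle> t \<langle>v' @ b\<rangle>"
      using factors_through_lub_trans[OF N s _ _ _ y(2)] by blast
    then show ?thesis using Nil uv by simp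
  qed
qed

lemma gen_mult_eq_factors_through_lub:
  assumes N: "cancel_upto N" "lub_upto N"
    and s: "s \<in> \<Sigma>" and t: "t \<in> \<Sigma>" and a: "a \<in> M" "blen a = N" and b: "b \<in> M" and eq: "\<sigma> s \<odot> a = \<sigma> t \<odot> b"
  shows "factors_through_lub s a t b"
proof -
  obtain u where u: "u \<in> lists \<Sigma>" "a = \<langle>u\<rangle>" using a(1) by (rule M_cases)
  obtain v where v: "v \<in> lists \<Sigma>" "b = \<langle>v\<rangle>" using b by (rule M_cases)
  have "s # u \<doteq> t # v" using eq u v by (simp flip: cls_Cons add: cls_eq_iff)
  then show ?thesis using word_eq_factors_through_lub[OF N, of "s # u" "t # v" s u] s u v a(2) by simp
qed

lemma cancel_upto_Suc:
  assumes N: "cancel_upto N" "lub_upto N" shows "cancel_upto (Suc N)"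
  unfolding cancel_upto_def
proof (intro ballI impI)
  fix s a b assume ab: "s \<in> \<Sigma>" "a \<in> M" "b \<in> M" "\<sigma> s \<odot> a = \<sigma> s \<odot> b" "blen a < Suc N"
  show "a = b"
  proof (cases "blen a = N")
    case False
    then show ?thesis using N(1) ab unfolding cancel_upto_def by (metis less_antisym)
  next
    case True
    obtain a' b' z where fac: "a' \<in> M" "b' \<in> M" "z \<in> M" "is_lub (\<sigma> s) (\<sigma> s) (\<sigma> s \<odot> a')" "\<sigma> s \<odot> a' = \<sigma> s \<odot> b'"
        "a = a' \<odot> z" "b = b' \<odot> z"
      using gen_mult_eq_factors_through_lub[OF N ab(1,1,2) True ab(3,4)] unfolding factors_through_lub_def
      by blast
    have "is_lub (\<sigma> s) (\<sigma> s) (\<sigma> s)" using ab(1) is_lub_self by simp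
    then have "\<sigma> s \<odot> a' = \<sigma> s" using is_lub_unique fac(4) by blast
    then have "blen (\<sigma> s \<odot> a') = blen (\<sigma> s)" "blen (\<sigma> s \<odot> b') = blen (\<sigma> s)" using fac(5) by simp_all
    then have "a' = \<one>" "b' = \<one>" using fac(1,2) ab(1) by simp_all
    then show ?thesis using fac by simp
  qed
qed

lemma lub_upto_Suc:
  assumes N: "cancel_upto N" "lub_upto N" shows "lub_upto (Suc N)"
  unfolding lub_upto_def
proof (intro ballI allI impI)
  fix s t m j
  assume m: "s \<in> \<Sigma>" "t \<in> \<Sigma>" "m \<in> M" "blen m \<le> Suc N" "\<sigma> s \<preceq> m" "\<sigma> t \<preceq> m" and j: "is_lub (\<sigma> s) (\<sigma> t) j"
  show "j \<preceq> m"
  proof (cases "blen m = Suc N")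
    case False
    then show ?thesis using N(2) m j unfolding lub_upto_def by (metis le_SucE)
  next
    case True
    obtain a where a: "a \<in> M" "m = \<sigma> s \<odot> a" using m(5) by (rule dvsE)
    obtain b where b: "b \<in> M" "m = \<sigma> t \<odot> b" using m(6) by (rule dvsE)
    have "blen a = N" using True a m(1) by simp
    then obtain a' z where fac: "a' \<in> M" "z \<in> M" "is_lub (\<sigma> s) (\<sigma> t) (\<sigma> s \<odot> a')" "a = a' \<odot> z"
      using gen_mult_eq_factors_through_lub[OF N m(1,2) a(1) _ b(1)] a(2) b(2)
      unfolding factors_through_lub_def by metis
    then have "m = j \<odot> z" using a(2) is_lub_unique[OF fac(3) j] m(1) by (simp flip: mult_assoc)
    then show ?thesis using fac(2) by auto
  qed
qed

lemma cancel_upto: "cancel_upto N" and lub_upto: "lub_upto N"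
proof (induction N)
  case 0
  { case 1 show ?case unfolding cancel_upto_def by simp }
  { case 2 show ?case unfolding lub_upto_def using dvs_blen_le gen_closed blen_gen by fastforce }
next
  case (Suc N)
  { case 1 show ?case using cancel_upto_Suc Suc by blast }
  { case 2 show ?case using lub_upto_Suc Suc by blast }
qed

subsection \<open>The Garside structure\<close>

lemma left_cancel: "x \<in> M \<Longrightarrow> a \<in> M \<Longrightarrow> b \<in> M \<Longrightarrow> x \<odot> a = x \<odot> b \<Longrightarrow> a = b"
  using cancel_upto cancel_upto_mult by blast

lemma is_lub_dvs_iff:
  assumes "x \<in> P" "y \<in> P" "is_lub x y j" "m \<in> M" shows "j \<preceq> m \<longleftrightarrow> x \<preceq> m \<and> y \<preceq> m"
  using assms lub_upto_is_lub_dvs[OF cancel_upto lub_upto assms order_refl]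
    dvs_trans[of x j m] dvs_trans[of y j m] is_lubD(3,4)[OF assms(3)] by auto

lemma gens_lub_exists:
  assumes "X \<subseteq> \<Sigma>" shows "\<exists>d\<in>P. \<forall>m\<in>M. d \<preceq> m \<longleftrightarrow> (\<forall>s\<in>X. \<sigma> s \<preceq> m)"
proof -
  have "finite X" using assms finite_subset finite_gens by blast
  then show ?thesis using assms
  proof (induction X)
    case empty
    then show ?case by (intro bexI[of _ \<one>]) auto
  next
    case (insert s X)
    then obtain d where d: "d \<in> P" "\<forall>m\<in>M. d \<preceq> m \<longleftrightarrow> (\<forall>s\<in>X. \<sigma> s \<preceq> m)" by auto
    have s: "\<sigma> s \<in> P" using insert.prems by simp
    obtain j where j: "is_lub (\<sigma> s) d j" using is_lub_exists[OF s d(1)] by blast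
    then show ?case using is_lub_dvs_iff[OF s d(1) j] d(2) is_lubD(1)[OF j] by (intro bexI[of _ j]) auto
  qed
qed

lemma DeltaX_in_P: "X \<subseteq> \<Sigma> \<Longrightarrow> DeltaX k n X \<in> P"
  and DeltaX_dvs_iff: "X \<subseteq> \<Sigma> \<Longrightarrow> m \<in> M \<Longrightarrow> DeltaX k n X \<preceq> m \<longleftrightarrow> (\<forall>s\<in>X. \<sigma> s \<preceq> m)"
proof -
  assume "X \<subseteq> \<Sigma>"
  then obtain d where d: "d \<in> P" "\<forall>m\<in>M. d \<preceq> m \<longleftrightarrow> (\<forall>s\<in>X. \<sigma> s \<preceq> m)" using gens_lub_exists by blast
  have "DeltaX k n X = d"
    unfolding DeltaX_def
  proof (rule the_equality)
    show "d \<in> M \<and> (\<forall>s\<in>X. \<sigma> s \<preceq> d) \<and> (\<forall>m\<in>M. (\<forall>s\<in>X. \<sigma> s \<preceq> m) \<longrightarrow> d \<preceq> m)"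
      using d dvs_refl P_closed by blast
  next
    fix d' assume "d' \<in> M \<and> (\<forall>s\<in>X. \<sigma> s \<preceq> d') \<and> (\<forall>m\<in>M. (\<forall>s\<in>X. \<sigma> s \<preceq> m) \<longrightarrow> d' \<preceq> m)"
    then show "d' = d" using d dvs_antisym P_closed dvs_refl by metis
  qed
  then show "DeltaX k n X \<in> P" "m \<in> M \<Longrightarrow> DeltaX k n X \<preceq> m \<longleftrightarrow> (\<forall>s\<in>X. \<sigma> s \<preceq> m)" using d by simp_all
qed

lemma Delta_eq: "Delta k n = \<delta>"
  unfolding Delta_def
proof (rule top_unique)
  show "DeltaX k n \<Sigma> \<in> P" by (simp add: DeltaX_in_P)
  then show "\<sigma> s \<preceq> DeltaX k n \<Sigma>" if "s \<in> \<Sigma>" for s using that DeltaX_dvs_iff[of \<Sigma> "DeltaX k n \<Sigma>"] by simp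
qed

lemma Simples_eq: "Simples k n = P"
  unfolding Simples_def Delta_eq using P_iff by auto

lemma garsideI:
  assumes "\<And>s t. s \<in> \<Sigma> \<Longrightarrow> t \<in> \<Sigma> \<Longrightarrow> \<sigma> s \<odot> \<delta> = \<sigma> t \<odot> \<delta> \<Longrightarrow> s = t"
  shows "garside k n"
proof
  show "a = b" if "x \<in> M" "a \<in> M" "b \<in> M" "x \<odot> a = x \<odot> b" for x a b using that by (rule left_cancel)
  show "b \<in> Simples k n" if "a \<in> M" "b \<in> M" "a \<odot> b \<in> Simples k n" for a b
    using P_factors that unfolding Simples_eq by blast
  show "DeltaX k n X \<in> M" if "X \<subseteq> \<Sigma>" for X using DeltaX_in_P[OF that] by simp
  show "DeltaX k n X \<preceq> m \<longleftrightarrow> (\<forall>s\<in>X. \<sigma> s \<preceq> m)" if "X \<subseteq> \<Sigma>" "m \<in> M" for X m using that by (rule DeltaX_dvs_iff)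
  show "s = t" if "s \<in> \<Sigma>" "t \<in> \<Sigma>" "\<sigma> s \<odot> Delta k n = \<sigma> t \<odot> Delta k n" for s t
    using assms that unfolding Delta_eq by blast
  show "\<exists>j\<in>Simples k n. a \<preceq> j \<and> b \<preceq> j \<and> (\<forall>m\<in>M. a \<preceq> m \<longrightarrow> b \<preceq> m \<longrightarrow> j \<preceq> m)"
    if "a \<in> Simples k n" "b \<in> Simples k n" for a b
  proof -
    have ab: "a \<in> P" "b \<in> P" using that unfolding Simples_eq by auto
    then obtain j where j: "is_lub a b j" using is_lub_exists by blast
    then show ?thesis unfolding Simples_eq using is_lub_dvs_iff[OF ab j] is_lubD(1,3,4)[OF j] by blast
  qed
qed

end

section \<open>Automata of simple elements\<close>

fun run :: "('w \<Rightarrow> gen set) \<Rightarrow> (gen \<Rightarrow> 'w \<Rightarrow> 'w) \<Rightarrow> gen list \<Rightarrow> 'w \<Rightarrow> 'w option" where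
  "run D quo [] x = Some x"
| "run D quo (s # w) x = (if s \<in> D x then run D quo w (quo s x) else None)"

lemma run_append: "run D quo (u @ v) x = Option.bind (run D quo u x) (run D quo v)"
  by (induction u arbitrary: x) auto

definition relator_graph :: "mkind \<Rightarrow> nat \<Rightarrow> gen set \<Rightarrow> (gen \<times> gen) set" where
  "relator_graph k n A =
    {(s, t). s \<in> A \<and> t \<in> A \<and> (\<exists>u v. (s # u, t # v) \<in> rels k n \<or> (t # v, s # u) \<in> rels k n)}"

definition state_arrows :: "'w set \<Rightarrow> ('w \<Rightarrow> gen set) \<Rightarrow> ('w \<Rightarrow> 'w) \<Rightarrow> ('w \<times> 'w) set" where
  "state_arrows S D K = {(x, y). x \<in> S \<and> y \<in> S \<and> D y \<inter> D (K x) = {}}"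

text \<open>A state \<open>x\<close> of the automaton models a simple element, \<open>D x\<close> the set of generators dividing it on the
  left and \<open>quo s x\<close> its quotient by such a generator \<open>s\<close>. The states \<open>e\<close> and \<open>\<delta>\<close> model the unit and the
  Garside element, and \<open>K x\<close> models the quotient of the Garside element by \<open>x\<close>.\<close>

locale simple_automaton = braid_monoid k n for k n +
  fixes S :: "'w set" and D :: "'w \<Rightarrow> gen set" and quo :: "gen \<Rightarrow> 'w \<Rightarrow> 'w" and e \<delta> :: 'w
    and rk :: "'w \<Rightarrow> nat" and K :: "'w \<Rightarrow> 'w"
  assumes unit_state: "e \<in> S" and top_state: "\<delta> \<in> S"
    and divisors_subset: "\<And>x. x \<in> S \<Longrightarrow> D x \<subseteq> \<Sigma>"
    and quo_state: "\<And>s x. x \<in> S \<Longrightarrow> s \<in> D x \<Longrightarrow> quo s x \<in> S"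
    and rk_quo_less: "\<And>s x. x \<in> S \<Longrightarrow> s \<in> D x \<Longrightarrow> rk (quo s x) < rk x"
    and divisors_empty_iff: "\<And>x. x \<in> S \<Longrightarrow> D x = {} \<longleftrightarrow> x = e"
    and divisors_top: "D \<delta> = \<Sigma>" and divisors_fullD: "\<And>x. x \<in> S \<Longrightarrow> D x = \<Sigma> \<Longrightarrow> x = \<delta>"
    and multiple_exists: "\<And>s x. x \<in> S \<Longrightarrow> s \<in> \<Sigma> \<Longrightarrow> D x \<subseteq> D (quo s \<delta>) \<Longrightarrow> \<exists>y\<in>S. s \<in> D y \<and> quo s y = x"
    and run_rels: "\<And>u v x. (u, v) \<in> rels k n \<Longrightarrow> x \<in> S \<Longrightarrow> run D quo u x = run D quo v x"
    and run_rels_defined: "\<And>s t u v x. (s # u, t # v) \<in> rels k n \<Longrightarrow> x \<in> S \<Longrightarrow> s \<in> D x \<Longrightarrow> t \<in> D x \<Longrightarrow>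
      run D quo (s # u) x \<noteq> None"
    and divisors_connected: "\<And>s t x. x \<in> S \<Longrightarrow> s \<in> D x \<Longrightarrow> t \<in> D x \<Longrightarrow> (s, t) \<in> (relator_graph k n (D x))\<^sup>*"
    and run_complement: "\<And>w x. x \<in> S \<Longrightarrow> run D quo w x = Some e \<Longrightarrow> run D quo w \<delta> = Some (K x)"
    and complement_quo_inj: "\<And>s t. s \<in> \<Sigma> \<Longrightarrow> t \<in> \<Sigma> \<Longrightarrow> D (K (quo s \<delta>)) \<inter> D (K (quo t \<delta>)) \<noteq> {} \<Longrightarrow> s = t"
begin

abbreviation "rd \<equiv> run D quo"

lemma run_state: "x \<in> S \<Longrightarrow> rd w x = Some y \<Longrightarrow> y \<in> S"
proof (induction w arbitrary: x)
  case (Cons s w)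
  then show ?case using quo_state[of x s] by (simp split: if_splits)
qed simp

lemma run_lists: "x \<in> S \<Longrightarrow> rd w x = Some y \<Longrightarrow> w \<in> lists \<Sigma>"
proof (induction w arbitrary: x)
  case (Cons s w)
  then show ?case using quo_state[of x s] divisors_subset[of x] by (auto split: if_splits)
qed simp

lemma run_word_eq: "u \<doteq> v \<Longrightarrow> x \<in> S \<Longrightarrow> rd u x = rd v x"
proof (induction rule: beq.induct)
  case (beq_step u v w a b)
  have "rd u y = rd v y" if "y \<in> S" for y
    using beq_step.hyps(1) run_rels[of u v y] run_rels[of v u y] that by auto
  then have "rd (a @ u @ b) x = rd (a @ v @ b) x"
    using run_state[OF beq_step.prems, of a] unfolding run_append by (cases "rd a x") auto
  then show ?case using beq_step by simp
qed simp

lemma run_to_unit_exists: "x \<in> S \<Longrightarrow> \<exists>w. rd w x = Some e"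
proof (induction "rk x" arbitrary: x rule: less_induct)
  case less
  show ?case
  proof (cases "x = e")
    case False
    then obtain s where s: "s \<in> D x" using divisors_empty_iff less.prems by blast
    then obtain w where "rd w (quo s x) = Some e" using less rk_quo_less quo_state by blast
    then have "rd (s # w) x = Some e" using s by simp
    then show ?thesis by blast
  qed (auto intro: exI[of _ "[]"])
qed

lemma relator_graph_run_to_unit:
  assumes x: "x \<in> S" and st: "(s, t) \<in> relator_graph k n (D x)"
  obtains u v where "s # u \<doteq> t # v" "rd u (quo s x) = Some e" "rd v (quo t x) = Some e"
proof -
  obtain u v where rel: "(s # u, t # v) \<in> rels k n \<or> (t # v, s # u) \<in> rels k n" and D: "s \<in> D x" "t \<in> D x"
    using st unfolding relator_graph_def by auto
  have "rd (s # u) x \<noteq> None" using rel run_rels run_rels_defined x D by metis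
  then obtain y where y: "rd (s # u) x = Some y" by auto
  then obtain w where "rd w y = Some e" using run_to_unit_exists run_state x by blast
  then have w: "rd (s # u @ w) x = Some e" using y run_append[of D quo "s # u" w x] by simp
  moreover have eq: "s # u @ w \<doteq> t # v @ w" using beq_rel[OF rel, of "[]" w] by simp
  ultimately have "rd (t # v @ w) x = Some e" using run_word_eq x by metis
  then show ?thesis using that[OF eq] w D by simp
qed

lemma run_to_unit_unique: "x \<in> S \<Longrightarrow> rd u x = Some e \<Longrightarrow> rd v x = Some e \<Longrightarrow> u \<doteq> v"
proof (induction "rk x" arbitrary: x u v rule: less_induct)
  case less
  show ?case
  proof (cases "x = e")
    case True
    then have "D x = {}" using divisors_empty_iff less.prems by blast
    then have "u = []" "v = []" using less.prems by (cases u; cases v; auto)+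
    then show ?thesis by (simp add: beq_refl)
  next
    case False
    then obtain s u' where u: "u = s # u'" "s \<in> D x" "rd u' (quo s x) = Some e"
      using less.prems by (cases u) (auto split: if_splits)
    obtain t v' where v: "v = t # v'" "t \<in> D x" "rd v' (quo t x) = Some e"
      using False less.prems by (cases v) (auto split: if_splits)
    have quotient: "r # w \<doteq> r # w'" if "r \<in> D x" "rd w (quo r x) = Some e" "rd w' (quo r x) = Some e" for r w w'
      using less.hyps[OF rk_quo_less quo_state] less.prems(1) that by (intro beq_Cons) blast
    have "\<forall>w. rd w (quo t x) = Some e \<longrightarrow> s # u' \<doteq> t # w"
      using divisors_connected[OF less.prems(1) u(2) v(2)]
    proof (induction rule: rtrancl_induct)
      case base
      show ?case using quotient u by blast
    next
      case (step r t)
      obtain w w' where w: "r # w \<doteq> t # w'" "rd w (quo r x) = Some e" "rd w' (quo t x) = Some e"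
        using relator_graph_run_to_unit[OF less.prems(1) step.hyps(2)] .
      have "s # u' \<doteq> t # w'" using beq_trans[OF w(1)] step.IH w(2) by blast
      moreover have "t \<in> D x" using step.hyps(2) unfolding relator_graph_def by blast
      ultimately show ?case using quotient[OF _ w(3)] beq_trans by metis
    qed
    then show ?thesis using u v by simp
  qed
qed

subsection \<open>The element of a state\<close>

definition elt_of :: "'w \<Rightarrow> elt" where "elt_of x = \<langle>SOME w. rd w x = Some e\<rangle>"

definition below :: "'w \<Rightarrow> 'w \<Rightarrow> bool" where "below x y \<longleftrightarrow> (\<exists>w. rd w x = Some e \<and> rd w y \<noteq> None)"

lemma elt_of_eq: "x \<in> S \<Longrightarrow> rd w x = Some e \<Longrightarrow> elt_of x = \<langle>w\<rangle>"
  unfolding elt_of_def cls_eq_iff using run_to_unit_unique someI[of "\<lambda>w. rd w x = Some e" w] by blast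

lemma elt_of_cases:
  assumes "x \<in> S" obtains w where "rd w x = Some e" "elt_of x = \<langle>w\<rangle>" "w \<in> lists \<Sigma>"
  using assms run_to_unit_exists elt_of_eq run_lists by metis

lemma elt_of_eqD: "x \<in> S \<Longrightarrow> elt_of x = \<langle>w\<rangle> \<Longrightarrow> rd w x = Some e"
  by (metis elt_of_cases cls_eq_iff run_word_eq)

lemma elt_of_closed [simp]: "x \<in> S \<Longrightarrow> elt_of x \<in> M"
  by (metis elt_of_cases cls_in_M)

lemma elt_of_unit: "elt_of e = \<one>"
  using elt_of_eq[OF unit_state, of "[]"] by (simp add: unit_e_def)

lemma elt_of_gen: "x \<in> S \<Longrightarrow> rd [s] x = Some e \<Longrightarrow> elt_of x = \<sigma> s"
  using elt_of_eq by (simp add: gel_def)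

lemma elt_of_quo: assumes "x \<in> S" "s \<in> D x" shows "elt_of x = \<sigma> s \<odot> elt_of (quo s x)"
proof -
  obtain w where "rd w (quo s x) = Some e" "elt_of (quo s x) = \<langle>w\<rangle>"
    using quo_state[OF assms] by (rule elt_of_cases)
  then show ?thesis using elt_of_eq[OF assms(1), of "s # w"] assms(2) by (simp add: cls_Cons)
qed

lemma gen_dvs_elt_of_iff: assumes "x \<in> S" shows "\<sigma> s \<preceq> elt_of x \<longleftrightarrow> s \<in> D x"
proof
  assume "\<sigma> s \<preceq> elt_of x"
  then obtain z where z: "z \<in> M" "elt_of x = \<sigma> s \<odot> z" by (rule dvsE)
  obtain w where "z = \<langle>w\<rangle>" using z(1) by (rule M_cases)
  then have "rd (s # w) x = Some e" using elt_of_eqD[OF assms, of "s # w"] z by (simp add: cls_Cons)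
  then show "s \<in> D x" by (auto split: if_splits)
next
  assume "s \<in> D x"
  then show "\<sigma> s \<preceq> elt_of x"
    using elt_of_quo[OF assms, of s] quo_state[OF assms, of s] elt_of_closed dvsI by metis
qed

lemma below_run:
  assumes "x \<in> S" "y \<in> S" "below x y" "rd w x \<noteq> None"
  shows "rd w y \<noteq> None"
proof -
  obtain v where v: "rd v x = Some e" "rd v y \<noteq> None" using assms(3) unfolding below_def by blast
  obtain z where z: "rd w x = Some z" using assms(4) by blast
  obtain u where u: "rd u z = Some e" using run_to_unit_exists run_state assms z by blast
  have "rd (w @ u) x = Some e" using z u by (simp add: run_append)
  then have "w @ u \<doteq> v" using run_to_unit_unique v assms by blast
  then have "rd (w @ u) y \<noteq> None" using run_word_eq assms(2) v by metis
  then show ?thesis by (cases "rd w y") (auto simp: run_append)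
qed

lemma below_top: "x \<in> S \<Longrightarrow> below x \<delta>"
  unfolding below_def using run_complement run_to_unit_exists by blast

lemma below_dvs: assumes "x \<in> S" "y \<in> S" "below x y" shows "elt_of x \<preceq> elt_of y"
proof -
  obtain w z where w: "rd w x = Some e" "rd w y = Some z" using assms(3) unfolding below_def by blast
  have "z \<in> S" using run_state w assms by blast
  then obtain u where u: "rd u z = Some e" "u \<in> lists \<Sigma>" using elt_of_cases by blast
  have "rd (w @ u) y = Some e" using w u by (simp add: run_append)
  then have "elt_of y = elt_of x \<odot> \<langle>u\<rangle>"
    using elt_of_eq[OF assms(2)] elt_of_eq[OF assms(1) w(1)] by (simp add: mult_cls)
  then show ?thesis using u by auto
qed

lemma run_top_state: "rd u \<delta> \<noteq> None \<Longrightarrow> \<exists>x\<in>S. rd u x = Some e"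
proof (induction u)
  case Nil
  then show ?case using unit_state by auto
next
  case (Cons s u)
  then have s: "s \<in> D \<delta>" "rd u (quo s \<delta>) \<noteq> None" by (auto split: if_splits)
  have quo: "quo s \<delta> \<in> S" using quo_state top_state s by blast
  then have "rd u \<delta> \<noteq> None" using below_run top_state below_top s(2) by blast
  then obtain x where x: "x \<in> S" "rd u x = Some e" using Cons by blast
  have "D x \<subseteq> D (quo s \<delta>)"
  proof
    fix t assume t: "t \<in> D x"
    obtain v where "rd v (quo t x) = Some e" using run_to_unit_exists quo_state x t by blast
    then have "rd (t # v) x = Some e" using t by simp
    then have "u \<doteq> t # v" using run_to_unit_unique x by blast
    then have "rd (t # v) (quo s \<delta>) \<noteq> None" using run_word_eq quo s(2) by metis
    then show "t \<in> D (quo s \<delta>)" by (auto split: if_splits)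
  qed
  then obtain y where "y \<in> S" "s \<in> D y" "quo s y = x" using multiple_exists[OF x(1)] s divisors_top by blast
  then show ?case using x by auto
qed

lemma gen_state:
  assumes "s \<in> \<Sigma>"
  shows "\<exists>j\<in>S. rd [s] j = Some e \<and> s \<in> D j \<and> (\<forall>x\<in>S. s \<in> D x \<longrightarrow> below j x)"
proof -
  have "D e = {}" using divisors_empty_iff unit_state by blast
  then obtain j where "j \<in> S" "s \<in> D j" "quo s j = e" using multiple_exists[OF unit_state assms] by auto
  then show ?thesis unfolding below_def by (intro bexI[of _ j]) (auto intro!: exI[of _ "[s]"])
qed

lemma rels_state:
  assumes rel: "(s # u, t # v) \<in> rels k n \<or> (t # v, s # u) \<in> rels k n"
  shows "\<exists>j\<in>S. rd (s # u) j = Some e \<and> s \<in> D j \<and> t \<in> D j \<and> (\<forall>x\<in>S. s \<in> D x \<longrightarrow> t \<in> D x \<longrightarrow> below j x)"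
proof -
  have eq: "rd (s # u) x = rd (t # v) x" if "x \<in> S" for x using rel run_rels that by metis
  have defined: "rd (s # u) x \<noteq> None" if "x \<in> S" "s \<in> D x" "t \<in> D x" for x
    using rel run_rels_defined that eq by metis
  have "s \<in> \<Sigma>" "t \<in> \<Sigma>" using rel by (auto dest: rels_length_and_letters)
  then obtain j where j: "j \<in> S" "rd (s # u) j = Some e"
    using run_top_state defined top_state divisors_top by metis
  then have "rd (t # v) j = Some e" using eq by simp
  then have "s \<in> D j" "t \<in> D j" using j by (auto split: if_splits)
  then show ?thesis using j defined unfolding below_def by blast
qed

lemma elt_of_factors:
  assumes x: "x \<in> S" and eq: "elt_of x = \<langle>u @ v\<rangle>"
  obtains y z where "y \<in> S" "z \<in> S" "rd u x = Some y" "elt_of y = \<langle>v\<rangle>" "elt_of z = \<langle>u\<rangle>"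
proof -
  have "rd (u @ v) x = Some e" using elt_of_eqD[OF x eq] .
  then obtain y where y: "rd u x = Some y" "rd v y = Some e" by (cases "rd u x") (auto simp: run_append)
  have yS: "y \<in> S" using run_state x y by blast
  have "rd u \<delta> \<noteq> None" using below_run[OF x top_state below_top[OF x]] y by simp
  then obtain z where "z \<in> S" "rd u z = Some e" using run_top_state by blast
  then show ?thesis using that[OF yS _ y(1) elt_of_eq[OF yS y(2)]] elt_of_eq by blast
qed

end

locale lattice_automaton = simple_automaton +
  assumes join: "\<And>s t. s \<in> \<Sigma> \<Longrightarrow> t \<in> \<Sigma> \<Longrightarrow>
    \<exists>j\<in>S. s \<in> D j \<and> t \<in> D j \<and> (\<forall>x\<in>S. s \<in> D x \<longrightarrow> t \<in> D x \<longrightarrow> below j x)"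

sublocale lattice_automaton \<subseteq> simples: simple_elements k n "elt_of ` S" "elt_of \<delta>"
proof
  fix a b assume a: "a \<in> M" and b: "b \<in> M" and ab: "a \<odot> b \<in> elt_of ` S"
  obtain u where u: "u \<in> lists \<Sigma>" "a = \<langle>u\<rangle>" using a by (rule M_cases)
  obtain v where v: "v \<in> lists \<Sigma>" "b = \<langle>v\<rangle>" using b by (rule M_cases)
  obtain x where x: "x \<in> S" "elt_of x = \<langle>u @ v\<rangle>" using ab u v by (auto simp: mult_cls)
  obtain y z where yz: "y \<in> S" "z \<in> S" "rd u x = Some y" "elt_of y = b" "elt_of z = a"
    using elt_of_factors[OF x] u(2) v(2) by metis
  then show "a \<in> elt_of ` S \<and> b \<in> elt_of ` S" by blast
  fix b' assume b': "b' \<in> M" and eq: "a \<odot> b = a \<odot> b'"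
  obtain v' where v': "v' \<in> lists \<Sigma>" "b' = \<langle>v'\<rangle>" using b' by (rule M_cases)
  have "elt_of x = \<langle>u @ v'\<rangle>" using x(2) eq u v v' by (simp add: mult_cls)
  then show "b = b'" using elt_of_factors[OF x(1)] yz(3,4) v'(2) by (metis option.inject)
next
  fix s t assume st: "s \<in> \<Sigma>" "t \<in> \<Sigma>"
  obtain j where j: "j \<in> S" "s \<in> D j" "t \<in> D j" "\<forall>x\<in>S. s \<in> D x \<longrightarrow> t \<in> D x \<longrightarrow> below j x"
    using join[OF st] by blast
  show "\<exists>j\<in>elt_of ` S. \<sigma> s \<preceq> j \<and> \<sigma> t \<preceq> j \<and> (\<forall>x\<in>elt_of ` S. \<sigma> s \<preceq> x \<longrightarrow> \<sigma> t \<preceq> x \<longrightarrow> j \<preceq> x)"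
    using j gen_dvs_elt_of_iff below_dvs by (intro bexI[of _ "elt_of j"]) auto
next
  fix s t u v x assume rel: "(s # u, t # v) \<in> rels k n"
  obtain j where j: "j \<in> S" "rd (s # u) j = Some e" "\<forall>x\<in>S. s \<in> D x \<longrightarrow> t \<in> D x \<longrightarrow> below j x"
    using rels_state rel by metis
  have "\<langle>s # u\<rangle> = elt_of j" using elt_of_eq[OF j(1,2)] by (rule sym)
  then show "\<langle>s # u\<rangle> \<in> elt_of ` S \<and> (x \<in> elt_of ` S \<longrightarrow> \<sigma> s \<preceq> x \<longrightarrow> \<sigma> t \<preceq> x \<longrightarrow> \<langle>s # u\<rangle> \<preceq> x)"
    using j(1,3) gen_dvs_elt_of_iff[of _ s] gen_dvs_elt_of_iff[of _ t] below_dvs[of j] by auto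
next
  fix x assume x: "x \<in> elt_of ` S"
  then show "x \<preceq> elt_of \<delta>" using below_dvs top_state below_top by auto
  assume "\<And>s. s \<in> \<Sigma> \<Longrightarrow> \<sigma> s \<preceq> x"
  then show "x = elt_of \<delta>" using x gen_dvs_elt_of_iff divisors_subset divisors_fullD by blast
qed (use top_state gen_dvs_elt_of_iff divisors_top in auto)

context lattice_automaton
begin

lemma complement_state: "x \<in> S \<Longrightarrow> K x \<in> S" and elt_of_mult_complement: "x \<in> S \<Longrightarrow> elt_of x \<odot> elt_of (K x) = elt_of \<delta>"
proof -
  assume x: "x \<in> S"
  obtain w where w: "rd w x = Some e" "elt_of x = \<langle>w\<rangle>" using x by (rule elt_of_cases)
  have K: "rd w \<delta> = Some (K x)" using run_complement[OF x w(1)] .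
  then show KS: "K x \<in> S" using run_state top_state by blast
  obtain v where v: "rd v (K x) = Some e" "elt_of (K x) = \<langle>v\<rangle>" using KS by (rule elt_of_cases)
  have "rd (w @ v) \<delta> = Some e" using K v by (simp add: run_append)
  then have "elt_of \<delta> = \<langle>w @ v\<rangle>" using elt_of_eq top_state by blast
  then show "elt_of x \<odot> elt_of (K x) = elt_of \<delta>" using v w by (simp add: mult_cls)
qed

lemma gen_mult_top_eq:
  assumes "s \<in> \<Sigma>" shows "\<sigma> s \<odot> elt_of \<delta> = elt_of \<delta> \<odot> elt_of (K (quo s \<delta>))"
proof -
  have quo: "quo s \<delta> \<in> S" using quo_state top_state divisors_top assms by blast
  have top: "elt_of \<delta> = \<sigma> s \<odot> elt_of (quo s \<delta>)" using elt_of_quo top_state divisors_top assms by blast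
  have "\<sigma> s \<odot> elt_of \<delta> = \<sigma> s \<odot> (elt_of (quo s \<delta>) \<odot> elt_of (K (quo s \<delta>)))"
    using elt_of_mult_complement[OF quo] by simp
  then show ?thesis using top assms quo complement_state by (simp flip: mult_assoc)
qed

lemma gen_mult_top_inj:
  assumes s: "s \<in> \<Sigma>" and t: "t \<in> \<Sigma>" and eq: "\<sigma> s \<odot> elt_of \<delta> = \<sigma> t \<odot> elt_of \<delta>"
  shows "s = t"
proof -
  have K: "K (quo s \<delta>) \<in> S" "K (quo t \<delta>) \<in> S"
    using complement_state quo_state top_state divisors_top s t by blast+
  have "elt_of \<delta> \<odot> elt_of (K (quo s \<delta>)) = elt_of \<delta> \<odot> elt_of (K (quo t \<delta>))"
    using eq unfolding gen_mult_top_eq[OF s] gen_mult_top_eq[OF t] .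
  then have "elt_of (K (quo s \<delta>)) = elt_of (K (quo t \<delta>))"
    using simples.left_cancel elt_of_closed K top_state by metis
  then have "D (K (quo s \<delta>)) = D (K (quo t \<delta>))"
    using gen_dvs_elt_of_iff K by (metis subsetI subset_antisym)
  moreover have "D (K (quo s \<delta>)) \<noteq> {}"
  proof
    assume "D (K (quo s \<delta>)) = {}"
    then have "K (quo s \<delta>) = e" using divisors_empty_iff K by blast
    then have "\<sigma> s \<odot> elt_of \<delta> = elt_of \<delta>"
      unfolding gen_mult_top_eq[OF s] using elt_of_unit top_state by simp
    then have "blen (\<sigma> s \<odot> elt_of \<delta>) = blen (elt_of \<delta>)" by simp
    then show False using s top_state by simp
  qed
  ultimately show ?thesis using complement_quo_inj[OF s t] by blast
qed

lemma garside: "garside k n"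
  using gen_mult_top_inj by (rule simples.garsideI)

lemma Lset_elt_of: "x \<in> S \<Longrightarrow> Lset k n (elt_of x) = D x"
  unfolding Lset_def using gen_dvs_elt_of_iff divisors_subset by blast

lemma Rset_elt_of: assumes x: "x \<in> S" shows "Rset k n (elt_of x) = \<Sigma> - D (K x)"
proof -
  interpret garside k n by (rule garside)
  have simple: "elt_of x \<in> \<S>" using x unfolding simples.Simples_eq by blast
  have "elt_of x \<odot> \<partial> (elt_of x) = elt_of x \<odot> elt_of (K x)"
    using complement_mult[OF simple] elt_of_mult_complement[OF x] by (simp add: simples.Delta_eq)
  then have "\<partial> (elt_of x) = elt_of (K x)"
    using left_cancel[of "elt_of x"] x complement_state simple complement_simple simple_closed elt_of_closed
    by metis
  then show ?thesis
    using mem_R_iff[OF simple] gen_dvs_elt_of_iff[OF complement_state[OF x]] unfolding Rset_def by auto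
qed

lemma arrow_elt_of_iff: "x \<in> S \<Longrightarrow> y \<in> S \<Longrightarrow> arrow k n (elt_of x) (elt_of y) \<longleftrightarrow> D y \<inter> D (K x) = {}"
  unfolding arrow_def using Lset_elt_of Rset_elt_of divisors_subset by blast

lemma irreducible_garsideI:
  assumes "\<Sigma> \<noteq> {}"
    and path: "\<And>s. s \<in> \<Sigma> \<Longrightarrow> \<exists>x z. x \<in> S \<and> rd [s] x = Some e \<and> (x, z) \<in> (state_arrows S D K)\<^sup>* \<and> card (D (K z)) \<le> 1"
  shows "irreducible_garside k n"
proof -
  interpret garside k n by (rule garside)
  have arrows: "z \<in> S \<and> (elt_of x, elt_of z) \<in> simple_arrows\<^sup>*"
    if "(x, z) \<in> (state_arrows S D K)\<^sup>*" "x \<in> S" for x z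
    using that
  proof (induction rule: rtrancl_induct)
    case (step y z)
    then have "(elt_of y, elt_of z) \<in> simple_arrows" "z \<in> S"
      using arrow_elt_of_iff unfolding state_arrows_def simple_arrows_def simples.Simples_eq by auto
    then show ?case using step by (auto intro: rtrancl_into_rtrancl)
  qed simp
  show ?thesis
  proof
    fix s assume "s \<in> \<Sigma>"
    then obtain x z where x: "x \<in> S" "rd [s] x = Some e" and z: "card (D (K z)) \<le> 1"
      and xz: "(x, z) \<in> (state_arrows S D K)\<^sup>*" using path by blast
    have "z \<in> S" using arrows[OF xz x(1)] by blast
    then have "\<Sigma> - R (elt_of z) = D (K z)" using Rset_elt_of complement_state divisors_subset by blast
    then show "\<exists>z. (\<sigma> s, z) \<in> simple_arrows\<^sup>* \<and> card (\<Sigma> - R z) \<le> 1"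
      using arrows[OF xz x(1)] z elt_of_gen[OF x] by (intro exI[of _ "elt_of z"]) simp
  qed (rule assms(1))
qed

end

section \<open>The positive braid monoid\<close>

lemma mem_gens_Artin_iff: "(i, j) \<in> gens Artin n \<longleftrightarrow> j = Suc i \<and> 1 \<le> i \<and> Suc i \<le> n"
  by (auto simp: gens_def)

lemma gens_Artin_cases:
  assumes "s \<in> gens Artin n" obtains i where "s = (i, Suc i)" "1 \<le> i" "Suc i \<le> n"
  using assms by (cases s) (auto simp: mem_gens_Artin_iff)

lemma rels_Artin_cases [consumes 1, case_names commutation braid]:
  assumes "(u, v) \<in> rels Artin n"
  obtains i j where "u = [(i, Suc i), (j, Suc j)]" "v = [(j, Suc j), (i, Suc i)]" "i + 2 \<le> j \<or> j + 2 \<le> i"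
      "1 \<le> i" "i < n" "1 \<le> j" "j < n"
    | i j where "u = [(i, Suc i), (j, Suc j), (i, Suc i)]" "v = [(j, Suc j), (i, Suc i), (j, Suc j)]"
      "i = Suc j \<or> j = Suc i" "1 \<le> i" "i < n" "1 \<le> j" "j < n"
  using assms unfolding rels_def by auto

lemma rels_Artin_exists:
  assumes "s \<in> gens Artin n" "t \<in> gens Artin n" "s \<noteq> t" shows "\<exists>u v. (s # u, t # v) \<in> rels Artin n"
proof -
  obtain i where i: "s = (i, Suc i)" "1 \<le> i" "Suc i \<le> n" using assms(1) by (rule gens_Artin_cases)
  obtain j where j: "t = (j, Suc j)" "1 \<le> j" "Suc j \<le> n" using assms(2) by (rule gens_Artin_cases)
  show ?thesis
  proof (cases "i + 2 \<le> j \<or> j + 2 \<le> i")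
    case True
    then have "(s # [t], t # [s]) \<in> rels Artin n" unfolding rels_def using i j by auto
    then show ?thesis by blast
  next
    case False
    then have "(s # [t, s], t # [s, t]) \<in> rels Artin n" unfolding rels_def using i j assms(3) by auto
    then show ?thesis by blast
  qed
qed

subsection \<open>Descents of permutations\<close>

text \<open>A permutation braid is represented by the inverse of its permutation, so that dividing by \<open>\<sigma>\<^sub>i\<close> swaps
  the values at the positions \<open>i\<close> and \<open>i + 1\<close>.\<close>

abbreviation perms :: "nat \<Rightarrow> (nat \<Rightarrow> nat) set" where "perms n \<equiv> {f. f permutes {1..n}}"

abbreviation adjacent_transposition :: "nat \<Rightarrow> nat \<Rightarrow> nat" where
  "adjacent_transposition i \<equiv> Transposition.transpose i (Suc i)"

definition descents :: "nat \<Rightarrow> (nat \<Rightarrow> nat) \<Rightarrow> gen set" where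
  "descents n f = {(i, i + 1) | i. 1 \<le> i \<and> i + 1 \<le> n \<and> f (i + 1) < f i}"

definition swap_at :: "gen \<Rightarrow> (nat \<Rightarrow> nat) \<Rightarrow> nat \<Rightarrow> nat" where
  "swap_at s f = f \<circ> Transposition.transpose (fst s) (snd s)"

definition reversal :: "nat \<Rightarrow> nat \<Rightarrow> nat" where
  "reversal n i = (if 1 \<le> i \<and> i \<le> n then n + 1 - i else i)"

definition descent_rank :: "nat \<Rightarrow> (nat \<Rightarrow> nat) \<Rightarrow> nat" where
  "descent_rank n f = (\<Sum>i\<in>{1..n}. (n - i) * f i)"

definition reversed_inv :: "nat \<Rightarrow> (nat \<Rightarrow> nat) \<Rightarrow> nat \<Rightarrow> nat" where
  "reversed_inv n f = reversal n \<circ> inv f"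

lemma mem_descents_iff: "(i, j) \<in> descents n f \<longleftrightarrow> j = Suc i \<and> 1 \<le> i \<and> Suc i \<le> n \<and> f (Suc i) < f i"
  by (auto simp: descents_def)

lemma descents_subset: "descents n f \<subseteq> gens Artin n"
  by (auto simp: mem_descents_iff mem_gens_Artin_iff)

lemma descents_cases:
  assumes "s \<in> descents n f" obtains i where "s = (i, Suc i)" "1 \<le> i" "Suc i \<le> n" "f (Suc i) < f i"
  using assms by (cases s) (auto simp: mem_descents_iff)

lemma permutes_and_inv_eqI:
  assumes "\<And>x. x \<notin> A \<Longrightarrow> f x = x" "\<And>x. g (f x) = x" "\<And>x. f (g x) = x"
  shows "f permutes A" "inv f = g"
proof -
  have "\<exists>!x. f x = y" for y using assms(2,3) by metis
  then show "f permutes A" unfolding permutes_def using assms(1) by blast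
  show "inv f = g" by (rule inv_unique_comp) (auto simp: fun_eq_iff assms)
qed

lemma reversal_reversal [simp]: "reversal n (reversal n i) = i" by (auto simp: reversal_def)

lemma reversal_permutes: "reversal n permutes {1..n}" and inv_reversal: "inv (reversal n) = reversal n"
  by (rule permutes_and_inv_eqI[of "{1..n}" "reversal n" "reversal n"]; auto simp: reversal_def)+

lemma reversal_less_iff:
  "i \<in> {1..n} \<Longrightarrow> j \<in> {1..n} \<Longrightarrow> reversal n i < reversal n j \<longleftrightarrow> j < i"
  by (auto simp: reversal_def)

lemma descents_reversal: "descents n (reversal n) = gens Artin n"
  by (auto simp: mem_descents_iff mem_gens_Artin_iff reversal_def)

lemma adjacent_transposition_permutes: "1 \<le> i \<Longrightarrow> Suc i \<le> n \<Longrightarrow> adjacent_transposition i permutes {1..n}"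
  by (intro permutes_swap_id) auto

lemma adjacent_transposition_less:
  "a < b \<Longrightarrow> a \<noteq> i \<or> b \<noteq> Suc i \<Longrightarrow> adjacent_transposition i a < adjacent_transposition i b"
  by (auto simp: Transposition.transpose_def)

lemma swap_at_permutes: "f permutes {1..n} \<Longrightarrow> 1 \<le> i \<Longrightarrow> Suc i \<le> n \<Longrightarrow> swap_at (i, Suc i) f permutes {1..n}"
  unfolding swap_at_def by (intro permutes_compose permutes_swap_id) auto

lemma swap_at_swap_at [simp]: "swap_at s (swap_at s f) = f"
  by (auto simp: swap_at_def fun_eq_iff)

lemma inv_swap_at: "f permutes A \<Longrightarrow> inv (swap_at (i, j) f) = Transposition.transpose i j \<circ> inv f"
  using o_inv_distrib[OF permutes_bij bij_transpose] by (simp add: swap_at_def inv_transpose_eq)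

lemma permutes_adjacent_neq: "f permutes A \<Longrightarrow> f i \<noteq> f (Suc i)"
  using injD[OF permutes_inj, of f A i "Suc i"] by auto

lemma increasing_permutation_eq_id:
  assumes f: "f permutes {1..n}" and "\<And>i. 1 \<le> i \<Longrightarrow> Suc i \<le> n \<Longrightarrow> f i < f (Suc i)"
  shows "f = id"
proof (rule permutes_natset_ge[OF f], rule ballI)
  fix i assume "i \<in> {1..n}"
  then have "1 \<le> i" "i \<le> n" by auto
  then show "i \<le> f i"
  proof (induction i rule: dec_induct)
    case base
    then show ?case using permutes_in_image[OF f, of 1] by auto
  next
    case (step i)
    then show ?case using assms(2)[of i] by simp
  qed
qed

lemma descents_empty_iff: assumes f: "f permutes {1..n}" shows "descents n f = {} \<longleftrightarrow> f = id"
proof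
  assume "descents n f = {}"
  then have "f i < f (Suc i)" if "1 \<le> i" "Suc i \<le> n" for i
    using that permutes_adjacent_neq[OF f, of i] mem_descents_iff[of i "Suc i" n f]
    by (auto simp: not_less le_less)
  then show "f = id" using increasing_permutation_eq_id[OF f] by blast
qed (auto simp: descents_def)

lemma descents_full_imp_reversal:
  assumes f: "f permutes {1..n}" and full: "descents n f = gens Artin n"
  shows "f = reversal n"
proof -
  have "reversal n \<circ> f = id"
  proof (rule increasing_permutation_eq_id)
    show "reversal n \<circ> f permutes {1..n}" using permutes_compose[OF f reversal_permutes] .
    fix i assume i: "1 \<le> i" "Suc i \<le> n"
    then have "f (Suc i) < f i" using full mem_gens_Artin_iff[of i "Suc i"] mem_descents_iff by blast
    moreover have "f i \<in> {1..n}" "f (Suc i) \<in> {1..n}" using permutes_in_image[OF f] i by simp_all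
    ultimately show "(reversal n \<circ> f) i < (reversal n \<circ> f) (Suc i)" by (simp add: reversal_less_iff)
  qed
  then show ?thesis by (metis comp_apply id_apply reversal_reversal ext)
qed

lemma descent_rank_swap_at_less:
  assumes "s \<in> descents n f" shows "descent_rank n (swap_at s f) < descent_rank n f"
proof -
  obtain i where i: "s = (i, Suc i)" "1 \<le> i" "Suc i \<le> n" "f (Suc i) < f i" using assms by (rule descents_cases)
  have positions: "{1..n} = insert i (insert (Suc i) ({1..n} - {i, Suc i}))" using i by auto
  have split: "descent_rank n h =
      (n - i) * h i + ((n - Suc i) * h (Suc i) + (\<Sum>j\<in>{1..n} - {i, Suc i}. (n - j) * h j))" for h
    unfolding descent_rank_def by (subst positions) simp
  have rest: "(\<Sum>j\<in>{1..n} - {i, Suc i}. (n - j) * swap_at s f j) = (\<Sum>j\<in>{1..n} - {i, Suc i}. (n - j) * f j)"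
    by (rule sum.cong) (auto simp: swap_at_def i)
  have "n - i = Suc (n - Suc i)" using i by simp
  then show ?thesis unfolding split rest using i by (simp add: swap_at_def)
qed

lemma descent_multiple_exists:
  assumes f: "f permutes {1..n}" and s: "s \<in> gens Artin n"
    and sub: "descents n f \<subseteq> descents n (swap_at s (reversal n))"
  shows "\<exists>h\<in>perms n. s \<in> descents n h \<and> swap_at s h = f"
proof -
  obtain i where i: "s = (i, Suc i)" "1 \<le> i" "Suc i \<le> n" using s by (rule gens_Artin_cases)
  have "s \<notin> descents n (swap_at s (reversal n))" using i by (auto simp: mem_descents_iff swap_at_def reversal_def)
  then have "\<not> f (Suc i) < f i" using sub i mem_descents_iff by blast
  then have "s \<in> descents n (swap_at s f)"
    using permutes_adjacent_neq[OF f, of i] i by (simp add: mem_descents_iff swap_at_def)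
  then show ?thesis using swap_at_permutes f i by (intro bexI[of _ "swap_at s f"]) auto
qed

lemma run_descents_rels:
  assumes "(u, v) \<in> rels Artin n"
  shows "run (descents n) swap_at u f = run (descents n) swap_at v f"
  using assms
proof (cases rule: rels_Artin_cases)
  case (commutation i j)
  then have "swap_at (j, Suc j) (swap_at (i, Suc i) f) = swap_at (i, Suc i) (swap_at (j, Suc j) f)"
    by (auto simp: swap_at_def fun_eq_iff Transposition.transpose_def)
  then show ?thesis using commutation by (auto simp: mem_descents_iff swap_at_def Transposition.transpose_def)
next
  case (braid i j)
  then have "swap_at (i, Suc i) (swap_at (j, Suc j) (swap_at (i, Suc i) f)) =
      swap_at (j, Suc j) (swap_at (i, Suc i) (swap_at (j, Suc j) f))"
    by (auto simp: swap_at_def fun_eq_iff Transposition.transpose_def)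
  then show ?thesis using braid by (auto simp: mem_descents_iff swap_at_def Transposition.transpose_def)
qed

lemma run_descents_rels_defined:
  assumes "(s # u, t # v) \<in> rels Artin n" "s \<in> descents n f" "t \<in> descents n f"
  shows "run (descents n) swap_at (s # u) f \<noteq> None"
  using assms
  by (cases rule: rels_Artin_cases) (auto simp: mem_descents_iff swap_at_def Transposition.transpose_def)

lemma descents_connected:
  assumes "s \<in> descents n f" "t \<in> descents n f"
  shows "(s, t) \<in> (relator_graph Artin n (descents n f))\<^sup>*"
proof (cases "s = t")
  case False
  then have "(s, t) \<in> relator_graph Artin n (descents n f)"
    using rels_Artin_exists descents_subset assms unfolding relator_graph_def by blast
  then show ?thesis by blast
qed simp

lemma run_descents_inversions_subset:
  assumes "f permutes {1..n}" "h permutes {1..n}" "run (descents n) swap_at w f = Some f'"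
    and "\<And>a b. 1 \<le> a \<Longrightarrow> a < b \<Longrightarrow> b \<le> n \<Longrightarrow> f b < f a \<Longrightarrow> h b < h a"
  shows "run (descents n) swap_at w h = Some (h \<circ> inv f \<circ> f')"
  using assms
proof (induction w arbitrary: f h)
  case Nil
  have "h \<circ> inv f \<circ> f = h" using permutes_inv_o(2)[OF Nil.prems(1)] by (simp add: comp_assoc)
  moreover have "f' = f" using Nil.prems(3) by simp
  ultimately show ?case by (simp only: run.simps)
next
  case (Cons s w)
  obtain i where s: "s = (i, Suc i)" "1 \<le> i" "Suc i \<le> n" "f (Suc i) < f i"
    using Cons.prems(3) descents_cases[of s n f] by (auto split: if_splits)
  let ?t = "adjacent_transposition i"
  have run: "run (descents n) swap_at w (swap_at s f) = Some f'" using Cons.prems(3) by (simp split: if_splits)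
  have "run (descents n) swap_at w (swap_at s h) = Some (swap_at s h \<circ> inv (swap_at s f) \<circ> f')"
  proof (rule Cons.IH[OF _ _ run])
    show "swap_at s f permutes {1..n}" "swap_at s h permutes {1..n}"
      using swap_at_permutes Cons.prems(1,2) s by auto
    fix a b assume ab: "1 \<le> a" "a < b" "b \<le> n" "swap_at s f b < swap_at s f a"
    then have "a \<noteq> i \<or> b \<noteq> Suc i" using s by (auto simp: swap_at_def)
    then have "?t a < ?t b" using adjacent_transposition_less ab by blast
    moreover have "?t a \<in> {1..n}" "?t b \<in> {1..n}"
      using permutes_in_image[OF adjacent_transposition_permutes] ab s by auto
    ultimately show "swap_at s h b < swap_at s h a"
      using Cons.prems(4)[of "?t a" "?t b"] ab(4) s by (simp add: swap_at_def)
  qed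
  moreover have "s \<in> descents n h" using Cons.prems(4)[of i "Suc i"] s by (simp add: mem_descents_iff)
  moreover have "swap_at s h \<circ> inv (swap_at s f) = h \<circ> inv f"
    using inv_swap_at[OF Cons.prems(1)] by (simp add: s swap_at_def fun_eq_iff)
  ultimately show ?case by (simp only: run.simps if_True)
qed

lemma run_descents_reversed_inv:
  assumes "f permutes {1..n}" "run (descents n) swap_at w f = Some id"
  shows "run (descents n) swap_at w (reversal n) = Some (reversed_inv n f)"
  using run_descents_inversions_subset[OF assms(1) reversal_permutes assms(2)]
  by (simp add: reversal_less_iff reversed_inv_def)

lemma mem_descents_reversed_inv_iff:
  assumes "f permutes {1..n}"
  shows "(i, j) \<in> descents n (reversed_inv n f) \<longleftrightarrow> j = Suc i \<and> 1 \<le> i \<and> Suc i \<le> n \<and> inv f i < inv f (Suc i)"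
proof -
  have "inv f a \<in> {1..n}" if "1 \<le> a" "a \<le> n" for a
    using permutes_in_image[OF permutes_inv[OF assms], of a] that by simp
  then have "reversal n (inv f (Suc i)) < reversal n (inv f i) \<longleftrightarrow> inv f i < inv f (Suc i)" if "1 \<le> i" "Suc i \<le> n"
    using that by (intro reversal_less_iff) auto
  then show ?thesis by (auto simp: reversed_inv_def mem_descents_iff)
qed

lemma descents_reversed_inv_swap_at_reversal:
  assumes i: "1 \<le> i" "Suc i \<le> n"
    and ab: "(a, b) \<in> descents n (reversed_inv n (swap_at (i, Suc i) (reversal n)))"
  shows "a = n - i"
proof -
  let ?t = "adjacent_transposition i"
  have "inv (swap_at (i, Suc i) (reversal n)) = ?t \<circ> reversal n"
    using inv_swap_at[OF reversal_permutes] by (simp add: inv_reversal)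
  then have a: "1 \<le> a" "Suc a \<le> n" "?t (reversal n a) < ?t (reversal n (Suc a))"
    using ab mem_descents_reversed_inv_iff[OF swap_at_permutes[OF reversal_permutes i]] by auto
  then have "reversal n a = Suc (n - a)" "reversal n (Suc a) = n - a" by (auto simp: reversal_def)
  then have "n - a = i" using a(3) adjacent_transposition_less[of "n - a" "Suc (n - a)" i] by force
  then show ?thesis using a by simp
qed

lemma descents_reversed_inv_disjoint:
  assumes s: "s \<in> gens Artin n" and t: "t \<in> gens Artin n"
    and "descents n (reversed_inv n (swap_at s (reversal n))) \<inter> descents n (reversed_inv n (swap_at t (reversal n))) \<noteq> {}"
  shows "s = t"
proof -
  obtain i where i: "s = (i, Suc i)" "1 \<le> i" "Suc i \<le> n" using s by (rule gens_Artin_cases)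
  obtain j where j: "t = (j, Suc j)" "1 \<le> j" "Suc j \<le> n" using t by (rule gens_Artin_cases)
  obtain a b where "(a, b) \<in> descents n (reversed_inv n (swap_at s (reversal n)))"
    "(a, b) \<in> descents n (reversed_inv n (swap_at t (reversal n)))" using assms(3) by auto
  then have "n - i = n - j"
    using descents_reversed_inv_swap_at_reversal[OF i(2,3)] descents_reversed_inv_swap_at_reversal[OF j(2,3)] i j
    by simp
  then show ?thesis using i j by simp
qed

lemma simple_automaton_permutations:
  "simple_automaton Artin n (perms n) (descents n) swap_at id (reversal n) (descent_rank n) (reversed_inv n)"
proof
  show "id \<in> perms n" "reversal n \<in> perms n" using permutes_id reversal_permutes by auto
next
  fix s t u v f assume "(s # u, t # v) \<in> rels Artin n" "s \<in> descents n f" "t \<in> descents n f"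
  then show "run (descents n) swap_at (s # u) f \<noteq> None" by (rule run_descents_rels_defined)
next
  fix s f assume f: "f \<in> perms n" and s: "s \<in> descents n f"
  obtain i where "s = (i, Suc i)" "1 \<le> i" "Suc i \<le> n" using s by (rule descents_cases)
  then show "swap_at s f \<in> perms n" using swap_at_permutes f by simp
next
  fix s f assume "f \<in> perms n" "s \<in> gens Artin n" "descents n f \<subseteq> descents n (swap_at s (reversal n))"
  then show "\<exists>h\<in>perms n. s \<in> descents n h \<and> swap_at s h = f" using descent_multiple_exists by simp
qed (simp_all add: descents_subset descent_rank_swap_at_less descents_empty_iff descents_reversal
    descents_full_imp_reversal run_descents_rels descents_connected run_descents_reversed_inv
    descents_reversed_inv_disjoint del: run.simps One_nat_def)

lemma lattice_automaton_permutations: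
  "lattice_automaton Artin n (perms n) (descents n) swap_at id (reversal n) (descent_rank n) (reversed_inv n)"
proof -
  interpret simple_automaton Artin n "perms n" "descents n" swap_at id "reversal n" "descent_rank n" "reversed_inv n"
    by (rule simple_automaton_permutations)
  show ?thesis
  proof
    fix s t assume st: "s \<in> \<Sigma>" "t \<in> \<Sigma>"
    show "\<exists>j\<in>perms n. s \<in> descents n j \<and> t \<in> descents n j \<and>
        (\<forall>x\<in>perms n. s \<in> descents n x \<longrightarrow> t \<in> descents n x \<longrightarrow> below j x)"
    proof (cases "s = t")
      case True
      then show ?thesis using gen_state[OF st(1)] by blast
    next
      case False
      then obtain u v where "(s # u, t # v) \<in> rels Artin n" using rels_Artin_exists st by blast
      then show ?thesis using rels_state by blast
    qed
  qed
qed

subsection \<open>Irreducibility of the positive braid monoid\<close>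

abbreviation permutation_arrows :: "nat \<Rightarrow> ((nat \<Rightarrow> nat) \<times> (nat \<Rightarrow> nat)) set" where
  "permutation_arrows n \<equiv> state_arrows (perms n) (descents n) (reversed_inv n)"

lemma permutation_arrowsI:
  assumes "f permutes {1..n}" "h permutes {1..n}" "inv f = f'"
    and "\<And>i. 1 \<le> i \<Longrightarrow> Suc i \<le> n \<Longrightarrow> h (Suc i) < h i \<Longrightarrow> f' (Suc i) < f' i"
  shows "(f, h) \<in> permutation_arrows n"
proof -
  have "descents n h \<inter> descents n (reversed_inv n f) = {}"
  proof (rule equals0I)
    fix s assume "s \<in> descents n h \<inter> descents n (reversed_inv n f)"
    then obtain i where "1 \<le> i" "Suc i \<le> n" "h (Suc i) < h i" "f' i < f' (Suc i)"
      using mem_descents_reversed_inv_iff[OF assms(1)] unfolding assms(3) by (auto elim: descents_cases)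
    then show False using assms(4)[of i] by simp
  qed
  then show ?thesis using assms(1,2) unfolding state_arrows_def by simp
qed

lemma permutation_arrows_adjacent:
  assumes "1 \<le> i" "Suc i \<le> n" "1 \<le> j" "Suc j \<le> n" "j = Suc i \<or> i = Suc j"
  shows "(adjacent_transposition i, adjacent_transposition j) \<in> (permutation_arrows n)\<^sup>*"
proof -
  let ?t = adjacent_transposition
  have t: "?t i permutes {1..n}" "?t j permutes {1..n}" using adjacent_transposition_permutes assms by auto
  have tt: "?t j \<circ> ?t i permutes {1..n}" using permutes_compose[OF t] .
  have inv: "inv (?t j \<circ> ?t i) = ?t i \<circ> ?t j" by (simp add: o_inv_distrib inv_transpose_eq)
  have "(?t i, ?t j \<circ> ?t i) \<in> permutation_arrows n"
    by (rule permutation_arrowsI[OF t(1) tt inv_transpose_eq])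
      (use assms in \<open>auto simp: Transposition.transpose_def split: if_splits\<close>)
  moreover have "(?t j \<circ> ?t i, ?t j) \<in> permutation_arrows n"
    by (rule permutation_arrowsI[OF tt t(2) inv])
      (use assms in \<open>auto simp: Transposition.transpose_def split: if_splits\<close>)
  ultimately show ?thesis by (meson converse_rtrancl_into_rtrancl r_into_rtrancl)
qed

lemma permutation_arrows_transpositions:
  assumes "1 \<le> i" "Suc i \<le> n" "1 \<le> j" "Suc j \<le> n"
  shows "(adjacent_transposition i, adjacent_transposition j) \<in> (permutation_arrows n)\<^sup>*"
proof (cases "i \<le> j")
  case True
  then show ?thesis using assms
  proof (induction rule: dec_induct)
    case (step m)
    then show ?case using permutation_arrows_adjacent[of m n "Suc m"] rtrancl_trans by fastforce
  qed simp
next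
  case False
  then have "j \<le> i" by simp
  then show ?thesis using assms
  proof (induction rule: dec_induct)
    case (step m)
    then show ?case using permutation_arrows_adjacent[of "Suc m" n m] rtrancl_trans by fastforce
  qed simp
qed

definition riffle :: "nat \<Rightarrow> nat \<Rightarrow> nat" where
  "riffle n v = (if v < 1 \<or> n < v then v else if v \<le> n div 2 then 2 * v else 2 * (v - n div 2) - 1)"

definition unriffle :: "nat \<Rightarrow> nat \<Rightarrow> nat" where
  "unriffle n v = (if v < 1 \<or> n < v then v else if even v then v div 2 else n div 2 + (v + 1) div 2)"

text \<open>The composition of \<open>riffle\<close> with the reversal of each of its two blocks, and its inverse.\<close>

definition reversed_riffle :: "nat \<Rightarrow> nat \<Rightarrow> nat" where
  "reversed_riffle n v =
    (if v < 1 \<or> n < v then v else if v \<le> n div 2 then 2 * (n div 2 + 1 - v) else 2 * (n + 1 - v) - 1)"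

definition reversed_unriffle :: "nat \<Rightarrow> nat \<Rightarrow> nat" where
  "reversed_unriffle n v =
    (if v < 1 \<or> n < v then v else if even v then n div 2 + 1 - v div 2 else n + 1 - (v + 1) div 2)"

lemma riffle_permutes: "riffle n permutes {1..n}" and inv_riffle: "inv (riffle n) = unriffle n"
proof -
  have inverse: "unriffle n (riffle n v) = v" "riffle n (unriffle n v) = v" for v
    unfolding riffle_def unriffle_def by (auto elim!: evenE oddE)
  have fixed: "riffle n v = v" if "v \<notin> {1..n}" for v using that by (auto simp: riffle_def)
  show "riffle n permutes {1..n}" by (rule permutes_and_inv_eqI(1)[OF fixed inverse])
  show "inv (riffle n) = unriffle n" by (rule permutes_and_inv_eqI(2)[OF fixed inverse])
qed

lemma reversed_unriffle_permutes: "reversed_unriffle n permutes {1..n}"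
  and inv_reversed_unriffle: "inv (reversed_unriffle n) = reversed_riffle n"
proof -
  have inverse: "reversed_riffle n (reversed_unriffle n v) = v"
    "reversed_unriffle n (reversed_riffle n v) = v" for v
    unfolding reversed_riffle_def reversed_unriffle_def by (auto elim!: evenE oddE)
  have fixed: "reversed_unriffle n v = v" if "v \<notin> {1..n}" for v using that by (auto simp: reversed_unriffle_def)
  show "reversed_unriffle n permutes {1..n}" by (rule permutes_and_inv_eqI(1)[OF fixed inverse])
  show "inv (reversed_unriffle n) = reversed_riffle n" by (rule permutes_and_inv_eqI(2)[OF fixed inverse])
qed

lemma permutation_arrows_reversed_unriffle:
  assumes n: "2 \<le> n"
  shows "(adjacent_transposition (n div 2), reversed_unriffle n) \<in> (permutation_arrows n)\<^sup>*"
proof -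
  have m: "1 \<le> n div 2" "Suc (n div 2) \<le> n" using n by auto
  have "(adjacent_transposition (n div 2), riffle n) \<in> permutation_arrows n"
  proof (rule permutation_arrowsI[OF adjacent_transposition_permutes[OF m] riffle_permutes inv_transpose_eq])
    fix i assume "1 \<le> i" "Suc i \<le> n" "riffle n (Suc i) < riffle n i"
    then have "i = n div 2" by (auto simp: riffle_def split: if_splits)
    then show "adjacent_transposition (n div 2) (Suc i) < adjacent_transposition (n div 2) i" by simp
  qed
  moreover have "(riffle n, reversed_unriffle n) \<in> permutation_arrows n"
  proof (rule permutation_arrowsI[OF riffle_permutes reversed_unriffle_permutes inv_riffle])
    fix i assume i: "1 \<le> i" "Suc i \<le> n" "reversed_unriffle n (Suc i) < reversed_unriffle n i"
    then have "odd i" by (auto simp: reversed_unriffle_def elim!: evenE split: if_splits)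
    then show "unriffle n (Suc i) < unriffle n i" using i by (auto simp: unriffle_def elim!: oddE)
  qed
  ultimately show ?thesis by (meson converse_rtrancl_into_rtrancl r_into_rtrancl)
qed

lemma card_descents_reversed_unriffle: "card (descents n (reversed_inv n (reversed_unriffle n))) \<le> 1"
proof -
  have "descents n (reversed_inv n (reversed_unriffle n)) \<subseteq> {(n div 2, Suc (n div 2))}"
  proof
    fix s assume "s \<in> descents n (reversed_inv n (reversed_unriffle n))"
    then obtain i where i: "s = (i, Suc i)" "1 \<le> i" "Suc i \<le> n" "reversed_riffle n i < reversed_riffle n (Suc i)"
      by (cases s) (auto simp: mem_descents_reversed_inv_iff[OF reversed_unriffle_permutes] inv_reversed_unriffle)
    then have "i = n div 2" unfolding reversed_riffle_def by (auto split: if_splits)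
    then show "s \<in> {(n div 2, Suc (n div 2))}" using i by simp
  qed
  then show ?thesis using card_mono[of "{(n div 2, Suc (n div 2))}"] by fastforce
qed

lemma irreducible_garside_Artin: assumes n: "2 \<le> n" shows "irreducible_garside Artin n"
proof -
  interpret lattice_automaton Artin n "perms n" "descents n" swap_at id "reversal n" "descent_rank n" "reversed_inv n"
    by (rule lattice_automaton_permutations)
  show ?thesis
  proof (rule irreducible_garsideI)
    have "(1, 2) \<in> \<Sigma>" using n by (simp add: mem_gens_Artin_iff)
    then show "\<Sigma> \<noteq> {}" by blast
    fix s assume "s \<in> \<Sigma>"
    then obtain i where i: "s = (i, Suc i)" "1 \<le> i" "Suc i \<le> n" by (rule gens_Artin_cases)
    have "(adjacent_transposition i, reversed_unriffle n) \<in> (permutation_arrows n)\<^sup>*"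
      using permutation_arrows_transpositions[of i n "n div 2"] permutation_arrows_reversed_unriffle[OF n] i n
        rtrancl_trans by fastforce
    moreover have "adjacent_transposition i \<in> perms n" using adjacent_transposition_permutes i by simp
    moreover have "run (descents n) swap_at [s] (adjacent_transposition i) = Some id"
      using i by (auto simp: mem_descents_iff swap_at_def fun_eq_iff)
    ultimately show "\<exists>x z. x \<in> perms n \<and> run (descents n) swap_at [s] x = Some id \<and>
        (x, z) \<in> (permutation_arrows n)\<^sup>* \<and> card (descents n (reversed_inv n z)) \<le> 1"
      using card_descents_reversed_unriffle by blast
  qed
qed

section \<open>The dual braid monoid\<close>

lemma mem_gens_Dual_iff: "(i, j) \<in> gens Dual n \<longleftrightarrow> 1 \<le> i \<and> i < j \<and> j \<le> n"
  by (auto simp: gens_def)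

lemma sg_less: "a < b \<Longrightarrow> sg a b = (a, b)" "a < b \<Longrightarrow> sg b a = (a, b)"
  by (auto simp: sg_def)

lemma rels_Dual_cases [consumes 1, case_names triangle_left triangle_right commutation]:
  assumes "(u, v) \<in> rels Dual n"
  obtains i j l where "u = [(i, j), (j, l)]" "v = [(j, l), (i, l)]" "1 \<le> i" "i < j" "j < l" "l \<le> n"
    | i j l where "u = [(j, l), (i, l)]" "v = [(i, l), (i, j)]" "1 \<le> i" "i < j" "j < l" "l \<le> n"
    | i j l m where "u = [(i, j), (l, m)]" "v = [(l, m), (i, j)]" "i < j" "l < m" "j < l \<or> i < l \<and> m < j"
  using assms unfolding rels_def mkind.case
proof (elim UnE)
  assume "(u, v) \<in> {([sg i j, sg j k], [sg j k, sg k i]) | i j k. 1 \<le> i \<and> i < j \<and> j < k \<and> k \<le> n}"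
  then show thesis using that(1) sg_less by fastforce
next
  assume "(u, v) \<in> {([sg j k, sg k i], [sg k i, sg i j]) | i j k. 1 \<le> i \<and> i < j \<and> j < k \<and> k \<le> n}"
  then show thesis using that(2) sg_less by fastforce
next
  assume "(u, v) \<in> {([sg i j, sg k l], [sg k l, sg i j]) | i j k l.
          1 \<le> i \<and> i < j \<and> j \<le> n \<and> 1 \<le> k \<and> k < l \<and> l \<le> n \<and>
          ((i < j \<and> j < k \<and> k < l) \<or> (i < k \<and> k < l \<and> l < j))}"
  then show thesis using that(3) sg_less by fastforce
qed

lemma rels_Dual_triangle:
  assumes "1 \<le> i" "i < j" "j < l" "l \<le> n"
  shows "([(i, j), (j, l)], [(j, l), (i, l)]) \<in> rels Dual n"
    and "([(j, l), (i, l)], [(i, l), (i, j)]) \<in> rels Dual n"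
proof -
  have sg: "(i, j) = sg i j" "(j, l) = sg j l" "(i, l) = sg l i" using sg_less assms by auto
  show "([(i, j), (j, l)], [(j, l), (i, l)]) \<in> rels Dual n" "([(j, l), (i, l)], [(i, l), (i, j)]) \<in> rels Dual n"
    unfolding rels_def mkind.case sg using assms by blast+
qed

lemma rels_Dual_commutation:
  assumes "1 \<le> i" "i < j" "j \<le> n" "1 \<le> l" "l < m" "m \<le> n" "j < l \<or> i < l \<and> m < j"
  shows "([(i, j), (l, m)], [(l, m), (i, j)]) \<in> rels Dual n"
proof -
  have sg: "(i, j) = sg i j" "(l, m) = sg l m" using sg_less assms by auto
  show ?thesis unfolding rels_def mkind.case sg using assms by blast
qed

subsection \<open>Noncrossing partitions\<close>

text \<open>A simple element is represented by the set of pairs \<open>(i, j)\<close> with \<open>i < j\<close> in a common block of its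
  noncrossing partition of the cyclically ordered points \<open>1, \<dots>, n\<close>. The chord \<open>s\<close> is compatible with \<open>t\<close> if it
  does not cross the chord obtained from \<open>t\<close> by replacing each endpoint \<open>a\<close> by the midpoint of \<open>a\<close> and
  \<open>a + 1\<close>. The noncrossing partitions are the closed sets of this Galois connection, and their Kreweras
  complements are given by the polar sets.\<close>

fun compatible :: "gen \<Rightarrow> gen \<Rightarrow> bool" where
  "compatible (u, v) (x, y) \<longleftrightarrow> ((u \<le> x \<longleftrightarrow> v \<le> x) \<longleftrightarrow> (u \<le> y \<longleftrightarrow> v \<le> y))"

definition left_polar :: "nat \<Rightarrow> gen set \<Rightarrow> gen set" where
  "left_polar n Y = {s \<in> gens Dual n. \<forall>t\<in>Y. compatible s t}"

definition kreweras :: "nat \<Rightarrow> gen set \<Rightarrow> gen set" where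
  "kreweras n X = {t \<in> gens Dual n. \<forall>s\<in>X. compatible s t}"

definition noncrossing :: "nat \<Rightarrow> gen set set" where
  "noncrossing n = {X. \<exists>Y \<subseteq> gens Dual n. X = left_polar n Y}"

definition cut_at :: "gen \<Rightarrow> gen set \<Rightarrow> gen set" where "cut_at s X = {t \<in> X. compatible s t}"

definition joined :: "gen set \<Rightarrow> nat \<Rightarrow> nat \<Rightarrow> bool" where
  "joined X a b \<longleftrightarrow> a = b \<or> (a, b) \<in> X \<or> (b, a) \<in> X"

definition rotate_chord :: "nat \<Rightarrow> gen \<Rightarrow> gen" where
  "rotate_chord n s = (if fst s = 1 then (snd s - 1, n) else (fst s - 1, snd s - 1))"

lemma compatible_refl [simp]: "compatible (a, a) t" "compatible s (x, x)"
  by (cases t; cases s; simp)+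

lemma compatible_sym: "compatible (a, b) t \<Longrightarrow> compatible (b, a) t" "compatible s (x, y) \<Longrightarrow> compatible s (y, x)"
  by (cases t; cases s; auto)+

lemma compatible_trans: "compatible (a, b) t \<Longrightarrow> compatible (b, c) t \<Longrightarrow> compatible (a, c) t"
  "compatible s (x, y) \<Longrightarrow> compatible s (y, z) \<Longrightarrow> compatible s (x, z)"
  by (cases t; cases s; auto)+

lemma compatible_crossing:
  "i < j \<Longrightarrow> j < k \<Longrightarrow> k < l \<Longrightarrow> compatible (i, k) t \<Longrightarrow> compatible (j, l) t \<Longrightarrow> compatible (i, j) t"
  by (cases t) auto

lemma equivp_compatible: "equivp (\<lambda>a b. compatible (a, b) t)" "equivp (\<lambda>x y. compatible s (x, y))"
  by (intro equivpI reflpI sympI transpI compatible_refl; blast intro: compatible_sym compatible_trans)+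

lemma not_compatible_self: "s \<in> gens Dual n \<Longrightarrow> \<not> compatible s s"
  by (cases s) (auto simp: mem_gens_Dual_iff)

lemma compatible_iff_sides: "i < j \<Longrightarrow> compatible (i, j) (a, b) \<longleftrightarrow> (a \<in> {i..<j} \<longleftrightarrow> b \<in> {i..<j})"
  by auto

lemma rotate_chord_closed: "s \<in> gens Dual n \<Longrightarrow> rotate_chord n s \<in> gens Dual n"
  by (cases s) (auto simp: rotate_chord_def mem_gens_Dual_iff)

lemma rotate_chord_inj: "s \<in> gens Dual n \<Longrightarrow> t \<in> gens Dual n \<Longrightarrow> rotate_chord n s = rotate_chord n t \<Longrightarrow> s = t"
  by (cases s; cases t) (auto simp: rotate_chord_def mem_gens_Dual_iff split: if_splits)

lemma rotate_chord_surj: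
  assumes "t \<in> gens Dual n" obtains s where "s \<in> gens Dual n" "t = rotate_chord n s"
proof -
  obtain x y where t: "t = (x, y)" by (cases t)
  show thesis
  proof (cases "y = n")
    case True
    then show thesis using that[of "(1, x + 1)"] assms t by (auto simp: rotate_chord_def mem_gens_Dual_iff)
  next
    case False
    then show thesis using that[of "(x + 1, y + 1)"] assms t by (auto simp: rotate_chord_def mem_gens_Dual_iff)
  qed
qed

lemma compatible_iff_rotated_sides:
  assumes s: "s \<in> gens Dual n" and ij: "rotate_chord n s = (i, j)" and ab: "a \<in> {1..n}" "b \<in> {1..n}"
  shows "compatible s (a, b) \<longleftrightarrow> (a \<in> {i<..j} \<longleftrightarrow> b \<in> {i<..j})"
proof -
  obtain u v where uv: "s = (u, v)" "1 \<le> u" "u < v" "v \<le> n" using s by (cases s) (auto simp: mem_gens_Dual_iff)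
  show ?thesis
  proof (cases "u = 1")
    case True
    then have "i = v - 1" "j = n" using ij uv unfolding rotate_chord_def by auto
    then have "x \<in> {i<..j} \<longleftrightarrow> (u \<le> x \<longleftrightarrow> v \<le> x)" if "x \<in> {1..n}" for x using that uv True by auto
    then show ?thesis using uv(1) ab by simp
  next
    case False
    then have "i = u - 1" "j = v - 1" using ij uv unfolding rotate_chord_def by auto
    then have sides: "x \<in> {i<..j} \<longleftrightarrow> \<not> (u \<le> x \<longleftrightarrow> v \<le> x)" for x using uv by auto
    show ?thesis unfolding uv(1) compatible.simps sides by argo
  qed
qed

lemma compatible_rotate_chord:
  assumes s: "s \<in> gens Dual n" and r: "r \<in> gens Dual n"
  shows "compatible r (rotate_chord n s) \<longleftrightarrow> compatible s r"
proof -
  obtain i j where ij: "rotate_chord n s = (i, j)" by (cases "rotate_chord n s")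
  obtain a b where ab: "r = (a, b)" by (cases r)
  have "a \<in> {1..n}" "b \<in> {1..n}" using r unfolding ab mem_gens_Dual_iff by auto
  then have "compatible s r \<longleftrightarrow> (a \<in> {i<..j} \<longleftrightarrow> b \<in> {i<..j})"
    using compatible_iff_rotated_sides[OF s ij] unfolding ab by blast
  moreover have "i < j" using rotate_chord_closed[OF s] unfolding ij mem_gens_Dual_iff by simp
  then have sides: "x \<in> {i<..j} \<longleftrightarrow> \<not> (x \<le> i \<longleftrightarrow> x \<le> j)" for x by auto
  ultimately show ?thesis unfolding ij ab compatible.simps sides by argo
qed

lemma noncrossingI: "Y \<subseteq> gens Dual n \<Longrightarrow> X = left_polar n Y \<Longrightarrow> X \<in> noncrossing n"
  unfolding noncrossing_def by blast

lemma noncrossing_subset: "X \<in> noncrossing n \<Longrightarrow> X \<subseteq> gens Dual n"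
  unfolding noncrossing_def left_polar_def by blast

lemma left_polar_kreweras: assumes "X \<in> noncrossing n" shows "left_polar n (kreweras n X) = X"
proof -
  obtain Y where Y: "Y \<subseteq> gens Dual n" "X = left_polar n Y" using assms unfolding noncrossing_def by blast
  then have "Y \<subseteq> kreweras n X" unfolding kreweras_def left_polar_def by blast
  then show ?thesis using Y(2) unfolding kreweras_def left_polar_def by blast
qed

lemma kreweras_antimono: "X \<subseteq> Y \<Longrightarrow> kreweras n Y \<subseteq> kreweras n X"
  and left_polar_antimono: "X \<subseteq> Y \<Longrightarrow> left_polar n Y \<subseteq> left_polar n X"
  unfolding kreweras_def left_polar_def by blast+

lemma left_polar_kreweras_noncrossing: "left_polar n (kreweras n X) \<in> noncrossing n"
  by (rule noncrossingI[OF _ refl]) (auto simp: kreweras_def)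

lemma kreweras_noncrossing: assumes "X \<subseteq> gens Dual n" shows "kreweras n X \<in> noncrossing n"
proof (rule noncrossingI)
  show "rotate_chord n ` X \<subseteq> gens Dual n" using rotate_chord_closed assms by blast
  show "kreweras n X = left_polar n (rotate_chord n ` X)"
    unfolding kreweras_def left_polar_def using compatible_rotate_chord assms by blast
qed

lemma cut_at_noncrossing: assumes "s \<in> gens Dual n" "X \<in> noncrossing n" shows "cut_at s X \<in> noncrossing n"
proof -
  obtain Y where Y: "Y \<subseteq> gens Dual n" "X = left_polar n Y" using assms(2) unfolding noncrossing_def by blast
  show ?thesis
  proof (rule noncrossingI)
    show "insert (rotate_chord n s) Y \<subseteq> gens Dual n" using rotate_chord_closed assms Y by blast
    show "cut_at s X = left_polar n (insert (rotate_chord n s) Y)"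
      unfolding cut_at_def Y(2) left_polar_def using compatible_rotate_chord[OF assms(1)] by blast
  qed
qed

lemma gens_noncrossing: "gens Dual n \<in> noncrossing n"
  by (rule noncrossingI[of "{}"]) (auto simp: left_polar_def)

lemma empty_noncrossing: "{} \<in> noncrossing n"
  by (rule noncrossingI[of "gens Dual n"]) (use not_compatible_self in \<open>auto simp: left_polar_def\<close>)

lemma joined_iff_mem:
  assumes "X \<in> noncrossing n" "a < b" shows "joined X a b \<longleftrightarrow> (a, b) \<in> X"
  using noncrossing_subset[OF assms(1)] mem_gens_Dual_iff[of b a n] assms(2) unfolding joined_def by auto

lemma joined_memI: "(a, b) \<in> X \<Longrightarrow> joined X a b"
  unfolding joined_def by blast

lemma joined_range:
  assumes "X \<in> noncrossing n" "joined X a b" "a \<noteq> b" shows "a \<in> {1..n}" "b \<in> {1..n}"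
  using assms noncrossing_subset[OF assms(1)] mem_gens_Dual_iff[of a b n] mem_gens_Dual_iff[of b a n]
  unfolding joined_def by auto

lemma equivp_joined_ball:
  assumes "equivp P" "joined X a b" "\<And>x y. (x, y) \<in> X \<Longrightarrow> P x y" shows "P a b"
  using assms(2,3) equivp_reflp[OF assms(1)] equivp_symp[OF assms(1)] unfolding joined_def by blast

lemma joined_left_polar_iff:
  "joined (left_polar n Y) a b \<longleftrightarrow> a = b \<or> a \<in> {1..n} \<and> b \<in> {1..n} \<and> (\<forall>t\<in>Y. compatible (a, b) t)"
proof -
  have mem: "(a, b) \<in> left_polar n Y \<longleftrightarrow> 1 \<le> a \<and> a < b \<and> b \<le> n \<and> (\<forall>t\<in>Y. compatible (a, b) t)" for a b
    unfolding left_polar_def by (simp add: mem_gens_Dual_iff)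
  have "(\<forall>t\<in>Y. compatible (b, a) t) \<longleftrightarrow> (\<forall>t\<in>Y. compatible (a, b) t)"
    using compatible_sym(1) by blast
  then show ?thesis unfolding joined_def mem by auto
qed

definition noncrossing_equiv :: "(nat \<Rightarrow> nat \<Rightarrow> bool) \<Rightarrow> bool" where
  "noncrossing_equiv r \<longleftrightarrow> equivp r \<and>
    (\<forall>i j k l. i < j \<longrightarrow> j < k \<longrightarrow> k < l \<longrightarrow> r i k \<longrightarrow> r j l \<longrightarrow> r i j)"

lemma noncrossing_equiv_joined: assumes "X \<in> noncrossing n" shows "noncrossing_equiv (joined X)"
proof -
  obtain Y where Y: "X = left_polar n Y" using assms unfolding noncrossing_def by blast
  have "equivp (joined X)"
    unfolding Y joined_left_polar_iff
    by (intro equivpI reflpI sympI transpI) (auto intro: compatible_sym compatible_trans)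
  moreover have "joined X i j" if "i < j" "j < k" "k < l" "joined X i k" "joined X j l" for i j k l
    using that compatible_crossing[OF that(1-3)] unfolding Y joined_left_polar_iff by auto
  ultimately show ?thesis unfolding noncrossing_equiv_def by blast
qed

lemma equivp_joined: "X \<in> noncrossing n \<Longrightarrow> equivp (joined X)"
  using noncrossing_equiv_joined unfolding noncrossing_equiv_def by blast

lemmas joined_sym = equivp_symp[OF equivp_joined] and joined_trans = equivp_transp[OF equivp_joined]

lemma noncrossing_equiv_separated:
  assumes r: "noncrossing_equiv r" and "r i j" "r a b" "i \<le> a" "a \<le> j" "b \<le> i \<or> j \<le> b"
  shows "r a i"
proof -
  have equiv: "equivp r" and crossing: "\<And>i j k l. i < j \<Longrightarrow> j < k \<Longrightarrow> k < l \<Longrightarrow> r i k \<Longrightarrow> r j l \<Longrightarrow> r i j"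
    using r unfolding noncrossing_equiv_def by blast+
  note sym = equivp_symp[OF equiv] and trans = equivp_transp[OF equiv]
  consider "a = i" | "a = j" | "b = i" | "b = j" | "i < a" "a < j" "b < i" | "i < a" "a < j" "j < b"
    using assms by linarith
  then show ?thesis
  proof cases
    case 5
    then show ?thesis using crossing[of b i a j] assms sym trans by blast
  next
    case 6
    then show ?thesis using crossing[of i a j b] assms sym by blast
  qed (use assms equivp_reflp[OF equiv] sym trans in blast)+
qed

lemma noncrossing_equiv_sides:
  assumes r: "noncrossing_equiv r" "r i j" and "i < j" and B: "B = {i..<j} \<or> B = {i<..j}"
    and P: "equivp P" "P i j" and sides: "\<And>a b. r a b \<Longrightarrow> (a \<in> B \<longleftrightarrow> b \<in> B) \<Longrightarrow> P a b"
    and "r a b"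
  shows "P a b"
proof -
  note P_sym = equivp_symp[OF P(1)] and P_trans = equivp_transp[OF P(1)]
  have equiv: "equivp r" using r(1) unfolding noncrossing_equiv_def by blast
  note r_sym = equivp_symp[OF equiv] and r_trans = equivp_transp[OF equiv]
  have separated: "P a b" if "r a b" "a \<in> B" "b \<notin> B" for a b
  proof -
    have "i \<le> a" "a \<le> j" "b \<le> i \<or> j \<le> b" using that(2,3) B by auto
    then have ai: "r a i" using noncrossing_equiv_separated[OF r] that(1) by blast
    then have bi: "r b i" and aj: "r a j" and bj: "r b j" using r(2) that(1) r_sym r_trans by blast+
    show ?thesis using B
    proof
      assume "B = {i..<j}"
      then have "P a i" "P b j" using sides[OF ai] sides[OF bj] that assms(3) by auto
      then show ?thesis using P(2) P_sym P_trans by blast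
    next
      assume "B = {i<..j}"
      then have "P a j" "P b i" using sides[OF aj] sides[OF bi] that assms(3) by auto
      then show ?thesis using P(2) P_sym P_trans by blast
    qed
  qed
  show ?thesis
    using sides[OF assms(8)] separated[OF assms(8)] separated[OF r_sym[OF assms(8)]] P_sym by blast
qed

lemma noncrossing_cut_induct:
  assumes X: "X \<in> noncrossing n" and s: "(i, j) \<in> X" and P: "equivp P" "P i j"
    and cut: "\<And>a b. (a, b) \<in> cut_at (i, j) X \<Longrightarrow> P a b" and "(a, b) \<in> X"
  shows "P a b"
proof (rule noncrossing_equiv_sides[OF noncrossing_equiv_joined[OF X] _ _ _ P])
  show "joined X i j" "joined X a b" using s assms(6) by (auto intro: joined_memI)
  show "i < j" using noncrossing_subset[OF X] s mem_gens_Dual_iff by blast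
  then have "joined (cut_at (i, j) X) a b" if "joined X a b" "a \<in> {i..<j} \<longleftrightarrow> b \<in> {i..<j}" for a b
    using that compatible_iff_sides unfolding joined_def cut_at_def by blast
  then show "P a b" if "joined X a b" "a \<in> {i..<j} \<longleftrightarrow> b \<in> {i..<j}" for a b
    using equivp_joined_ball[OF P(1) _ cut] that by blast
qed simp

lemma compatible_kreweras_if_cut:
  assumes X: "X \<subseteq> gens Dual n" and s: "s \<in> gens Dual n" "X \<subseteq> cut_at s (gens Dual n)"
    and r: "compatible s r" "r \<in> gens Dual n"
    and cut: "\<And>t. t \<in> cut_at s (kreweras n X) \<Longrightarrow> compatible r t" and t: "t \<in> kreweras n X"
  shows "compatible r t"
proof -
  obtain i j where ij: "rotate_chord n s = (i, j)" by (cases "rotate_chord n s")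
  obtain a b where ab: "t = (a, b)" by (cases t)
  have K: "kreweras n X \<in> noncrossing n" using kreweras_noncrossing[OF X] .
  have "compatible x (i, j)" if "x \<in> X" for x
    using compatible_rotate_chord[OF s(1), of x] that s(2) X unfolding ij cut_at_def by auto
  then have sK: "(i, j) \<in> kreweras n X" using rotate_chord_closed[OF s(1)] unfolding kreweras_def ij by blast
  have "compatible r (a, b)"
  proof (rule noncrossing_equiv_sides[OF noncrossing_equiv_joined[OF K] _ _ _ equivp_compatible(2)])
    show "joined (kreweras n X) i j" "joined (kreweras n X) a b" using sK t ab by (auto intro: joined_memI)
    show "i < j" using rotate_chord_closed[OF s(1)] unfolding ij mem_gens_Dual_iff by blast
    show "compatible r (i, j)" using compatible_rotate_chord[OF s(1) r(2)] r(1) ij by simp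
    fix a b assume "joined (kreweras n X) a b" "a \<in> {i<..j} \<longleftrightarrow> b \<in> {i<..j}"
    then have "joined (cut_at s (kreweras n X)) a b"
      using compatible_iff_rotated_sides[OF s(1) ij] joined_range[OF K] compatible_sym(2)
      unfolding joined_def cut_at_def by blast
    then show "compatible r (a, b)" using equivp_joined_ball[OF equivp_compatible(2)] cut by blast
  qed simp
  then show ?thesis using ab by simp
qed

lemma noncrossing_multiple_exists:
  assumes X: "X \<in> noncrossing n" and s: "s \<in> gens Dual n" "X \<subseteq> cut_at s (gens Dual n)"
  shows "\<exists>Y\<in>noncrossing n. s \<in> Y \<and> cut_at s Y = X"
proof (intro bexI conjI)
  let ?Y = "left_polar n (cut_at s (kreweras n X))"
  show "?Y \<in> noncrossing n" by (rule noncrossingI[OF _ refl]) (auto simp: cut_at_def kreweras_def)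
  show "s \<in> ?Y" using s(1) unfolding left_polar_def cut_at_def by blast
  have "r \<in> left_polar n (kreweras n X)" if "r \<in> cut_at s ?Y" for r
    using that compatible_kreweras_if_cut[OF noncrossing_subset[OF X] s]
    unfolding left_polar_def cut_at_def by blast
  then have "cut_at s ?Y \<subseteq> X" using left_polar_kreweras[OF X] by blast
  moreover have "X \<subseteq> cut_at s ?Y"
    using s(2) noncrossing_subset[OF X] unfolding left_polar_def cut_at_def kreweras_def by blast
  ultimately show "cut_at s ?Y = X" by blast
qed

lemma singleton_noncrossing: assumes s: "s \<in> gens Dual n" shows "{s} \<in> noncrossing n"
proof -
  obtain Y where Y: "Y \<in> noncrossing n" "s \<in> Y" "cut_at s Y = {}"
    using noncrossing_multiple_exists[OF empty_noncrossing s] by blast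
  obtain i j where ij: "s = (i, j)" by (cases s)
  define merge where "merge x = (if x = j then i else x)" for x
  have "(a, b) = s" if "(a, b) \<in> Y" for a b
  proof -
    have "equivp (\<lambda>a b. merge a = merge b)" by (intro equivpI reflpI sympI transpI) auto
    then have "merge a = merge b"
      using noncrossing_cut_induct[OF Y(1), of i j "\<lambda>a b. merge a = merge b" a b] Y(2,3) that ij
      by (simp add: merge_def)
    moreover have "i < j" "a < b" using noncrossing_subset[OF Y(1)] Y(2) ij that mem_gens_Dual_iff by blast+
    ultimately show ?thesis unfolding ij merge_def by (auto split: if_splits)
  qed
  then have "Y = {s}" using Y(2) by auto
  then show ?thesis using Y(1) by simp
qed

lemma kreweras_cut_gens:
  assumes s: "s \<in> gens Dual n" and t: "t \<in> kreweras n (cut_at s (gens Dual n))"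
  shows "t = rotate_chord n s"
proof -
  have "t \<in> gens Dual n" using t unfolding kreweras_def by blast
  then obtain r where r: "r \<in> gens Dual n" "t = rotate_chord n r" by (rule rotate_chord_surj)
  have "compatible r x" if "x \<in> gens Dual n" "compatible s x" for x
    using t that compatible_rotate_chord[OF r(1)] r(2) unfolding kreweras_def cut_at_def by blast
  then have "r \<in> left_polar n (kreweras n {s})" using r(1) unfolding left_polar_def kreweras_def by blast
  then have "r = s" using left_polar_kreweras[OF singleton_noncrossing[OF s]] by blast
  then show ?thesis using r(2) by simp
qed

subsection \<open>The automaton of noncrossing partitions\<close>

abbreviation "run_cut \<equiv> run (\<lambda>X. X) cut_at"

lemma run_cut_mono:
  "run_cut w X = Some Y \<Longrightarrow> X \<subseteq> X' \<Longrightarrow> run_cut w X' = Some {t \<in> X'. \<forall>s\<in>set w. compatible s t}"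
proof (induction w arbitrary: X X')
  case (Cons s w)
  have s: "s \<in> X" "run_cut w (cut_at s X) = Some Y" using Cons.prems by (auto split: if_splits)
  have "cut_at s X \<subseteq> cut_at s X'" using Cons.prems unfolding cut_at_def by blast
  then have "run_cut w (cut_at s X') = Some {t \<in> cut_at s X'. \<forall>s\<in>set w. compatible s t}" using Cons.IH s by blast
  moreover have "{t \<in> cut_at s X'. \<forall>s\<in>set w. compatible s t} = {t \<in> X'. \<forall>s\<in>set (s # w). compatible s t}"
    unfolding cut_at_def by auto
  ultimately show ?case using s Cons.prems by auto
qed simp

lemma run_cut_subset: "run_cut w X = Some Y \<Longrightarrow> set w \<subseteq> X"
proof (induction w arbitrary: X)
  case (Cons s w)
  then have "s \<in> X" "set w \<subseteq> cut_at s X" by (auto split: if_splits)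
  then show ?case unfolding cut_at_def by auto
qed simp

lemma run_cut_compatible:
  "X \<in> noncrossing n \<Longrightarrow> run_cut w X = Some {} \<Longrightarrow> \<forall>s\<in>set w. compatible s t \<Longrightarrow> r \<in> X \<Longrightarrow> compatible r t"
proof (induction w arbitrary: X r)
  case (Cons s w)
  have s: "s \<in> X" "run_cut w (cut_at s X) = Some {}" using Cons.prems by (auto split: if_splits)
  obtain i j a b where ij: "s = (i, j)" and ab: "r = (a, b)" by (cases s; cases r)
  have "cut_at s X \<in> noncrossing n" using cut_at_noncrossing noncrossing_subset Cons.prems(1) s(1) by blast
  then have cut: "compatible x t" if "x \<in> cut_at s X" for x using Cons.IH[OF _ s(2)] Cons.prems(3) that by simp
  have "compatible (a, b) t"
  proof (rule noncrossing_cut_induct[OF Cons.prems(1) _ equivp_compatible(1)])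
    show "(i, j) \<in> X" "compatible (i, j) t" "(a, b) \<in> X" using s(1) Cons.prems(3,4) ij ab by simp_all
    show "compatible (a, b) t" if "(a, b) \<in> cut_at (i, j) X" for a b using cut that ij by simp
  qed
  then show ?case using ab by simp
qed simp

lemma run_cut_kreweras:
  assumes X: "X \<in> noncrossing n" and w: "run_cut w X = Some {}"
  shows "run_cut w (gens Dual n) = Some (kreweras n X)"
proof -
  have "{t \<in> gens Dual n. \<forall>s\<in>set w. compatible s t} = kreweras n X"
    using run_cut_compatible[OF X w] run_cut_subset[OF w] unfolding kreweras_def by blast
  then show ?thesis using run_cut_mono[OF w noncrossing_subset[OF X]] by simp
qed

lemma run_cut_two:
  "run_cut [s, t] X =
    (if s \<in> X \<and> t \<in> X \<and> compatible s t then Some {r \<in> X. compatible s r \<and> compatible t r} else None)"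
  by (auto simp: cut_at_def)

lemma run_cut_triangle:
  assumes X: "X \<in> noncrossing n" and lt: "i < j" "j < l"
  shows "run_cut [(i, j), (j, l)] X = run_cut [(j, l), (i, l)] X"
    and "run_cut [(j, l), (i, l)] X = run_cut [(i, l), (i, j)] X"
proof -
  have il: "i < l" using lt by simp
  note mem = joined_iff_mem[OF X lt(1), symmetric] joined_iff_mem[OF X lt(2), symmetric]
    joined_iff_mem[OF X il, symmetric]
  have pairs: "(i, j) \<in> X \<and> (j, l) \<in> X \<longleftrightarrow> (j, l) \<in> X \<and> (i, l) \<in> X"
    "(j, l) \<in> X \<and> (i, l) \<in> X \<longleftrightarrow> (i, l) \<in> X \<and> (i, j) \<in> X"
    unfolding mem using joined_trans[OF X] joined_sym[OF X] by meson+
  have "compatible (i, j) (j, l)" "compatible (j, l) (i, l)" "compatible (i, l) (i, j)" using lt by auto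
  moreover have "compatible (i, j) r \<and> compatible (j, l) r \<longleftrightarrow> compatible (j, l) r \<and> compatible (i, l) r"
    "compatible (j, l) r \<and> compatible (i, l) r \<longleftrightarrow> compatible (i, l) r \<and> compatible (i, j) r" for r
    using compatible_trans(1) compatible_sym(1) by meson+
  ultimately show "run_cut [(i, j), (j, l)] X = run_cut [(j, l), (i, l)] X"
    "run_cut [(j, l), (i, l)] X = run_cut [(i, l), (i, j)] X"
    unfolding run_cut_two using pairs by simp_all
qed

lemma run_cut_rels:
  assumes "(u, v) \<in> rels Dual n" and X: "X \<in> noncrossing n"
  shows "run_cut u X = run_cut v X"
  using assms(1)
proof (cases rule: rels_Dual_cases)
  case (triangle_left i j l)
  show ?thesis
    unfolding triangle_left(1,2) by (rule run_cut_triangle(1)[OF X triangle_left(4,5)])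
next
  case (triangle_right i j l)
  show ?thesis
    unfolding triangle_right(1,2) by (rule run_cut_triangle(2)[OF X triangle_right(4,5)])
next
  case (commutation i j l m)
  then have "compatible (l, m) (i, j)" "compatible (i, j) (l, m)" by auto
  then show ?thesis unfolding commutation(1,2) run_cut_two by auto
qed

lemma run_cut_rels_defined:
  assumes "(s # u, t # v) \<in> rels Dual n" "s \<in> X" "t \<in> X"
  shows "run_cut (s # u) X \<noteq> None"
  using assms by (cases rule: rels_Dual_cases) (auto simp: cut_at_def)

lemma sym_relator_graph: "(s, t) \<in> (relator_graph k n A)\<^sup>* \<Longrightarrow> (t, s) \<in> (relator_graph k n A)\<^sup>*"
proof -
  have "sym (relator_graph k n A)" unfolding relator_graph_def sym_def by blast
  then show "(s, t) \<in> (relator_graph k n A)\<^sup>* \<Longrightarrow> (t, s) \<in> (relator_graph k n A)\<^sup>*"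
    by (blast intro: symD[OF sym_rtrancl])
qed

lemma triangle_connected:
  assumes X: "X \<in> noncrossing n" and lt: "i < j" "j < l" and "joined X i j" "joined X j l"
  shows "((i, j), (j, l)) \<in> (relator_graph Dual n X)\<^sup>*" "((j, l), (i, l)) \<in> (relator_graph Dual n X)\<^sup>*"
    "((i, j), (i, l)) \<in> (relator_graph Dual n X)\<^sup>*"
proof -
  have "joined X i l" using joined_trans[OF X] assms by blast
  then have mem: "(i, j) \<in> X" "(j, l) \<in> X" "(i, l) \<in> X" using joined_iff_mem[OF X] assms by auto
  then have range: "1 \<le> i" "l \<le> n" using noncrossing_subset[OF X] mem_gens_Dual_iff by blast+
  have first: "((i, j), (j, l)) \<in> relator_graph Dual n X"
    using rels_Dual_triangle(1)[OF range(1) lt range(2)] mem unfolding relator_graph_def by blast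
  have second: "((j, l), (i, l)) \<in> relator_graph Dual n X"
    using rels_Dual_triangle(2)[OF range(1) lt range(2)] mem unfolding relator_graph_def by blast
  show "((i, j), (j, l)) \<in> (relator_graph Dual n X)\<^sup>*" "((j, l), (i, l)) \<in> (relator_graph Dual n X)\<^sup>*"
    "((i, j), (i, l)) \<in> (relator_graph Dual n X)\<^sup>*"
    using first second by (auto intro: rtrancl_into_rtrancl)
qed

lemma noncrossing_connected_ordered:
  assumes X: "X \<in> noncrossing n" and s: "(i, j) \<in> X" and t: "(l, m) \<in> X" and "i < l \<or> i = l \<and> j < m"
  shows "((i, j), (l, m)) \<in> (relator_graph Dual n X)\<^sup>*"
proof -
  have lt: "1 \<le> i" "i < j" "j \<le> n" "1 \<le> l" "l < m" "m \<le> n"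
    using noncrossing_subset[OF X] s t mem_gens_Dual_iff by blast+
  have joined: "joined X i j" "joined X l m" using s t by (auto intro: joined_memI)
  note joined_trans = joined_trans[OF X] and joined_sym = joined_sym[OF X]
  consider "i = l" "j < m" | "i < l" "j = m" | "i < l" "j = l" | "i < l" "j < l \<or> m < j" | "i < l" "l < j" "j < m"
    using assms(4) by linarith
  then show ?thesis
  proof cases
    case 1
    then have "joined X j m" using joined_trans joined_sym joined by meson
    then show ?thesis using triangle_connected(3)[OF X, of i j m] 1 lt joined by simp
  next
    case 2
    then have "joined X i l" using joined_trans joined_sym joined by meson
    then show ?thesis using triangle_connected(2)[OF X, of i l m] 2 lt joined sym_relator_graph by simp
  next
    case 3
    then show ?thesis using triangle_connected(1)[OF X, of i j m] lt joined by simp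
  next
    case 4
    then show ?thesis
      using rels_Dual_commutation[of i j n l m] lt s t unfolding relator_graph_def by (intro r_into_rtrancl) auto
  next
    case 5
    have "joined X i l" using noncrossing_equiv_joined[OF X] 5 joined unfolding noncrossing_equiv_def by blast
    moreover from this have "joined X l j" using joined_trans joined_sym joined by meson
    ultimately have "((i, l), (i, j)) \<in> (relator_graph Dual n X)\<^sup>*"
      "((i, l), (l, m)) \<in> (relator_graph Dual n X)\<^sup>*"
      using triangle_connected(3)[OF X, of i l j] triangle_connected(1)[OF X, of i l m] 5 lt joined by auto
    then show ?thesis using sym_relator_graph rtrancl_trans by meson
  qed
qed

lemma noncrossing_connected:
  assumes X: "X \<in> noncrossing n" and s: "s \<in> X" and t: "t \<in> X"
  shows "(s, t) \<in> (relator_graph Dual n X)\<^sup>*"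
proof -
  obtain i j l m where ij: "s = (i, j)" and lm: "t = (l, m)" by (cases s; cases t)
  consider "s = t" | "i < l \<or> i = l \<and> j < m" | "l < i \<or> l = i \<and> m < j" using ij lm by (auto, linarith)
  then show ?thesis
    using noncrossing_connected_ordered[OF X, of i j l m] noncrossing_connected_ordered[OF X, of l m i j]
      sym_relator_graph s t unfolding ij lm by cases auto
qed

lemma simple_automaton_noncrossing:
  "simple_automaton Dual n (noncrossing n) (\<lambda>X. X) cut_at {} (gens Dual n) card (kreweras n)"
proof
  fix s X assume X: "X \<in> noncrossing n" and s: "s \<in> X"
  have sub: "X \<subseteq> gens Dual n" using noncrossing_subset[OF X] .
  then show "cut_at s X \<in> noncrossing n" using cut_at_noncrossing X s by blast
  have "cut_at s X \<subset> X" using not_compatible_self s sub unfolding cut_at_def by blast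
  then show "card (cut_at s X) < card X" using finite_subset[OF sub finite_gens] psubset_card_mono by blast
next
  fix s t
  assume st: "s \<in> gens Dual n" "t \<in> gens Dual n"
    "kreweras n (cut_at s (gens Dual n)) \<inter> kreweras n (cut_at t (gens Dual n)) \<noteq> {}"
  then have "rotate_chord n s = rotate_chord n t" using kreweras_cut_gens by blast
  then show "s = t" using rotate_chord_inj st by blast
next
  fix X s assume "X \<in> noncrossing n" "s \<in> gens Dual n" "X \<subseteq> cut_at s (gens Dual n)"
  then show "\<exists>Y\<in>noncrossing n. s \<in> Y \<and> cut_at s Y = X" by (rule noncrossing_multiple_exists)
next
  fix s t u v X assume "(s # u, t # v) \<in> rels Dual n" "s \<in> X" "t \<in> X"
  then show "run_cut (s # u) X \<noteq> None" by (rule run_cut_rels_defined)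
qed (simp_all add: empty_noncrossing gens_noncrossing noncrossing_subset run_cut_rels noncrossing_connected
    run_cut_kreweras del: run.simps)

lemma lattice_automaton_noncrossing:
  "lattice_automaton Dual n (noncrossing n) (\<lambda>X. X) cut_at {} (gens Dual n) card (kreweras n)"
proof -
  interpret simple_automaton Dual n "noncrossing n" "\<lambda>X. X" cut_at "{}" "gens Dual n" card "kreweras n"
    by (rule simple_automaton_noncrossing)
  show ?thesis
  proof
    fix s t assume st: "s \<in> \<Sigma>" "t \<in> \<Sigma>"
    define J where "J = left_polar n (kreweras n {s, t})"
    have J: "J \<in> noncrossing n" unfolding J_def by (rule left_polar_kreweras_noncrossing)
    then obtain w where w: "run_cut w J = Some {}" using run_to_unit_exists by blast
    have "below J X" if "X \<in> noncrossing n" "s \<in> X" "t \<in> X" for X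
    proof -
      have "J \<subseteq> left_polar n (kreweras n X)"
        unfolding J_def by (intro left_polar_antimono kreweras_antimono) (use that in blast)
      then have "J \<subseteq> X" using left_polar_kreweras that(1) by simp
      then show ?thesis using run_cut_mono[OF w] w unfolding below_def by blast
    qed
    moreover have "s \<in> J" "t \<in> J" using st unfolding J_def left_polar_def kreweras_def by auto
    ultimately show "\<exists>j\<in>noncrossing n. s \<in> j \<and> t \<in> j \<and> (\<forall>x\<in>noncrossing n. s \<in> x \<longrightarrow> t \<in> x \<longrightarrow> below j x)"
      using J by blast
  qed
qed

subsection \<open>Irreducibility of the dual braid monoid\<close>

abbreviation noncrossing_arrows :: "nat \<Rightarrow> (gen set \<times> gen set) set" where
  "noncrossing_arrows n \<equiv> state_arrows (noncrossing n) (\<lambda>X. X) (kreweras n)"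

definition mirror_pairs :: "nat \<Rightarrow> gen set" where
  "mirror_pairs n = {(a, b) \<in> gens Dual n. a + b = n + 1}"

lemma noncrossing_arrowsI:
  assumes "X \<in> noncrossing n" "Y \<in> noncrossing n" "\<And>t. t \<in> Y \<Longrightarrow> \<exists>s\<in>X. \<not> compatible s t"
  shows "(X, Y) \<in> noncrossing_arrows n"
  using assms unfolding state_arrows_def kreweras_def by blast

lemma singleton_arrowI:
  assumes "s \<in> gens Dual n" "t \<in> gens Dual n" "\<not> compatible s t" shows "({s}, {t}) \<in> noncrossing_arrows n"
  using assms singleton_noncrossing by (intro noncrossing_arrowsI) auto

lemma mirror_pairs_noncrossing: "mirror_pairs n \<in> noncrossing n"
proof (rule noncrossingI)
  let ?Y = "{(x, y) \<in> gens Dual n. x + y = n}"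
  show "?Y \<subseteq> gens Dual n" by blast
  have "a + b = n + 1" if s: "(a, b) \<in> left_polar n ?Y" for a b
  proof -
    have ab: "1 \<le> a" "a < b" "b \<le> n" and compatible: "\<And>t. t \<in> ?Y \<Longrightarrow> compatible (a, b) t"
      using s unfolding left_polar_def by (auto simp: mem_gens_Dual_iff)
    have Y: "compatible (a, b) (x, n - x)" if "1 \<le> x" "x < n" for x
    proof (cases x "n - x" rule: linorder_cases)
      case less
      then show ?thesis using compatible[of "(x, n - x)"] that by (auto simp: mem_gens_Dual_iff)
    next
      case greater
      then show ?thesis using compatible[of "(n - x, x)"] that compatible_sym(2) by (auto simp: mem_gens_Dual_iff)
    qed simp
    have "n + 1 \<le> a + b" using Y[of a] ab by (simp, linarith)
    moreover have "a + b \<le> n + 1" using Y[of "b - 1"] ab by (simp, linarith)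
    ultimately show ?thesis by simp
  qed
  then have "left_polar n ?Y \<subseteq> mirror_pairs n" unfolding mirror_pairs_def left_polar_def by blast
  moreover have "compatible (a, b) (x, y)" if "(a, b) \<in> mirror_pairs n" "(x, y) \<in> ?Y" for a b x y
    using that by (auto simp: mirror_pairs_def mem_gens_Dual_iff)
  then have "mirror_pairs n \<subseteq> left_polar n ?Y" unfolding left_polar_def mirror_pairs_def by blast
  ultimately show "mirror_pairs n = left_polar n ?Y" by blast
qed

lemma noncrossing_arrows_singletons:
  assumes s: "s \<in> gens Dual n" and n: "3 \<le> n"
  shows "({s}, {(1, n div 2 + 1)}) \<in> (noncrossing_arrows n)\<^sup>*"
proof -
  obtain i j where ij: "s = (i, j)" "1 \<le> i" "i < j" "j \<le> n" using s by (cases s) (auto simp: mem_gens_Dual_iff)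
  have first: "({(1, l)}, {(1, n)}) \<in> noncrossing_arrows n" if "1 < l" "l \<le> n" for l
    using that by (intro singleton_arrowI) (auto simp: mem_gens_Dual_iff)
  have "({s}, {(1, n)}) \<in> (noncrossing_arrows n)\<^sup>*"
  proof (cases "i = 1")
    case True
    then show ?thesis using first ij by blast
  next
    case False
    then have "({s}, {(1, i)}) \<in> noncrossing_arrows n"
      using ij by (intro singleton_arrowI) (auto simp: mem_gens_Dual_iff)
    then show ?thesis using first[of i] False ij by (auto intro: converse_rtrancl_into_rtrancl)
  qed
  also have "({(1, n)}, {(2, n)}) \<in> noncrossing_arrows n"
    using n by (intro singleton_arrowI) (auto simp: mem_gens_Dual_iff)
  also have "({(2, n)}, {(1, n div 2 + 1)}) \<in> noncrossing_arrows n"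
    using n by (intro singleton_arrowI) (auto simp: mem_gens_Dual_iff)
  finally show ?thesis .
qed

lemma noncrossing_arrows_halves:
  assumes n: "2 \<le> n"
  shows "({(1, n div 2 + 1)}, cut_at (1, n div 2 + 1) (gens Dual n)) \<in> (noncrossing_arrows n)\<^sup>*"
proof -
  let ?m = "n div 2"
  have s: "(1, ?m + 1) \<in> gens Dual n" using n by (auto simp: mem_gens_Dual_iff)
  have "({(1, ?m + 1)}, mirror_pairs n) \<in> noncrossing_arrows n"
    using singleton_noncrossing[OF s] mirror_pairs_noncrossing
    by (rule noncrossing_arrowsI) (auto simp: mirror_pairs_def mem_gens_Dual_iff)
  also have "(mirror_pairs n, cut_at (1, ?m + 1) (gens Dual n)) \<in> noncrossing_arrows n"
    using mirror_pairs_noncrossing cut_at_noncrossing[OF s gens_noncrossing]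
  proof (rule noncrossing_arrowsI)
    fix t assume cut: "t \<in> cut_at (1, ?m + 1) (gens Dual n)"
    obtain a b where ab: "t = (a, b)" by (cases t)
    then have t: "t = (a, b)" "1 \<le> a" "a < b" "b \<le> n" "\<not> (a \<le> ?m \<and> ?m < b)"
      using cut by (auto simp: cut_at_def mem_gens_Dual_iff)
    show "\<exists>s\<in>mirror_pairs n. \<not> compatible s t"
    proof (cases "b \<le> ?m")
      case True
      then have "(b, n + 1 - b) \<in> mirror_pairs n" "\<not> compatible (b, n + 1 - b) t"
        using t by (auto simp: mirror_pairs_def mem_gens_Dual_iff)
      then show ?thesis by blast
    next
      case False
      then have "(n + 1 - b, b) \<in> mirror_pairs n" "\<not> compatible (n + 1 - b, b) t"
        using t by (auto simp: mirror_pairs_def mem_gens_Dual_iff)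
      then show ?thesis by blast
    qed
  qed
  finally show ?thesis by auto
qed

lemma irreducible_garside_Dual: assumes n: "2 \<le> n" shows "irreducible_garside Dual n"
proof -
  interpret lattice_automaton Dual n "noncrossing n" "\<lambda>X. X" cut_at "{}" "gens Dual n" card "kreweras n"
    by (rule lattice_automaton_noncrossing)
  let ?h = "(1, n div 2 + 1)"
  have h: "?h \<in> \<Sigma>" using n by (auto simp: mem_gens_Dual_iff)
  show ?thesis
  proof (rule irreducible_garsideI)
    show "\<Sigma> \<noteq> {}" using h by blast
    fix s assume s: "s \<in> \<Sigma>"
    have "({s}, {?h}) \<in> (noncrossing_arrows n)\<^sup>*"
    proof (cases "n = 2")
      case True
      then have "s = ?h" using s by (cases s) (auto simp: mem_gens_Dual_iff)
      then show ?thesis by simp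
    qed (use noncrossing_arrows_singletons s n in simp)
    then have path: "({s}, cut_at ?h \<Sigma>) \<in> (noncrossing_arrows n)\<^sup>*"
      using noncrossing_arrows_halves[OF n] by (rule rtrancl_trans)
    have "kreweras n (cut_at ?h \<Sigma>) \<subseteq> {rotate_chord n ?h}" using kreweras_cut_gens[OF h] by blast
    then have "card (kreweras n (cut_at ?h \<Sigma>)) \<le> 1" using card_mono[of "{rotate_chord n ?h}"] by fastforce
    moreover have "run_cut [s] {s} = Some {}" using not_compatible_self[OF s] by (auto simp: cut_at_def)
    ultimately show "\<exists>x z. x \<in> noncrossing n \<and> run_cut [s] x = Some {} \<and>
        (x, z) \<in> (noncrossing_arrows n)\<^sup>* \<and> card (kreweras n z) \<le> 1"
      using singleton_noncrossing[OF s] path by blast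
  qed
qed

section \<open>Uniform measures on the braid monoids\<close>

theorem theorem4p8:
  fixes k :: mkind and n :: nat and p :: real
  assumes "n \<ge> 2" and "p \<ge> 0"
  shows "((\<exists>\<nu>. uniform k n p \<nu>) \<longleftrightarrow> (p \<le> qn k n \<or> p = 1))
    \<and> ((p \<le> qn k n \<or> p = 1) \<longrightarrow> (\<exists>!\<nu>. uniform k n p \<nu>))
    \<and> (\<forall>\<nu>. uniform k n 0 \<nu> \<longrightarrow> \<nu> = return (Bbar k n) (nfs k n (unit_e k n)))
    \<and> (\<forall>\<nu>. uniform k n 1 \<nu> \<longrightarrow> \<nu> = return (Bbar k n) (\<lambda>_. Delta k n))
    \<and> (0 < p \<and> p < qn k n \<longrightarrow>
         (\<forall>\<nu>. uniform k n p \<nu> \<longrightarrow> measure \<nu> (Mimg k n) = 1 \<and>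
              (\<forall>x\<in>Mon k n. measure \<nu> {nfs k n x} = Hn k n p * p ^ blen x))
       \<and> (\<forall>\<nu>. prob_on k n \<nu> \<longrightarrow>
            ((\<forall>x\<in>Mon k n. measure \<nu> {nfs k n x} = Hn k n p * p ^ blen x)
              \<longleftrightarrow> uniform k n p \<nu>)))
    \<and> (p = qn k n \<longrightarrow>
         (\<forall>\<nu>. uniform k n p \<nu> \<longrightarrow> measure \<nu> (bdry k n) = 1)
       \<and> (\<forall>\<nu>. prob_on k n \<nu> \<longrightarrow>
            ((\<forall>x\<in>Mon k n. measure \<nu> (up k n x) = qn k n ^ blen x)
              \<longleftrightarrow> uniform k n p \<nu>)))"
proof -
  interpret irreducible_garside k n
    using irreducible_garside_Artin irreducible_garside_Dual assms(1) by (cases k) auto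
  show ?thesis
  proof (intro conjI impI allI)
    show existence: "(\<exists>\<nu>. uniform k n p \<nu>) \<longleftrightarrow> p \<le> q \<or> p = 1" using uniform_exists_iff assms(2) .
    show "\<exists>!\<nu>. uniform k n p \<nu>" if "p \<le> q \<or> p = 1" using that existence uniform_unique by blast
    show "\<nu> = return (Bbar k n) (nfs k n \<one>)" if "uniform k n 0 \<nu>" for \<nu>
      using uniform_unique[OF that uniform_0] .
    show "\<nu> = return (Bbar k n) (\<lambda>_. \<Delta>)" if "uniform k n 1 \<nu>" for \<nu>
      using uniform_unique[OF that uniform_1] .
  next
    fix \<nu> assume p: "0 < p \<and> p < q" and \<nu>: "uniform k n p \<nu>"
    show "\<forall>x\<in>M. measure \<nu> {nfs k n x} = Hn k n p * p ^ blen x" using uniform_singleton[OF \<nu>] by blast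
    then show "measure \<nu> (Mimg k n) = 1" using measure_Mimg_eq_1 p assms(2) uniform_prob_on[OF \<nu>] by blast
  next
    fix \<nu> assume "0 < p \<and> p < q" "prob_on k n \<nu>"
    then show "(\<forall>x\<in>M. measure \<nu> {nfs k n x} = Hn k n p * p ^ blen x) \<longleftrightarrow> uniform k n p \<nu>"
      using uniform_iff_singletons assms(2) by simp
  next
    fix \<nu> assume p: "p = q"
    show "measure \<nu> (bdry k n) = 1" if "uniform k n p \<nu>" using that uniform_q_bdry unfolding p by blast
    show "(\<forall>x\<in>M. measure \<nu> (up k n x) = q ^ blen x) \<longleftrightarrow> uniform k n p \<nu>" if "prob_on k n \<nu>"
      using uniform_q_iff_up[OF that] unfolding p by blast
  qed
qed

end
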